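(* Let $m,n$ be positive integers, let $\lambda=(\lambda_1,\lambda_2,\ldots,\lambda_\ell)$ be a partition of $mn$ and let $q\in\mathbb{N}_0$ be minimal such that $0\leq\lambda_{q+1}\leq m$. Define $\tilde\lambda:=(\lambda_1,\ldots,\lambda_q,m,\lambda_{q+1},\ldots,\lambda_\ell)$ if $q\neq 0$ and $\tilde\lambda:=(m,\lambda_1,\ldots,\lambda_\ell)$ if $q=0$. \begin{enumerate} \item If $m$ is even, then $p^{\lambda}_{(n),(m)}\leq p^{\tilde\lambda}_{(n+1),(m)}$. \item If $m$ is odd, then $p^{\lambda}_{(1^n),(m)}\leq p^{\tilde\lambda}_{(1^{n+1}),(m)}$. \end{enumerate}
   Context: For a partition $\lambda$ with $\ell$ parts, $\lambda_i:=0$ for $i>\ell$. For partitions $\nu\vdash n$ and $\mu\vdash m$, the plethysm coefficients $p^\lambda_{\nu,\mu}$ (for $\lambda\vdash mn$) are the integers defined by the expansion in Schur functions $s_\nu\circ s_\mu=\sum_{\lambda\vdash mn}p^\lambda_{\nu,\mu}s_\lambda$, where $\circ$ is plethysm of symmetric functions. Equivalently, when $\mu=(m)$, $p^\lambda_{\nu,(m)}$ is the multiplicity of the Specht module $S^\lambda$ in the $\mathbb{C}\mathfrak{S}_{mn}$-module $H^{(m^n)}_\nu=\big(\mathrm{Inf}\, S^\nu\big)\big\uparrow_{\mathfrak{S}_m\wr\mathfrak{S}_n}^{\mathfrak{S}_{mn}}$, where $\mathrm{Inf}\,S^\nu$ is the inflation of the Specht module $S^\nu$ of $\mathfrak{S}_n$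 along the canonical surjection $\mathfrak{S}_m\wr\mathfrak{S}_n\to\mathfrak{S}_n$. ($S^{(n)}$ is the trivial module and $S^{(1^n)}$ is the sign module of $\mathfrak{S}_n$.) *)

theory Defs
  imports Complex_Main "HOL-Library.Poly_Mapping"
begin

definition is_partition_of :: "nat list \<Rightarrow> nat \<Rightarrow> bool" where
  "is_partition_of lam N \<longleftrightarrow>
     sorted_wrt (\<ge>) lam \<and> (\<forall>k \<in> set lam. 0 < k) \<and> sum_list lam = N"

text \<open>Parts are numbered from 1, and the parts beyond the length are 0.\<close>

definition part :: "nat list \<Rightarrow> nat \<Rightarrow> nat" where
  "part lam i = (if 1 \<le> i \<and> i \<le> length lam then lam ! (i - 1) else 0)"

text \<open>
  A monomial in the variables \<open>x\<^sub>0, x\<^sub>1, x\<^sub>2, \<dots>\<close> is its finitely supported exponent vector, so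
  that the product of monomials is the sum of exponent vectors. A formal series is the function
  giving the coefficient of each monomial.
\<close>

type_synonym monomial = "nat \<Rightarrow>\<^sub>0 nat"
type_synonym series = "monomial \<Rightarrow> int"

definition cells :: "nat list \<Rightarrow> (nat \<times> nat) set" where
  "cells lam = {(i, j). i < length lam \<and> j < lam ! i}"

text \<open>Fillings are normalised to be 0 outside the diagram so that tableaux can be counted.\<close>

definition semistandard :: "nat list \<Rightarrow> (nat \<Rightarrow> nat \<Rightarrow> nat) \<Rightarrow> bool" where
  "semistandard lam T \<longleftrightarrow>
     (\<forall>i j. (i, j) \<notin> cells lam \<longrightarrow> T i j = 0) \<and>
     (\<forall>i j. (i, Suc j) \<in> cells lam \<longrightarrow> T i j \<le> T i (Suc j)) \<and>
     (\<forall>i j. (Suc i, j) \<in> cells lam \<longrightarrow> T i j < T (Suc i) j)"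

definition tableau_monomial :: "nat list \<Rightarrow> (nat \<Rightarrow> nat \<Rightarrow> nat) \<Rightarrow> monomial" where
  "tableau_monomial lam T = (\<Sum>(i, j) \<in> cells lam. Poly_Mapping.single (T i j) 1)"

definition schur :: "nat list \<Rightarrow> series" where
  "schur lam a = int (card {T. semistandard lam T \<and> tableau_monomial lam T = a})"

text \<open>
  Plethysm by substitution of monomials: if \<open>g\<close> is a sum of monomials \<open>\<Sum>i \<in> I. \<theta> i\<close> (each
  repeated according to its coefficient in \<open>g\<close>), then \<open>f \<circ> g\<close> is obtained from \<open>f\<close> by
  \<open>x\<^sub>i \<mapsto> \<theta> i\<close> for \<open>i \<in> I\<close> and \<open>x\<^sub>i \<mapsto> 0\<close> for \<open>i \<notin> I\<close>. For symmetric \<open>f\<close> the result does not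
  depend on the chosen enumeration. An enumeration exists exactly when all coefficients of \<open>g\<close>
  are nonnegative, as for Schur functions; for other \<open>g\<close> the value of \<open>plethysm f g\<close> is
  meaningless.
\<close>

definition enumerates :: "nat set \<Rightarrow> (nat \<Rightarrow> monomial) \<Rightarrow> series \<Rightarrow> bool" where
  "enumerates I \<theta> g \<longleftrightarrow>
     (\<forall>a. finite {i \<in> I. \<theta> i = a} \<and> int (card {i \<in> I. \<theta> i = a}) = g a)"

definition monomial_subst :: "(nat \<Rightarrow> monomial) \<Rightarrow> monomial \<Rightarrow> monomial" where
  "monomial_subst \<theta> c =
     (\<Sum>i \<in> Poly_Mapping.keys c. Poly_Mapping.map ((*) (Poly_Mapping.lookup c i)) (\<theta> i))"

text \<open>
  The condition \<open>f c \<noteq> 0\<close> makes the index set finite when \<open>f\<close> has bounded degree, even if some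
  \<open>\<theta> i\<close> is the monomial 1.
\<close>

definition series_subst :: "nat set \<Rightarrow> (nat \<Rightarrow> monomial) \<Rightarrow> series \<Rightarrow> series" where
  "series_subst I \<theta> f b =
     (\<Sum>c | Poly_Mapping.keys c \<subseteq> I \<and> monomial_subst \<theta> c = b \<and> f c \<noteq> 0. f c)"

definition plethysm :: "series \<Rightarrow> series \<Rightarrow> series" where
  "plethysm f g = (case SOME (I, \<theta>). enumerates I \<theta> g of (I, \<theta>) \<Rightarrow> series_subst I \<theta> f)"

definition plethysm_coeff :: "nat list \<Rightarrow> nat list \<Rightarrow> nat list \<Rightarrow> int" where
  "plethysm_coeff nu mu =
     (THE p.
        (\<forall>b. plethysm (schur nu) (schur mu) b =
               (\<Sum>lam | is_partition_of lam (sum_list mu * sum_list nu). p lam * schur lam b)) \<and>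
        (\<forall>lam. \<not> is_partition_of lam (sum_list mu * sum_list nu) \<longrightarrow> p lam = 0))"

end

theory Submission
  imports Defs "HOL-Library.Multiset" "HOL-Library.Countable" "HOL-Combinatorics.Transposition"
begin

text \<open>
  Applying the involution that conjugates Schur functions, both statements concern the multiplicity
  of the conjugate partition in \<open>Sym\<^sup>n(\<Lambda>\<^sup>m)\<close>, and inserting a row of length \<open>m\<close> becomes adding a column
  of length \<open>m\<close>. There the inequality is clear: multiplication by the highest weight vector
  \<open>e\<^sub>0 \<and> \<dots> \<and> e\<^sub>m\<^sub>-\<^sub>1\<close> of \<open>\<Lambda>\<^sup>m\<close> is an injection of highest weight spaces, since \<open>Sym(\<Lambda>\<^sup>m)\<close> is a
  polynomial ring.

  Schur multiplicities are identified with dimensions of highest weight spaces by a trace form of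
  Freudenthal's argument. If \<open>P\<close> commutes with \<open>gl\<^sub>N\<close> and \<open>T\<^sub>P\<close> is the generating function of
  the traces of \<open>P\<close> on the weight spaces, then multiplying \<open>P\<close> by the Casimir operator multiplies the
  coefficient of \<open>x\<^sup>\<lambda>\<^sup>+\<^sup>\<delta>\<close> in \<open>V T\<^sub>P\<close> (\<open>V\<close> the Vandermonde product) by the Casimir eigenvalue \<open>c(\<lambda>)\<close>.
  For \<open>P\<close> the product of all \<open>Casimir - c(\<mu>)\<close> with \<open>\<mu>\<close> strictly dominating \<open>\<lambda>\<close>, the operator \<open>P\<close> is, up to
  a nonzero scalar, the projection of the weight space \<open>\<lambda>\<close> onto its highest weight vectors.

  The conjugation is carried out by counting objects over an alphabet with even and odd letters:
  both the plethysm and the chains of strips (semistandard tableaux) admit a sign-reversing toggle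
  between an even letter and an adjacent odd one, so an expansion known for odd letters
  transfers to even letters, where it is the Schur expansion of the plethysm.
\<close>

section \<open>Polynomials and the Vandermonde product\<close>

text \<open>The split by the parity of \<open>m\<close> comes from the conjugating involution: it
  sends \<open>h_n\<close> composed with \<open>h_m\<close> (\<open>m\<close> even) and
  \<open>e_n\<close> composed with \<open>h_m\<close> (\<open>m\<close> odd) to the same function
  \<open>h_n\<close> composed with \<open>e_m\<close>, the character of Sym^n of Lambda^m. One
  number, \<open>pcoef\<close>, therefore serves both claims. The obstacle is that plethysm
  coefficients are given by counting tableaux, while the injection lives on highest weight vectors.
  The Casimir operator bridges the two without complete reducibility or irreducible characters: only
  traces on weight spaces with an explicit basis occur. The product over dominating weights works
  because the Casimir eigenvalue increases strictly above a decreasing weight. Hence no factor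
  vanishes on the highest weight vectors of weight \<open>l\<close>, while every strictly higher
  weight space is annihilated. Conjugation does not act on single monomials, so it cannot be read
  off coefficient by coefficient. Mixed alphabets make it a sequence of small steps, each turning
  copies of one letter from odd to even.\<close>

abbreviation lk :: "('a \<Rightarrow>\<^sub>0 'b::zero) \<Rightarrow> 'a \<Rightarrow> 'b" where "lk \<equiv> Poly_Mapping.lookup"
abbreviation sg :: "'a \<Rightarrow> 'b::zero \<Rightarrow> 'a \<Rightarrow>\<^sub>0 'b" where "sg \<equiv> Poly_Mapping.single"

lemma poly_mapping_sum_single:
  fixes p :: "'a \<Rightarrow>\<^sub>0 'b::comm_monoid_add"
  assumes "finite A" "Poly_Mapping.keys p \<subseteq> A"
  shows "p = (\<Sum>c\<in>A. sg c (lk p c))"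
proof (rule poly_mapping_eqI)
  fix k
  have "lk (\<Sum>c\<in>A. sg c (lk p c)) k = (\<Sum>c\<in>A. if c = k then lk p c else 0)"
    unfolding lookup_sum by (intro sum.cong refl) (simp add: lookup_single when_def)
  also have "\<dots> = lk p k" using assms by (auto simp: in_keys_iff)
  finally show "lk p k = lk (\<Sum>c\<in>A. sg c (lk p c)) k" by simp
qed

lemma poly_mapping_single_induct [case_names zero single add]:
  fixes p :: "'a \<Rightarrow>\<^sub>0 'b::comm_monoid_add"
  assumes "P 0" "\<And>c r. P (sg c r)" "\<And>p q. P p \<Longrightarrow> P q \<Longrightarrow> P (p + q)"
  shows "P p"
proof -
  have "P (\<Sum>c\<in>A. sg c (lk p c))" if "finite A" for A
    using that by (induction A rule: finite_induct) (auto intro: assms)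
  from this[of "Poly_Mapping.keys p"] show ?thesis
    using poly_mapping_sum_single[of "Poly_Mapping.keys p" p] by simp
qed

lemma lookup_single_mult:
  fixes p :: "'a::cancel_comm_monoid_add \<Rightarrow>\<^sub>0 'b::comm_semiring_0"
  shows "lk (sg d r * p) (d + c) = r * lk p c"
  by (induction p rule: poly_mapping_single_induct)
     (auto simp: mult_single lookup_single lookup_add ring_distribs when_def distrib_left)

lemma lookup_single_mult_0:
  fixes p :: "'a::cancel_comm_monoid_add \<Rightarrow>\<^sub>0 'b::comm_semiring_0"
  assumes "\<And>c'. c \<noteq> d + c'"
  shows "lk (sg d r * p) c = 0"
  using assms
  by (induction p rule: poly_mapping_single_induct)
     (auto simp: mult_single lookup_single lookup_add when_def distrib_left)

lemma lookup_mult_sum: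
  fixes p q :: "'a::cancel_comm_monoid_add \<Rightarrow>\<^sub>0 'b::comm_semiring_0"
  assumes "finite A" "Poly_Mapping.keys p \<subseteq> A" "finite B" "Poly_Mapping.keys q \<subseteq> B"
  shows "lk (p * q) c = (\<Sum>a\<in>A. \<Sum>b\<in>B. if a + b = c then lk p a * lk q b else 0)"
proof -
  have "p * q = (\<Sum>a\<in>A. \<Sum>b\<in>B. sg (a + b) (lk p a * lk q b))"
    by (subst (1) poly_mapping_sum_single[OF assms(1,2)], subst (1) poly_mapping_sum_single[OF assms(3,4)])
       (simp add: sum_product mult_single)
  thus ?thesis by (simp add: lookup_sum lookup_single when_def)
qed

text \<open>Monomials are multisets of variables, so that a weight of the representation below is
  literally a monomial.\<close>

type_synonym mpoly = "nat multiset \<Rightarrow>\<^sub>0 real"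

definition X :: "nat \<Rightarrow> mpoly" where "X i = sg {#i#} 1"

lemma lookup_X_mult: "lk (X i * p) c = (if i \<in># c then lk p (c - {#i#}) else 0)"
proof (cases "i \<in># c")
  case True
  then obtain d where "c = add_mset i d" by (metis mset_add)
  thus ?thesis using lookup_single_mult[of "{#i#}" 1 p d] by (simp add: X_def)
next
  case False
  thus ?thesis by (auto simp: X_def intro!: lookup_single_mult_0)
qed

text \<open>The derivation X_i d/dX_i. Being diagonal on monomials, it multiplies the coefficient of
  a weight by the i-th entry of the weight.\<close>

definition euler :: "nat \<Rightarrow> mpoly \<Rightarrow> mpoly" where
  "euler i p = Poly_Mapping.mapp (\<lambda>c r. real (count c i) * r) p"

lemma lookup_euler: "lk (euler i p) c = real (count c i) * lk p c"
  by (auto simp: euler_def lookup_mapp in_keys_iff when_def)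

lemma euler_add: "euler i (p + q) = euler i p + euler i q"
  by (rule poly_mapping_eqI) (simp add: lookup_euler lookup_add algebra_simps)

lemma euler_diff: "euler i (p - q) = euler i p - euler i q"
  by (rule poly_mapping_eqI) (simp add: lookup_euler lookup_minus algebra_simps)

lemma euler_0 [simp]: "euler i 0 = 0"
  by (rule poly_mapping_eqI) (simp add: lookup_euler)

lemma euler_single: "euler i (sg c r) = sg c (real (count c i) * r)"
  by (rule poly_mapping_eqI) (simp add: lookup_euler lookup_single when_def)

lemma euler_1 [simp]: "euler i 1 = 0"
  using euler_single[of i 0 1] by simp

lemma euler_X: "euler i (X j) = (if i = j then X j else 0)"
  by (simp add: X_def euler_single)

lemma euler_mult: "euler i (p * q) = euler i p * q + p * euler i q"
proof (induction p rule: poly_mapping_single_induct)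
  case (single c r)
  show ?case
    by (induction q rule: poly_mapping_single_induct)
       (simp_all add: euler_single mult_single euler_add distrib_left single_add[symmetric] algebra_simps)
qed (simp_all add: euler_add distrib_right)

lemma euler_prod:
  assumes "finite S"
  shows "euler i (\<Prod>s\<in>S. f s) = (\<Sum>s\<in>S. euler i (f s) * (\<Prod>t\<in>S - {s}. f t))"
  using assms
proof (induction S rule: finite_induct)
  case (insert x S)
  have "(\<Sum>s\<in>S. euler i (f s) * (\<Prod>t\<in>insert x S - {s}. f t))
      = (\<Sum>s\<in>S. f x * (euler i (f s) * (\<Prod>t\<in>S - {s}. f t)))"
  proof (intro sum.cong refl)
    fix s assume "s \<in> S"
    hence "insert x S - {s} = insert x (S - {s})" using insert by auto
    thus "euler i (f s) * (\<Prod>t\<in>insert x S - {s}. f t) = f x * (euler i (f s) * (\<Prod>t\<in>S - {s}. f t))"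
      using insert by simp
  qed
  thus ?case using insert by (simp add: euler_mult sum_distrib_left)
qed simp

text \<open>\<open>map_key\<close> pulls coefficients back, which amounts to renaming by the inverse
  map; it is only applied to transpositions, where the two agree.\<close>

definition rename_vars :: "(nat \<Rightarrow> nat) \<Rightarrow> mpoly \<Rightarrow> mpoly" where
  "rename_vars f p = Poly_Mapping.map_key (image_mset f) p"

lemma inj_image_mset_transpose: "inj (image_mset (transpose i j))"
  by (metis inj_on_inverseI multiset.map_comp multiset.map_id transpose_comp_involutory)

lemma image_mset_transpose_twice [simp]:
  "image_mset (transpose i j) (image_mset (transpose i j) c) = c"
  by (simp add: multiset.map_comp)

lemma count_image_transpose: "count (image_mset (transpose i j) c) x = count c (transpose i j x)"
  by (induction c) (auto simp: transpose_def)

lemma lookup_ren: "lk (rename_vars (transpose i j) p) c = lk p (image_mset (transpose i j) c)"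
  by (simp add: rename_vars_def map_key.rep_eq inj_image_mset_transpose)

lemma ren_single: "rename_vars (transpose i j) (sg c r) = sg (image_mset (transpose i j) c) r"
  by (rule poly_mapping_eqI) (auto simp: lookup_ren lookup_single when_def)

lemma ren_add: "rename_vars (transpose i j) (p + q) = rename_vars (transpose i j) p + rename_vars (transpose i j) q"
  by (rule poly_mapping_eqI) (simp add: lookup_ren lookup_add)

lemma ren_diff: "rename_vars (transpose i j) (p - q) = rename_vars (transpose i j) p - rename_vars (transpose i j) q"
  by (rule poly_mapping_eqI) (simp add: lookup_ren lookup_minus)

lemma ren_0 [simp]: "rename_vars (transpose i j) 0 = 0"
  by (rule poly_mapping_eqI) (simp add: lookup_ren)

lemma ren_mult: "rename_vars (transpose i j) (p * q) = rename_vars (transpose i j) p * rename_vars (transpose i j) q"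
proof (induction p rule: poly_mapping_single_induct)
  case (single c r)
  show ?case
    by (induction q rule: poly_mapping_single_induct)
       (simp_all add: ren_single mult_single ren_add distrib_left)
qed (simp_all add: ren_add distrib_right)

lemma ren_prod: "rename_vars (transpose i j) (\<Prod>s\<in>S. f s) = (\<Prod>s\<in>S. rename_vars (transpose i j) (f s))"
proof (induction S rule: infinite_finite_induct)
  case empty
  show ?case using ren_single[of i j 0 1] by simp
next
  case (infinite A)
  then show ?case using ren_single[of i j 0 1] by simp
qed (simp_all add: ren_mult)

lemma ren_X: "rename_vars (transpose i j) (X k) = X (transpose i j k)"
  by (simp add: X_def ren_single)

section \<open>The Vandermonde product and its antisymmetry\<close>

definition pairs :: "nat \<Rightarrow> (nat \<times> nat) set" where "pairs N = {(a, b). a < b \<and> b < N}"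

definition V :: "nat \<Rightarrow> mpoly" where "V N = (\<Prod>(a, b)\<in>pairs N. X a - X b)"

lemma finite_pairs [simp]: "finite (pairs N)"
  by (rule finite_subset[of _ "{..<N} \<times> {..<N}"]) (auto simp: pairs_def)

lemma pairs_Suc: "pairs (Suc N) = pairs N \<union> (\<lambda>a. (a, N)) ` {..<N}"
  by (auto simp: pairs_def)

lemma V_0 [simp]: "V 0 = 1"
  by (simp add: V_def pairs_def)

lemma V_Suc: "V (Suc N) = V N * (\<Prod>a<N. X a - X N)"
proof -
  have "pairs N \<inter> (\<lambda>a. (a, N)) ` {..<N} = {}" by (auto simp: pairs_def)
  thus ?thesis
    by (simp add: V_def pairs_Suc prod.union_disjoint prod.reindex inj_on_def)
qed

text \<open>An adjacent transposition preserves the order inside every pair except (i, i+1). The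
  other factors are permuted and this one changes sign.\<close>

lemma ren_V:
  assumes "Suc i < N"
  shows "rename_vars (transpose i (Suc i)) (V N) = - V N"
proof -
  let ?t = "transpose i (Suc i)"
  let ?P = "pairs N - {(i, Suc i)}"
  have sub: "map_prod ?t ?t ` ?P \<subseteq> ?P"
    using assms by (auto simp: pairs_def transpose_def split: if_splits)
  have bij: "bij_betw (map_prod ?t ?t) ?P ?P"
    by (rule bij_betw_byWitness[OF _ _ sub sub]) auto
  have mem: "(i, Suc i) \<in> pairs N" using assms by (auto simp: pairs_def)
  have VN: "V N = (X i - X (Suc i)) * (\<Prod>(a, b)\<in>?P. X a - X b)"
    unfolding V_def by (subst prod.remove[OF finite_pairs mem]) simp
  have "rename_vars ?t (\<Prod>(a, b)\<in>?P. X a - X b) = (\<Prod>(a, b)\<in>?P. X (?t a) - X (?t b))"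
    unfolding ren_prod by (intro prod.cong) (auto simp: ren_diff ren_X)
  also have "\<dots> = (\<Prod>(a, b)\<in>?P. X a - X b)"
    using prod.reindex_bij_betw[OF bij, of "\<lambda>(a, b). X a - X b"] by (simp add: case_prod_beta)
  finally show ?thesis unfolding VN ren_mult ren_diff ren_X by (simp add: algebra_simps)
qed

lemma lookup_V_transpose:
  assumes "Suc i < N"
  shows "lk (V N) (image_mset (transpose i (Suc i)) c) = - lk (V N) c"
  using arg_cong[OF ren_V[OF assms], of "\<lambda>p. lk p c"] by (simp add: lookup_ren)

text \<open>Antisymmetry under a swap that fixes \<open>c\<close>. Only adjacent swaps are
  available, so the exponent at \<open>j\<close> is first carried down next to \<open>i\<close>; the
  signs on the way do not matter.\<close>

lemma lookup_V_eq_0: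
  assumes "i < j" "j < N" "count c i = count c j"
  shows "lk (V N) c = 0"
  using assms
proof (induction j arbitrary: c)
  case (Suc j)
  show ?case
  proof (cases "i = j")
    case True
    have "image_mset (transpose i (Suc i)) c = c"
    proof (rule multiset_eqI)
      fix x
      show "count (image_mset (transpose i (Suc i)) c) x = count c x"
        using Suc.prems True by (simp add: count_image_transpose transpose_def)
    qed
    with lookup_V_transpose[of i N c] Suc.prems True show ?thesis by simp
  next
    case False
    let ?t = "transpose j (Suc j)"
    have "lk (V N) (image_mset ?t c) = 0"
      using Suc.prems False by (intro Suc.IH) (auto simp: count_image_transpose transpose_def)
    thus ?thesis using lookup_V_transpose[of j N c] Suc.prems by simp
  qed
qed simp

text \<open>Weights need not be decreasing here, so this is the order of gl_N by positive roots:
  \<open>b - a\<close> is a sum of differences e_i - e_j with i < j.\<close>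

definition dominated :: "nat multiset \<Rightarrow> nat multiset \<Rightarrow> bool" where
  "dominated a b \<longleftrightarrow> size a = size b \<and> (\<forall>r. size (filter_mset (\<lambda>i. i < r) a) \<le> size (filter_mset (\<lambda>i. i < r) b))"

lemma dom_refl [simp]: "dominated a a" by (simp add: dominated_def)

lemma dom_trans: "dominated a b \<Longrightarrow> dominated b c \<Longrightarrow> dominated a c"
  by (auto simp: dominated_def intro: order_trans)

lemma dom_add: "dominated a b \<Longrightarrow> dominated c d \<Longrightarrow> dominated (a + c) (b + d)"
  by (auto simp: dominated_def intro: add_mono)

lemma size_filter_Suc: "size (filter_mset (\<lambda>i. i < Suc r) a) = size (filter_mset (\<lambda>i. i < r) a) + count a r"
  by (induction a) auto

lemma dom_antisym:
  assumes "dominated a b" "dominated b a" shows "a = b"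
proof (rule multiset_eqI)
  fix r
  have "size (filter_mset (\<lambda>i. i < r) a) = size (filter_mset (\<lambda>i. i < r) b)" for r
    using assms by (auto simp: dominated_def intro: antisym)
  from this[of r] this[of "Suc r"] show "count a r = count b r"
    by (simp add: size_filter_Suc)
qed

lemma dom_cancel: "dominated (a + c) (a + d) \<longleftrightarrow> dominated c d"
  by (simp add: dominated_def)

lemma dom_add_eq:
  assumes "dominated a b" "dominated c d" "a + c = b + d"
  shows "a = b \<and> c = d"
proof -
  have "dominated (b + d) (b + c)" using dom_add[OF assms(1) dom_refl[of c]] assms(3) by simp
  hence "dominated d c" by (simp add: dom_cancel)
  hence "c = d" using assms(2) dom_antisym by blast
  thus ?thesis using assms(3) by simp
qed

text \<open>A leading monomial with coefficient 1 for a partial order; \<open>dom_add_eq\<close>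
  makes the notion multiplicative.\<close>

definition monic_dom :: "mpoly \<Rightarrow> nat multiset \<Rightarrow> bool" where
  "monic_dom p d \<longleftrightarrow> lk p d = 1 \<and> (\<forall>c. lk p c \<noteq> 0 \<longrightarrow> dominated c d)"

lemma monic_dom_mult:
  assumes "monic_dom p d" "monic_dom q e"
  shows "monic_dom (p * q) (d + e)"
proof -
  let ?A = "Poly_Mapping.keys p" and ?B = "Poly_Mapping.keys q"
  have L: "lk (p * q) c = (\<Sum>a\<in>?A. \<Sum>b\<in>?B. if a + b = c then lk p a * lk q b else 0)" for c
    by (rule lookup_mult_sum) auto
  have d: "d \<in> ?A" "e \<in> ?B" using assms by (auto simp: monic_dom_def in_keys_iff)
  have "lk (p * q) (d + e) = (\<Sum>a\<in>?A. \<Sum>b\<in>?B. if a = d \<and> b = e then 1 else 0)"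
    unfolding L
  proof (intro sum.cong refl)
    fix a b assume "a \<in> ?A" "b \<in> ?B"
    hence "dominated a d" "dominated b e" using assms by (auto simp: monic_dom_def in_keys_iff)
    thus "(if a + b = d + e then lk p a * lk q b else 0) = (if a = d \<and> b = e then 1 else 0)"
      using dom_add_eq[of a d b e] assms by (cases "a + b = d + e") (auto simp: monic_dom_def)
  qed
  also have "\<dots> = (\<Sum>a\<in>?A. if a = d then (\<Sum>b\<in>?B. if b = e then 1 else 0) else 0)"
    by (intro sum.cong) auto
  also have "\<dots> = 1" using d by simp
  finally have 1: "lk (p * q) (d + e) = 1" .
  have "dominated c (d + e)" if "lk (p * q) c \<noteq> 0" for c
  proof -
    have "\<exists>a\<in>?A. \<exists>b\<in>?B. a + b = c"
    proof (rule ccontr)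
      assume "\<not> ?thesis"
      hence "lk (p * q) c = 0" unfolding L by (intro sum.neutral ballI) auto
      with that show False by simp
    qed
    thus ?thesis using assms by (auto simp: monic_dom_def in_keys_iff intro: dom_add)
  qed
  with 1 show ?thesis by (simp add: monic_dom_def)
qed

lemma monic_dom_X_diff:
  assumes "a < b" shows "monic_dom (X a - X b) {#a#}"
  using assms by (auto simp: monic_dom_def X_def lookup_minus lookup_single when_def dominated_def split: if_splits)

lemma monic_dom_prod:
  assumes "finite S" "\<And>s. s \<in> S \<Longrightarrow> monic_dom (f s) (d s)"
  shows "monic_dom (\<Prod>s\<in>S. f s) (\<Sum>s\<in>S. d s)"
  using assms
proof (induction S rule: finite_induct)
  case empty
  show ?case by (auto simp: monic_dom_def lookup_one when_def split: if_splits)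
qed (auto intro: monic_dom_mult)

definition mon :: "nat \<Rightarrow> (nat \<Rightarrow> nat) \<Rightarrow> nat multiset" where
  "mon N g = (\<Sum>i<N. replicate_mset (g i) i)"

lemma count_mon: "count (mon N g) i = (if i < N then g i else 0)"
proof -
  have "count (mon N g) i = (\<Sum>j<N. if j = i then g j else 0)"
    unfolding mon_def count_sum by (intro sum.cong) auto
  thus ?thesis by simp
qed

lemma set_mon: "set_mset (mon N g) \<subseteq> {..<N}"
  by (metis count_greater_zero_iff count_mon lessThan_iff not_gr_zero subsetI)

lemma mon_add: "mon N f + mon N g = mon N (\<lambda>i. f i + g i)"
  by (rule multiset_eqI) (simp add: count_mon)

lemma size_mon: "size (mon N g) = (\<Sum>i<N. g i)"
  by (induction N) (simp_all add: mon_def)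

lemma mon_count: "set_mset b \<subseteq> {..<N} \<Longrightarrow> mon N (count b) = b"
  by (rule multiset_eqI) (auto simp: count_mon count_eq_zero_iff)

definition staircase :: "nat \<Rightarrow> nat \<Rightarrow> nat" where "staircase N i = N - 1 - i"

text \<open>The leading variable of X_a - X_b is X_a, and x is the smaller index of N - 1 - x
  pairs.\<close>

lemma monic_dom_V: "monic_dom (V N) (mon N (staircase N))"
proof -
  have "monic_dom (V N) (\<Sum>(a, b)\<in>pairs N. {#a#})"
    unfolding V_def case_prod_beta
    by (rule monic_dom_prod[OF finite_pairs]) (auto simp: pairs_def intro: monic_dom_X_diff)
  also have "(\<Sum>(a, b)\<in>pairs N. {#a#}) = mon N (staircase N)"
  proof (rule multiset_eqI)
    fix x
    have "count (\<Sum>(a, b)\<in>pairs N. {#a#}) x = (\<Sum>s\<in>pairs N. if fst s = x then 1 else 0)"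
      unfolding count_sum by (intro sum.cong) auto
    also have "\<dots> = card {s\<in>pairs N. fst s = x}" by (simp add: sum.If_cases Int_def)
    also have "{s\<in>pairs N. fst s = x} = (\<lambda>b. (x, b)) ` {x<..<N}" by (auto simp: pairs_def)
    also have "card \<dots> = N - 1 - x" by (subst card_image) (auto simp: inj_on_def)
    finally show "count (\<Sum>(a, b)\<in>pairs N. {#a#}) x = count (mon N (staircase N)) x"
      by (simp add: count_mon staircase_def)
  qed
  finally show ?thesis .
qed

text \<open>This replaces the expansion of a determinant: the exponents are distinct by
  \<open>lookup_V_eq_0\<close> and have the sum of 0, ..., N-1, which forces them to be a
  permutation of these numbers. In particular the sum of squares is constant, as
  \<open>sum_euler_sq_V\<close> requires.\<close>

lemma lookup_V_support:
  assumes "lk (V N) c \<noteq> 0"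
  shows "set_mset c \<subseteq> {..<N}" "(\<Sum>i<N. (count c i)\<^sup>2) = (\<Sum>i<N. i\<^sup>2)"
proof -
  have dominated: "dominated c (mon N (staircase N))" using assms monic_dom_V by (auto simp: monic_dom_def)
  have szc: "size c = (\<Sum>i<N. i)"
  proof -
    have "size c = (\<Sum>i<N. N - Suc i)" using dominated by (simp add: dominated_def size_mon staircase_def)
    also have "\<dots> = (\<Sum>i<N. i)" by (rule sum.nat_diff_reindex)
    finally show ?thesis .
  qed
  show sub: "set_mset c \<subseteq> {..<N}"
    using assms
  proof -
    have "lk (\<Prod>s\<in>S. X (fst s) - X (snd s)) c \<noteq> 0 \<Longrightarrow> set_mset c \<subseteq> fst ` S \<union> snd ` S" if "finite S" for S c
      using that
    proof (induction S arbitrary: c rule: finite_induct)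
      case empty
      then show ?case by (auto simp: lookup_one when_def split: if_splits)
    next
      case (insert s S)
      from insert have "lk (X (fst s) * (\<Prod>s\<in>S. X (fst s) - X (snd s))) c \<noteq> 0 \<or>
         lk (X (snd s) * (\<Prod>s\<in>S. X (fst s) - X (snd s))) c \<noteq> 0"
        by (auto simp: left_diff_distrib lookup_minus)
      then obtain z where z: "z \<in># c" "z \<in> {fst s, snd s}" "set_mset (c - {#z#}) \<subseteq> fst ` S \<union> snd ` S"
        using insert.IH by (auto simp: lookup_X_mult split: if_splits)
      thus ?case by (auto dest!: multi_member_split)
    qed
    from this[of "pairs N" c] have "set_mset c \<subseteq> fst ` pairs N \<union> snd ` pairs N" using assms
      by (simp add: V_def case_prod_beta)
    also have "\<dots> \<subseteq> {..<N}" by (auto simp: pairs_def)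
    finally show ?thesis .
  qed
  have inj: "inj_on (count c) {..<N}"
  proof (rule linorder_inj_onI)
    fix i j assume "i < j" "i \<in> {..<N}" "j \<in> {..<N}"
    thus "count c i \<noteq> count c j" using lookup_V_eq_0[of i j N c] assms by auto
  qed auto
  let ?S = "count c ` {..<N}"
  have card: "card ?S = N" using inj by (simp add: card_image)
  have sum: "(\<Sum>s\<in>?S. s) = (\<Sum>i<N. i)"
  proof -
    have "(\<Sum>s\<in>?S. s) = (\<Sum>i<N. count c i)" by (simp add: sum.reindex[OF inj])
    also have "\<dots> = size c" using size_mon[of N "count c"] mon_count[OF sub] by simp
    finally show ?thesis using szc by simp
  qed
  \<comment> \<open>There are as many elements of \<open>?S\<close> from N on as numbers below N
    missing from it, so any deviation would make the sum too large.\<close>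
  have "?S = {..<N}"
  proof (rule ccontr)
    assume ne: "?S \<noteq> {..<N}"
    let ?A = "?S - {..<N}" and ?B = "{..<N} - ?S"
    have cAB: "card ?A = card ?B"
      using card card_Diff_subset_Int[of ?S "{..<N}"] card_Diff_subset_Int[of "{..<N}" ?S]
      by (simp add: Int_commute)
    have "\<not> ?S \<subseteq> {..<N}" using ne card card_subset_eq[of "{..<N}" ?S] by auto
    hence A: "?A \<noteq> {}" by auto
    have "sum id ?A \<ge> card ?A * N" using sum_bounded_below[of ?A N id] by auto
    moreover have "sum id ?B < card ?B * N"
    proof -
      have "?B \<noteq> {}" using A cAB by (metis card_eq_0_iff finite_Diff finite_imageI finite_lessThan)
      hence "sum id ?B < (\<Sum>b\<in>?B. N)" by (intro sum_strict_mono) auto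
      thus ?thesis by simp
    qed
    moreover have "sum id ?S = sum id ?A + sum id (?S \<inter> {..<N})"
      using sum.Int_Diff[of ?S id "{..<N}"] by simp
    moreover have "sum id {..<N} = sum id ?B + sum id (?S \<inter> {..<N})"
      using sum.Int_Diff[of "{..<N}" id ?S] by (simp add: Int_commute)
    ultimately show False using sum cAB by simp
  qed
  thus "(\<Sum>i<N. (count c i)\<^sup>2) = (\<Sum>i<N. i\<^sup>2)"
    using sum.reindex[OF inj, of "\<lambda>s. s\<^sup>2"] by simp
qed

section \<open>The Casimir identity\<close>

text \<open>The scalar (b, b + 2 rho) with 2 rho_i = N - 1 - 2i, the Casimir eigenvalue on a highest
  weight vector of weight \<open>b\<close>.\<close>

definition cas_val :: "nat \<Rightarrow> nat multiset \<Rightarrow> real" where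
  "cas_val N b = (\<Sum>i<N. (real (count b i))\<^sup>2 + (real N - 1 - 2 * real i) * real (count b i))"

text \<open>Leibniz rule over the factors of \<open>V N\<close>: only \<open>euler a\<close> and
  \<open>euler b\<close> see X_a - X_b. Keeping the product of the other factors avoids a
  division.\<close>

lemma sum_euler_V_euler:
  "(\<Sum>i<N. euler i (V N) * euler i T)
     = (\<Sum>(a, b)\<in>pairs N. (X a * euler a T - X b * euler b T) * (\<Prod>(c, d)\<in>pairs N - {(a, b)}. X c - X d))"
proof -
  let ?W = "\<lambda>s. \<Prod>(c, d)\<in>pairs N - {s}. X c - X d"
  have "(\<Sum>i<N. euler i (V N) * euler i T)
      = (\<Sum>i<N. \<Sum>s\<in>pairs N. euler i (X (fst s) - X (snd s)) * ?W s * euler i T)"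
    unfolding V_def case_prod_beta by (simp add: euler_prod sum_distrib_right)
  also have "\<dots> = (\<Sum>s\<in>pairs N. \<Sum>i<N. euler i (X (fst s) - X (snd s)) * ?W s * euler i T)"
    by (rule sum.swap)
  also have "\<dots> = (\<Sum>s\<in>pairs N. (X (fst s) * euler (fst s) T - X (snd s) * euler (snd s) T) * ?W s)"
  proof (intro sum.cong refl)
    fix s assume "s \<in> pairs N"
    then obtain a b where s: "s = (a, b)" "a < b" "b < N" by (auto simp: pairs_def)
    have "(\<Sum>i<N. euler i (X a - X b) * ?W s * euler i T)
        = (\<Sum>i<N. if i = a then X a * ?W s * euler a T else 0) - (\<Sum>i<N. if i = b then X b * ?W s * euler b T else 0)"
      unfolding sum_subtractf[symmetric] euler_diff euler_X
      using s by (intro sum.cong refl) (auto simp: left_diff_distrib)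
    also have "\<dots> = (X a * euler a T - X b * euler b T) * ?W s"
      using s by (simp add: algebra_simps)
    finally show "(\<Sum>i<N. euler i (X (fst s) - X (snd s)) * ?W s * euler i T)
      = (X (fst s) * euler (fst s) T - X (snd s) * euler (snd s) T) * ?W s" using s by simp
  qed
  finally show ?thesis by (simp add: case_prod_beta)
qed

lemma sum_pairs_fst: "(\<Sum>(a, b)\<in>pairs N. f a) = (\<Sum>i<N. of_nat (N - 1 - i) * (f i :: 'a::comm_ring_1))"
proof -
  have "pairs N = (SIGMA a:{..<N}. {a<..<N})" by (auto simp: pairs_def)
  thus ?thesis by (simp add: sum.Sigma[symmetric])
qed

text \<open>\<open>U a b\<close> is the quotient X_b (D_a T - D_b T) / (X_a - X_b), with D_i for
  \<open>euler i\<close>, specified without denominators. It turns X_a D_a T - X_b D_b T into (X_a -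
  X_b) (D_a T + U a b), which restores the missing factor of \<open>V N\<close>.\<close>

lemma V_sum_U:
  assumes U: "\<And>a b. a < b \<Longrightarrow> b < N \<Longrightarrow> (X a - X b) * U a b = X b * (euler a T - euler b T)"
  shows "V N * (\<Sum>(a, b)\<in>pairs N. U a b)
       = (\<Sum>i<N. euler i (V N) * euler i T) - V N * (\<Sum>i<N. of_nat (N - 1 - i) * euler i T)"
proof -
  have "(\<Sum>i<N. euler i (V N) * euler i T) = (\<Sum>(a, b)\<in>pairs N. V N * (euler a T + U a b))"
    unfolding sum_euler_V_euler case_prod_beta
  proof (intro sum.cong refl)
    fix s assume s: "s \<in> pairs N"
    obtain a b where ab: "s = (a, b)" by (cases s)
    with s have lt: "a < b" "b < N" by (auto simp: pairs_def)
    have "X a * euler a T - X b * euler b T = (X a - X b) * (euler a T + U a b)"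
      unfolding distrib_left U[OF lt] by (simp add: algebra_simps)
    moreover have "V N = (X a - X b) * (\<Prod>s\<in>pairs N - {(a, b)}. X (fst s) - X (snd s))"
      unfolding V_def using s ab by (subst prod.remove[OF finite_pairs, of "(a, b)"]) (auto simp: case_prod_beta)
    ultimately show "(X (fst s) * euler (fst s) T - X (snd s) * euler (snd s) T) *
         (\<Prod>p\<in>pairs N - {(fst s, snd s)}. X (fst p) - X (snd p)) = V N * (euler (fst s) T + U (fst s) (snd s))"
      unfolding ab fst_conv snd_conv by (simp only: ac_simps)
  qed
  also have "\<dots> = V N * (\<Sum>(a, b)\<in>pairs N. euler a T) + V N * (\<Sum>(a, b)\<in>pairs N. U a b)"
    by (simp add: case_prod_beta sum_distrib_left sum.distrib distrib_left)
  finally show ?thesis by (simp add: sum_pairs_fst)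
qed

text \<open>All monomials of \<open>V N\<close> have the same sum of squared exponents.\<close>

lemma sum_euler_sq_V: "(\<Sum>i<N. euler i (euler i (V N))) = sg 0 (\<Sum>i<N. (real i)\<^sup>2) * V N"
proof (rule poly_mapping_eqI)
  fix c
  have "lk (\<Sum>i<N. euler i (euler i (V N))) c = real (\<Sum>i<N. (count c i)\<^sup>2) * lk (V N) c"
    by (simp add: lookup_sum lookup_euler sum_distrib_right power2_eq_square mult.assoc)
  also have "\<dots> = real (\<Sum>i<N. i\<^sup>2) * lk (V N) c"
    using lookup_V_support(2)[of N c] by (cases "lk (V N) c = 0") simp_all
  also have "\<dots> = lk (sg 0 (\<Sum>i<N. (real i)\<^sup>2) * V N) c"
    using lookup_single_mult[of 0 _ "V N" c] by simp
  finally show "lk (\<Sum>i<N. euler i (euler i (V N))) c = lk (sg 0 (\<Sum>i<N. (real i)\<^sup>2) * V N) c" .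
qed

lemma lookup_of_nat_mult: "lk (of_nat n * p) c = real n * lk (p :: mpoly) c"
  using lookup_single_mult[of 0 "real n" p c] by simp

lemma lookup_const_mult: "lk (sg 0 r * p) c = r * lk (p :: mpoly) c"
  using lookup_single_mult[of 0 r p c] by simp

text \<open>Conjugation of the radial part of the Casimir operator by \<open>V N\<close>: up to
  constants, the first-order terms of \<open>V N * T'\<close> are the cross terms of the Laplacian
  (the sum of the squared \<open>euler i\<close>) applied to \<open>V N * T\<close>. The resulting
  operator is diagonal on monomials, with value |l + delta|^2 - |delta|^2 - (N - 1) k at l +
  delta.\<close>

proposition casimir_eigenvalue:
  assumes U: "\<And>a b. a < b \<Longrightarrow> b < N \<Longrightarrow> (X a - X b) * U a b = X b * (euler a T - euler b T)"
    and T': "\<And>c. lk T' c = cas_val N c * lk T c + 2 * (\<Sum>(a, b)\<in>pairs N. lk (U a b) c)"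
    and hom: "\<And>c. lk T c \<noteq> 0 \<Longrightarrow> size c = k \<and> set_mset c \<subseteq> {..<N}"
    and l: "set_mset l \<subseteq> {..<N}" "size l = k"
  shows "lk (V N * T') (l + mon N (staircase N)) = cas_val N l * lk (V N * T) (l + mon N (staircase N))"
proof -
  let ?V = "V N" and ?d = "l + mon N (staircase N)"
  let ?E = "\<Sum>i<N. euler i T"
  \<comment> \<open>Euler's relation for the homogeneous polynomial \<open>T\<close>.\<close>
  have E: "?E = of_nat k * T"
  proof (rule poly_mapping_eqI)
    fix c
    show "lk ?E c = lk (of_nat k * T) c"
    proof (cases "lk T c = 0")
      case False
      hence "size c = k" "(\<Sum>i<N. count c i) = size c"
        using hom[OF False] size_mon[of N "count c"] mon_count[of c N] by auto
      thus ?thesis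
        by (simp add: lookup_sum lookup_euler lookup_of_nat_mult sum_distrib_right[symmetric] flip: of_nat_sum)
    qed (simp add: lookup_sum lookup_euler lookup_of_nat_mult)
  qed
  have T'eq: "T' = (\<Sum>i<N. euler i (euler i T)) + (\<Sum>i<N. sg 0 (real N - 1 - 2 * real i) * euler i T) + 2 * (\<Sum>(a, b)\<in>pairs N. U a b)"
  proof (rule poly_mapping_eqI)
    fix c
    have two: "lk (2 * p) c = 2 * lk p c" for p :: mpoly
      using lookup_of_nat_mult[of 2 p c] by simp
    show "lk T' c = lk ((\<Sum>i<N. euler i (euler i T)) + (\<Sum>i<N. sg 0 (real N - 1 - 2 * real i) * euler i T) + 2 * (\<Sum>(a, b)\<in>pairs N. U a b)) c"
      unfolding T' lookup_add two
      by (simp add: lookup_sum lookup_euler cas_val_def lookup_const_mult[simplified] sum_distrib_right sum.distrib[symmetric]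
          case_prod_beta) (intro sum.cong refl, simp add: power2_eq_square algebra_simps)
  qed
  \<comment> \<open>(N - 1 - 2i) - 2 (N - 1 - i) = -(N - 1) is free of i, so the first-order
    remainder is a multiple of the degree operator.\<close>
  have coeffs: "(\<Sum>i<N. sg 0 (real N - 1 - 2 * real i) * euler i T) - 2 * (\<Sum>i<N. of_nat (N - 1 - i) * euler i T)
       = - (sg 0 (real N - 1) * ?E)"
    unfolding sum_distrib_left sum_subtractf[symmetric] sum_negf[symmetric]
  proof (intro sum.cong refl)
    fix i assume "i \<in> {..<N}"
    hence 1: "real (N - 1 - i) = real N - 1 - real i" by simp
    have 2: "(of_nat (N - 1 - i) :: mpoly) = sg 0 (real (N - 1 - i))" by simp
    have 3: "(2 :: mpoly) = sg 0 2" by (simp add: single_numeral)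
    show "sg 0 (real N - 1 - 2 * real i) * euler i T - 2 * (of_nat (N - 1 - i) * euler i T) = - (sg 0 (real N - 1) * euler i T)"
      unfolding 2 3 1
      by (rule poly_mapping_eqI) (simp only: lookup_minus lookup_uminus lookup_const_mult, simp add: algebra_simps)
  qed
  have "?V * T' = ?V * (\<Sum>i<N. euler i (euler i T)) + 2 * (\<Sum>i<N. euler i ?V * euler i T)
      + ?V * ((\<Sum>i<N. sg 0 (real N - 1 - 2 * real i) * euler i T) - 2 * (\<Sum>i<N. of_nat (N - 1 - i) * euler i T))"
  proof -
    have ring: "v * (a + b + 2 * u) = v * a + 2 * t + v * (b - 2 * d)" if "v * u = t - v * d" for v a b u t d :: mpoly
    proof -
      have "v * (a + b + 2 * u) = v * a + v * b + 2 * (v * u)" by (simp add: algebra_simps)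
      thus ?thesis unfolding that by (simp add: algebra_simps)
    qed
    show ?thesis unfolding T'eq by (rule ring, rule V_sum_U, rule U)
  qed
  also have "\<dots> = (\<Sum>i<N. euler i (euler i (?V * T))) - (\<Sum>i<N. euler i (euler i ?V)) * T - sg 0 (real N - 1) * ?V * ?E"
    unfolding coeffs
    by (simp add: euler_mult euler_add sum.distrib sum_distrib_left sum_distrib_right algebra_simps)
  also have "\<dots> = (\<Sum>i<N. euler i (euler i (?V * T))) - sg 0 (\<Sum>i<N. (real i)\<^sup>2) * (?V * T) - sg 0 ((real N - 1) * real k) * (?V * T)"
  proof -
    have "sg 0 ((real N - 1) * real k) = sg 0 (real N - 1) * (of_nat k :: mpoly)"
      using mult_single[of "0 :: nat multiset" "real N - 1" 0 "real k"] by simp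
    thus ?thesis unfolding sum_euler_sq_V E by (simp only: ac_simps)
  qed
  finally have "lk (?V * T') ?d = ((\<Sum>i<N. (real (count ?d i))\<^sup>2) - (\<Sum>i<N. (real i)\<^sup>2) - (real N - 1) * real k) * lk (?V * T) ?d"
    by (simp add: lookup_minus lookup_sum lookup_euler lookup_const_mult sum_distrib_right left_diff_distrib power2_eq_square mult.assoc)
  also have "(\<Sum>i<N. (real (count ?d i))\<^sup>2) - (\<Sum>i<N. (real i)\<^sup>2) - (real N - 1) * real k = cas_val N l"
  proof -
    have k: "real k = (\<Sum>i<N. real (count l i))"
      using l size_mon[of N "count l"] mon_count[of l N] by simp
    \<comment> \<open>The squared entries of the staircase, listed in reverse order.\<close>
    have s: "(\<Sum>i<N. (real i)\<^sup>2) = (\<Sum>i<N. (real N - 1 - real i)\<^sup>2)"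
      unfolding sum.nat_diff_reindex[of "\<lambda>i. (real i)\<^sup>2" N, symmetric]
      by (intro sum.cong refl) (simp add: of_nat_diff Suc_leI algebra_simps)
    show ?thesis
      unfolding k s cas_val_def sum_distrib_left sum_subtractf[symmetric]
      by (intro sum.cong refl) (simp add: count_mon staircase_def power2_eq_square algebra_simps)
  qed
  finally show ?thesis .
qed

section \<open>Linear maps\<close>

definition scl :: "real \<Rightarrow> ('a \<Rightarrow>\<^sub>0 real) \<Rightarrow> ('a \<Rightarrow>\<^sub>0 real)" where
  "scl r v = Poly_Mapping.map ((*) r) v"

lemma lookup_scl [simp]: "lk (scl r v) c = r * lk v c"
  by (simp add: scl_def map.rep_eq when_def)

lemma scl_simps [simp]:
  "scl r 0 = 0" "scl 0 v = 0" "scl 1 v = v" "scl r (scl s v) = scl (r * s) v" "scl r (sg c s) = sg c (r * s)"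
  "scl r (- v) = - scl r v" "scl (- r) v = - scl r v"
  by (auto intro!: poly_mapping_eqI simp: lookup_single when_def)

lemma scl_add: "scl r (u + v) = scl r u + scl r v"
  by (rule poly_mapping_eqI) (simp add: lookup_add algebra_simps)

lemma scl_diff: "scl r (u - v) = scl r u - scl r v"
  by (rule poly_mapping_eqI) (simp add: lookup_minus algebra_simps)

lemma scl_add_left: "scl (r + s) v = scl r v + scl s v"
  by (rule poly_mapping_eqI) (simp add: lookup_add algebra_simps)

lemma scl_mult: "scl r (u :: 'a::cancel_comm_monoid_add \<Rightarrow>\<^sub>0 real) * v = scl r (u * v)" "u * scl r v = scl r (u * v)"
  by (simp_all add: scl_def mult_map_scale_conv_mult ac_simps)

global_interpretation pvs: vector_space scl
  by unfold_locales (simp_all add: scl_add scl_add_left)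

definition lin :: "(('a \<Rightarrow>\<^sub>0 real) \<Rightarrow> ('b \<Rightarrow>\<^sub>0 real)) \<Rightarrow> bool" where
  "lin L \<longleftrightarrow> (\<forall>u v. L (u + v) = L u + L v) \<and> (\<forall>r v. L (scl r v) = scl r (L v))"

lemma linI: "(\<And>u v. L (u + v) = L u + L v) \<Longrightarrow> (\<And>r v. L (scl r v) = scl r (L v)) \<Longrightarrow> lin L"
  by (simp add: lin_def)

lemma lin_add: "lin L \<Longrightarrow> L (u + v) = L u + L v" by (simp add: lin_def)
lemma lin_scl: "lin L \<Longrightarrow> L (scl r v) = scl r (L v)" by (simp add: lin_def)
lemma lin_0: "lin L \<Longrightarrow> L 0 = 0" using lin_scl[of L 0 0] by simp
lemma lin_uminus: "lin L \<Longrightarrow> L (- v) = - L v" using lin_scl[of L "- 1" v] by simp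
lemma lin_diff: "lin L \<Longrightarrow> L (u - v) = L u - L v"
  using lin_add[of L u "- v"] lin_uminus[of L v] by simp
lemma lin_sum: "lin L \<Longrightarrow> L (\<Sum>i\<in>I. f i) = (\<Sum>i\<in>I. L (f i))"
  by (induction I rule: infinite_finite_induct) (auto simp: lin_0 lin_add)

lemma lin_comp: "lin L \<Longrightarrow> lin L' \<Longrightarrow> lin (\<lambda>v. L (L' v))" by (simp add: lin_def)
lemma lin_plus: "lin L \<Longrightarrow> lin L' \<Longrightarrow> lin (\<lambda>v. L v + L' v)" by (simp add: lin_def scl_add)
lemma lin_minus: "lin L \<Longrightarrow> lin L' \<Longrightarrow> lin (\<lambda>v. L v - L' v)" by (simp add: lin_def scl_diff)
lemma lin_scale: "lin L \<Longrightarrow> lin (\<lambda>v. scl r (L v))" by (simp add: lin_def scl_add ac_simps)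
lemma lin_zero [simp]: "lin (\<lambda>v. 0)" by (simp add: lin_def)
lemma lin_id [simp]: "lin (\<lambda>v. v)" by (simp add: lin_def)
lemma lin_if: "lin L \<Longrightarrow> lin (\<lambda>v. if P then L v else 0)" by (cases P) simp_all
lemma lin_sums: "(\<And>i. i \<in> I \<Longrightarrow> lin (L i)) \<Longrightarrow> lin (\<lambda>v. \<Sum>i\<in>I. L i v)"
  by (induction I rule: infinite_finite_induct) (auto intro: lin_plus)
lemma lin_mult_left: "lin (\<lambda>v. u * v)" for u :: "'a::cancel_comm_monoid_add \<Rightarrow>\<^sub>0 real"
  by (rule linI) (simp_all add: distrib_left scl_mult)
lemma lin_mult_right: "lin (\<lambda>v. v * u)" for u :: "'a::cancel_comm_monoid_add \<Rightarrow>\<^sub>0 real"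
  by (rule linI) (simp_all add: distrib_right scl_mult)

lemma lin_expand:
  assumes "lin L" "finite A" "Poly_Mapping.keys v \<subseteq> A"
  shows "L v = (\<Sum>c\<in>A. scl (lk v c) (L (sg c 1)))"
proof -
  have "(\<Sum>c\<in>A. scl (lk v c) (sg c 1)) = v"
    by (simp add: poly_mapping_sum_single[OF assms(2,3), symmetric])
  hence "L v = L (\<Sum>c\<in>A. scl (lk v c) (sg c 1))" by (simp only:)
  thus ?thesis by (simp only: lin_sum[OF assms(1)] lin_scl[OF assms(1)])
qed

lemma lin_eqI:
  assumes "lin L" "lin L'" "\<And>c. L (sg c 1) = L' (sg c 1)"
  shows "L v = L' v"
  unfolding lin_expand[OF assms(1) finite_keys[of v] order_refl] lin_expand[OF assms(2) finite_keys[of v] order_refl]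
  by (simp add: assms(3))

definition lext :: "('a \<Rightarrow> ('b \<Rightarrow>\<^sub>0 real)) \<Rightarrow> ('a \<Rightarrow>\<^sub>0 real) \<Rightarrow> ('b \<Rightarrow>\<^sub>0 real)" where
  "lext f v = (\<Sum>c\<in>Poly_Mapping.keys v. scl (lk v c) (f c))"

lemma lext_superset:
  assumes "finite A" "Poly_Mapping.keys v \<subseteq> A"
  shows "lext f v = (\<Sum>c\<in>A. scl (lk v c) (f c))"
  unfolding lext_def using assms by (intro sum.mono_neutral_left) (auto simp: in_keys_iff)

lemma lin_lext: "lin (lext f)"
proof (rule linI)
  fix u v :: "'a \<Rightarrow>\<^sub>0 real"
  let ?A = "Poly_Mapping.keys u \<union> Poly_Mapping.keys v"
  have "Poly_Mapping.keys (u + v) \<subseteq> ?A" by (auto simp: in_keys_iff lookup_add)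
  thus "lext f (u + v) = lext f u + lext f v"
    by (simp add: lext_superset[of ?A] lookup_add scl_add_left sum.distrib)
next
  fix r and v :: "'a \<Rightarrow>\<^sub>0 real"
  have "Poly_Mapping.keys (scl r v) \<subseteq> Poly_Mapping.keys v" by (auto simp: in_keys_iff)
  thus "lext f (scl r v) = scl r (lext f v)"
    by (simp add: lext_superset[of "Poly_Mapping.keys v"] pvs.scale_sum_right)
qed

lemma lext_single [simp]: "lext f (sg c r) = scl r (f c)"
  by (simp add: lext_superset[of "{c}"])

section \<open>Exterior powers\<close>

text \<open>The sign for moving e_j across the factors of smaller index in a wedge product written
  in increasing order.\<close>

definition eps :: "nat \<Rightarrow> nat set \<Rightarrow> real" where "eps j S = (-1) ^ card {k\<in>S. k < j}"

lemma eps_sq [simp]: "eps j S * eps j S = 1"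
  by (simp add: eps_def power_mult_distrib[symmetric])

lemma eps_remove: "eps j (S - {i}) = (if i \<in> S \<and> i < j then - eps j S else eps j S)"
proof (cases "i \<in> S \<and> i < j")
  case True
  hence "{k\<in>S. k < j} = insert i {k\<in>S - {i}. k < j}" by auto
  hence "card {k\<in>S. k < j} = Suc (card {k\<in>S - {i}. k < j})" by simp
  thus ?thesis using True by (simp add: eps_def)
next
  case False
  hence "{k\<in>S. k < j} = {k\<in>S - {i}. k < j}" by auto
  thus ?thesis using False by (simp add: eps_def)
qed

lemma eps_insert: "eps j (insert i S) = (if i \<notin> S \<and> i < j then - eps j S else eps j S)"
  using eps_remove[of j "insert i S" i] by (cases "i \<in> S") (auto simp: insert_absorb split: if_splits)

text \<open>The basis vector \<open>sg S 1\<close> is the wedge of the e_k with k in S.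
  \<open>ann j\<close> is contraction with the dual of e_j and \<open>cre j\<close> is left
  multiplication by e_j; their anticommutation relations take over the sign computations.\<close>

definition ann :: "nat \<Rightarrow> (nat set \<Rightarrow>\<^sub>0 real) \<Rightarrow> (nat set \<Rightarrow>\<^sub>0 real)" where
  "ann j = lext (\<lambda>S. if j \<in> S then sg (S - {j}) (eps j S) else 0)"

definition cre :: "nat \<Rightarrow> (nat set \<Rightarrow>\<^sub>0 real) \<Rightarrow> (nat set \<Rightarrow>\<^sub>0 real)" where
  "cre j = lext (\<lambda>S. if j \<in> S then 0 else sg (insert j S) (eps j S))"

lemma lin_ann: "lin (ann j)" and lin_cre: "lin (cre j)"
  by (simp_all add: ann_def cre_def lin_lext)

lemma ann_single: "ann j (sg S r) = (if j \<in> S then sg (S - {j}) (r * eps j S) else 0)"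
  and cre_single: "cre j (sg S r) = (if j \<in> S then 0 else sg (insert j S) (r * eps j S))"
  by (simp_all add: ann_def cre_def)

lemma ann_0 [simp]: "ann j 0 = 0" and cre_0 [simp]: "cre j 0 = 0"
  by (simp_all add: lin_0 lin_ann lin_cre)

lemma ann_ann: "ann i (ann j v) = - ann j (ann i v)"
proof (rule lin_eqI[of "\<lambda>v. ann i (ann j v)" "\<lambda>v. - ann j (ann i v)"])
  show "lin (\<lambda>v. - ann j (ann i v))" using lin_scale[OF lin_comp[OF lin_ann[of j] lin_ann[of i]], of "- 1"] by simp
  fix S :: "nat set"
  show "ann i (ann j (sg S 1)) = - ann j (ann i (sg S 1))"
  proof -
    have "S - {j} - {i} = S - {i} - {j}" by auto
    thus ?thesis
      by (cases i j rule: linorder_cases; cases "i \<in> S"; cases "j \<in> S")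
         (simp_all add: ann_single eps_remove single_uminus mult.commute)
  qed
qed (rule lin_comp[OF lin_ann lin_ann])

lemma cre_cre: "cre i (cre j v) = - cre j (cre i v)"
proof (rule lin_eqI[of "\<lambda>v. cre i (cre j v)" "\<lambda>v. - cre j (cre i v)"])
  show "lin (\<lambda>v. - cre j (cre i v))" using lin_scale[OF lin_comp[OF lin_cre[of j] lin_cre[of i]], of "- 1"] by simp
  fix S :: "nat set"
  show "cre i (cre j (sg S 1)) = - cre j (cre i (sg S 1))"
    using insert_commute[of i j S]
    by (cases i j rule: linorder_cases; cases "i \<in> S"; cases "j \<in> S")
       (simp_all add: cre_single eps_insert single_uminus mult.commute)
qed (rule lin_comp[OF lin_cre lin_cre])

lemma ann_cre: "ann i (cre j v) = (if i = j then v else 0) - cre j (ann i v)"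
proof (rule lin_eqI[of "\<lambda>v. ann i (cre j v)" "\<lambda>v. (if i = j then v else 0) - cre j (ann i v)"])
  show "lin (\<lambda>v. (if i = j then v else 0) - cre j (ann i v))"
    by (rule lin_minus[OF _ lin_comp[OF lin_cre lin_ann]]) (cases "i = j"; simp)
  fix S :: "nat set"
  have "insert j (S - {i}) = insert j S - {i}" if "i \<noteq> j" using that by auto
  thus "ann i (cre j (sg S 1)) = (if i = j then sg S 1 else 0) - cre j (ann i (sg S 1))"
    by (cases i j rule: linorder_cases; cases "i \<in> S"; cases "j \<in> S")
       (simp_all add: ann_single cre_single eps_remove eps_insert single_uminus mult.commute insert_absorb)
qed (rule lin_comp[OF lin_ann lin_cre])

definition EL :: "nat \<Rightarrow> nat \<Rightarrow> (nat set \<Rightarrow>\<^sub>0 real) \<Rightarrow> (nat set \<Rightarrow>\<^sub>0 real)" where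
  "EL i j v = cre i (ann j v)"

lemma lin_EL: "lin (EL i j)"
  unfolding EL_def by (rule lin_comp[OF lin_cre lin_ann])

text \<open>Normal ordering: each product is an \<open>EL\<close> term, present when the inner
  indices match, minus a quartic term. The quartic term is the same for both, since exchanging the
  two creators and the two annihilators gives two signs.\<close>

lemma EL_commutator:
  "EL i j (EL k l v) - EL k l (EL i j v) = (if j = k then EL i l v else 0) - (if l = i then EL k j v else 0)"
proof -
  have 1: "EL i j (EL k l v) = (if j = k then EL i l v else 0) - cre i (cre k (ann j (ann l v)))" for i j k l
    unfolding EL_def ann_cre by (simp add: lin_diff[OF lin_cre])
  have "cre k (cre i (ann l (ann j v))) = cre i (cre k (ann j (ann l v)))"
    using cre_cre[of k i] ann_ann[of l j] by (simp add: lin_uminus[OF lin_cre])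
  thus ?thesis unfolding 1[of i j k l] 1[of k l i j] by simp
qed

lemma EL_single: "EL i j (sg S 1) = (if j \<in> S \<and> (i = j \<or> i \<notin> S) then sg (insert i (S - {j})) (eps j S * eps i (S - {j})) else 0)"
  by (auto simp: EL_def ann_single cre_single)

section \<open>Symmetric powers of exterior powers\<close>

text \<open>Multisets are monomials in the basis vectors of the exterior algebra. With the
  convolution product this is the symmetric algebra of the whole exterior algebra; the piece Sym^n
  of Lambda^m is cut out by \<open>B\<close>.\<close>

type_synonym vec = "nat set multiset \<Rightarrow>\<^sub>0 real"

definition iota :: "(nat set \<Rightarrow>\<^sub>0 real) \<Rightarrow> vec" where "iota = lext (\<lambda>S. sg {#S#} 1)"

lemma lin_iota: "lin iota" by (simp add: iota_def lin_lext)
lemma iota_single: "iota (sg S r) = sg {#S#} r" by (simp add: iota_def)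

text \<open>The derivation extending \<open>L\<close> from the generators. The sum runs over the
  factors of a monomial with multiplicity, which yields the exponents of the power rule.\<close>

definition derivation :: "((nat set \<Rightarrow>\<^sub>0 real) \<Rightarrow> (nat set \<Rightarrow>\<^sub>0 real)) \<Rightarrow> vec \<Rightarrow> vec" where
  "derivation L = lext (\<lambda>C. \<Sum>S\<in>#C. sg (C - {#S#}) 1 * iota (L (sg S 1)))"

lemma lin_deriv: "lin (derivation L)" by (simp add: derivation_def lin_lext)

lemma deriv_1 [simp]: "derivation L 1 = 0"
  using lext_single[of "\<lambda>C. \<Sum>S\<in>#C. sg (C - {#S#}) 1 * iota (L (sg S 1))" 0 1] by (simp add: derivation_def)

lemma deriv_single_add:
  "derivation L (sg (add_mset S C) 1) = iota (L (sg S 1)) * sg C 1 + sg {#S#} 1 * derivation L (sg C 1)"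
proof -
  have "(\<Sum>S'\<in>#C. sg (add_mset S C - {#S'#}) 1 * iota (L (sg S' 1)))
      = (\<Sum>S'\<in>#C. sg {#S#} 1 * (sg (C - {#S'#}) 1 * iota (L (sg S' 1))))"
  proof (intro arg_cong[of _ _ sum_mset] image_mset_cong)
    fix S' assume "S' \<in># C"
    hence "add_mset S C - {#S'#} = {#S#} + (C - {#S'#})" by simp
    thus "sg (add_mset S C - {#S'#}) 1 * iota (L (sg S' 1)) = sg {#S#} 1 * (sg (C - {#S'#}) 1 * iota (L (sg S' 1)))"
      by (simp only: mult.assoc[symmetric] mult_single mult_1)
  qed
  thus ?thesis by (simp add: derivation_def sum_mset_distrib_left mult.commute)
qed

lemma deriv_iota_mult:
  assumes L: "lin L"
  shows "derivation L (iota u * v) = iota (L u) * v + iota u * derivation L v"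
proof (rule lin_eqI[of "\<lambda>u. derivation L (iota u * v)" "\<lambda>u. iota (L u) * v + iota u * derivation L v"])
  fix S
  show "derivation L (iota (sg S 1) * v) = iota (L (sg S 1)) * v + iota (sg S 1) * derivation L v"
  proof (rule lin_eqI[of "\<lambda>v. derivation L (iota (sg S 1) * v)" "\<lambda>v. iota (L (sg S 1)) * v + iota (sg S 1) * derivation L v"])
    fix C
    show "derivation L (iota (sg S 1) * sg C 1) = iota (L (sg S 1)) * sg C 1 + iota (sg S 1) * derivation L (sg C 1)"
      by (simp add: iota_single mult_single deriv_single_add)
  qed (rule lin_comp[OF lin_deriv lin_mult_left] lin_plus[OF lin_mult_left lin_comp[OF lin_mult_left lin_deriv]])+
qed (rule lin_comp[OF lin_deriv lin_comp[OF lin_mult_right lin_iota]]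
      lin_plus[OF lin_comp[OF lin_mult_right lin_comp[OF lin_iota L]] lin_comp[OF lin_mult_right lin_iota]])+

text \<open>Induction over products of generators, the form in which the Leibniz rule
  \<open>deriv_iota_mult\<close> applies.\<close>

lemma deriv_single_induct:
  assumes "lin A" "lin B" "A (sg {#} 1) = B (sg {#} 1)"
    and "\<And>S C. A (sg C 1) = B (sg C 1) \<Longrightarrow> A (iota (sg S 1) * sg C 1) = B (iota (sg S 1) * sg C 1)"
  shows "A v = B v"
proof (rule lin_eqI[OF assms(1,2)])
  fix C show "A (sg C 1) = B (sg C 1)"
  proof (induction C)
    case (add S C)
    thus ?case using assms(4)[of C S] by (simp add: iota_single mult_single)
  qed (rule assms(3))
qed

text \<open>When the Leibniz rule is applied twice, the mixed terms are symmetric and cancel. The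
  commutator is again a derivation, and only its values on generators matter.\<close>

lemma deriv_commutator:
  assumes "lin L1" "lin L2" "lin L3" "\<And>v. L1 (L2 v) - L2 (L1 v) = L3 v"
  shows "derivation L1 (derivation L2 v) - derivation L2 (derivation L1 v) = derivation L3 v"
proof (rule deriv_single_induct[of "\<lambda>v. derivation L1 (derivation L2 v) - derivation L2 (derivation L1 v)"])
  fix S :: "nat set" and C
  let ?x = "sg S 1" and ?w = "sg C 1 :: vec"
  assume IH: "derivation L1 (derivation L2 ?w) - derivation L2 (derivation L1 ?w) = derivation L3 ?w"
  have "iota (L3 ?x) = iota (L1 (L2 ?x)) - iota (L2 (L1 ?x))"
    by (simp add: assms(4)[symmetric] lin_diff[OF lin_iota])
  thus "derivation L1 (derivation L2 (iota ?x * ?w)) - derivation L2 (derivation L1 (iota ?x * ?w)) = derivation L3 (iota ?x * ?w)"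
    unfolding deriv_iota_mult[OF assms(1)] deriv_iota_mult[OF assms(2)] deriv_iota_mult[OF assms(3)]
      lin_add[OF lin_deriv] IH[symmetric]
    by (simp only:) (simp add: algebra_simps)
qed (simp_all add: deriv_1 lin_0[OF lin_deriv] lin_deriv lin_minus[OF lin_comp[OF lin_deriv lin_deriv] lin_comp[OF lin_deriv lin_deriv]])

lemma deriv_diff: "derivation (\<lambda>v. L v - L' v) v = derivation L v - derivation L' v"
proof -
  have diff: "(\<Sum>x\<in>#A. f x - g x) = (\<Sum>x\<in>#A. f x) - (\<Sum>x\<in>#A. g x)" for A and f g :: "nat set \<Rightarrow> vec"
    by (induction A) auto
  show ?thesis
    by (rule lin_eqI[OF lin_deriv lin_minus[OF lin_deriv lin_deriv]])
       (simp add: derivation_def lin_diff[OF lin_iota] right_diff_distrib diff)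
qed

text \<open>The action of the matrix unit of gl_N with row i and column j: it replaces one index j
  by i, hence raises the weight when i < j.\<close>

definition E :: "nat \<Rightarrow> nat \<Rightarrow> vec \<Rightarrow> vec" where "E i j = derivation (EL i j)"

lemma lin_E: "lin (E i j)" by (simp add: E_def lin_deriv)

lemma deriv_0: "derivation (\<lambda>v. 0) v = 0"
  by (rule lin_eqI[OF lin_deriv lin_zero]) (simp add: derivation_def lin_0[OF lin_iota])

lemma E_commutator:
  "E i j (E k l v) - E k l (E i j v) = (if j = k then E i l v else 0) - (if l = i then E k j v else 0)"
proof -
  let ?L = "\<lambda>v. (if j = k then EL i l v else 0) - (if l = i then EL k j v else 0)"
  have L: "lin ?L" by (rule lin_minus[OF lin_if[OF lin_EL] lin_if[OF lin_EL]])
  have "E i j (E k l v) - E k l (E i j v) = derivation ?L v"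
    unfolding E_def by (rule deriv_commutator[OF lin_EL lin_EL L]) (rule EL_commutator)
  also have "\<dots> = derivation (\<lambda>v. if j = k then EL i l v else 0) v - derivation (\<lambda>v. if l = i then EL k j v else 0) v"
    by (rule deriv_diff)
  finally show ?thesis by (cases "j = k"; cases "l = i") (simp_all add: E_def deriv_0)
qed

lemma E_swap:
  "E i j (E k l v) = E k l (E i j v) + (if j = k then E i l v else 0) - (if l = i then E k j v else 0)"
  using E_commutator[of i j k l v] by (simp add: algebra_simps)

definition casimir :: "nat \<Rightarrow> vec \<Rightarrow> vec" where
  "casimir N v = (\<Sum>i<N. \<Sum>j<N. E i j (E j i v))"

lemma lin_casimir: "lin (casimir N)"
  unfolding casimir_def by (intro lin_sums lin_comp[OF lin_E lin_E])

text \<open>Commuting \<open>E k l\<close> past both factors leaves four surplus terms; once the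
  index sums collapse they cancel in pairs.\<close>

lemma casimir_E:
  assumes "k < N" "l < N"
  shows "casimir N (E k l v) = E k l (casimir N v)"
proof -
  have step: "E i j (E j i (E k l v)) = E k l (E i j (E j i v))
      + ((if j = k then E i l (E j i v) else 0) - (if l = i then E k j (E j i v) else 0))
      + ((if i = k then E i j (E j l v) else 0) - (if l = j then E i j (E k i v) else 0))" for i j
  proof -
    have "E i j (E j i (E k l v)) = E i j (E k l (E j i v)) + (if i = k then E i j (E j l v) else 0) - (if l = j then E i j (E k i v) else 0)"
      unfolding E_swap[of j i k l v] by (auto simp: lin_add[OF lin_E] lin_diff[OF lin_E] lin_0[OF lin_E])
    thus ?thesis unfolding E_swap[of i j k l "E j i v"] by simp
  qed
  have "casimir N (E k l v) = E k l (casimir N v)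
      + ((\<Sum>i<N. \<Sum>j<N. if j = k then E i l (E j i v) else 0) - (\<Sum>i<N. \<Sum>j<N. if l = i then E k j (E j i v) else 0))
      + ((\<Sum>i<N. \<Sum>j<N. if i = k then E i j (E j l v) else 0) - (\<Sum>i<N. \<Sum>j<N. if l = j then E i j (E k i v) else 0))"
    unfolding casimir_def step sum.distrib sum_subtractf lin_sum[OF lin_E] ..
  also have "(\<Sum>i<N. \<Sum>j<N. if l = i then E k j (E j i v) else 0) = (\<Sum>j<N. E k j (E j l v))"
    by (subst sum.swap) (use assms in simp)
  also have "(\<Sum>i<N. \<Sum>j<N. if i = k then E i j (E j l v) else 0) = (\<Sum>j<N. E k j (E j l v))"
    by (subst sum.swap) (use assms in simp)
  finally show ?thesis using assms by simp
qed

section \<open>Weight spaces\<close>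

text \<open>Indexes a basis of the weight space \<open>b\<close> of Sym^n of Lambda^m; its
  cardinality is the coefficient of the monomial \<open>b\<close> in \<open>h_n\<close> composed
  with \<open>e_m\<close>. The condition \<open>finite S\<close> excludes infinite sets, for which
  \<open>card\<close> and \<open>mset_set\<close> take default values.\<close>

definition B :: "nat \<Rightarrow> nat \<Rightarrow> nat multiset \<Rightarrow> nat set multiset set" where
  "B m n b = {C. size C = n \<and> (\<forall>S\<in>#C. finite S \<and> card S = m) \<and> (\<Sum>S\<in>#C. mset_set S) = b}"

definition wt :: "nat \<Rightarrow> nat \<Rightarrow> nat multiset \<Rightarrow> vec set" where
  "wt m n b = {v. Poly_Mapping.keys v \<subseteq> B m n b}"

lemma finite_B: "finite (B m n b)"
proof -
  have "B m n b \<subseteq> {C. set_mset C \<subseteq> Pow (set_mset b) \<and> size C = n}"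
  proof clarify
    fix C assume C: "C \<in> B m n b"
    have "S \<subseteq> set_mset b" if S: "S \<in># C" for S
    proof -
      have "finite S" using C S by (auto simp: B_def)
      moreover have "mset_set S \<subseteq># (\<Sum>S\<in>#C. mset_set S)" using S by (auto dest!: multi_member_split)
      ultimately show ?thesis using C by (auto simp: B_def dest!: mset_subset_eqD)
    qed
    thus "set_mset C \<subseteq> Pow (set_mset b) \<and> size C = n" using C by (auto simp: B_def)
  qed
  thus ?thesis using finite_multisets_of_size[of "Pow (set_mset b)" n]
    by (auto intro: finite_subset simp: multisets_of_size_def)
qed

lemma size_B: "C \<in> B m n b \<Longrightarrow> size b = m * n"
proof -
  assume C: "C \<in> B m n b"
  have "size (\<Sum>S\<in>#C. mset_set S) = m * size C" if "\<forall>S\<in>#C. finite S \<and> card S = m" for C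
    using that by (induction C) auto
  thus ?thesis using C by (auto simp: B_def)
qed

lemma wt_0 [simp]: "0 \<in> wt m n b" by (simp add: wt_def)
lemma wt_add: "u \<in> wt m n b \<Longrightarrow> v \<in> wt m n b \<Longrightarrow> u + v \<in> wt m n b"
  using keys_add[of u v] by (auto simp: wt_def)
lemma wt_scl: "v \<in> wt m n b \<Longrightarrow> scl r v \<in> wt m n b"
  by (auto simp: wt_def in_keys_iff)
lemma wt_diff: "u \<in> wt m n b \<Longrightarrow> v \<in> wt m n b \<Longrightarrow> u - v \<in> wt m n b"
  using keys_diff[of u v] by (auto simp: wt_def)
lemma wt_sum: "(\<And>i. i \<in> I \<Longrightarrow> f i \<in> wt m n b) \<Longrightarrow> sum f I \<in> wt m n b"
  by (induction I rule: infinite_finite_induct) (auto intro: wt_add)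
lemma wt_single: "C \<in> B m n b \<Longrightarrow> sg C r \<in> wt m n b"
  by (auto simp: wt_def)

lemma wt_lin:
  assumes "lin L" "v \<in> wt m n b" "\<And>C. C \<in> B m n b \<Longrightarrow> L (sg C 1) \<in> wt m' n' b'"
  shows "L v \<in> wt m' n' b'"
proof -
  have "L v = (\<Sum>c\<in>B m n b. scl (lk v c) (L (sg c 1)))"
    using assms(2) by (intro lin_expand assms(1) finite_B) (auto simp: wt_def)
  thus ?thesis by (auto intro!: wt_sum wt_scl assms(3))
qed

lemma lin_eq_on_wt:
  assumes "lin L" "lin L'" "v \<in> wt m n b" "\<And>C. C \<in> B m n b \<Longrightarrow> L (sg C 1) = L' (sg C 1)"
  shows "L v = L' v"
proof -
  have "Poly_Mapping.keys v \<subseteq> B m n b" using assms(3) by (simp add: wt_def)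
  from lin_expand[OF assms(1) finite_B this] lin_expand[OF assms(2) finite_B this] assms(4)
  show ?thesis by simp
qed

lemma E_single: "E i j (sg C 1) = (\<Sum>S\<in>#C. sg (C - {#S#}) 1 * iota (EL i j (sg S 1)))"
  by (simp add: E_def derivation_def)

lemma sum_mset_wt: "(\<And>S. S \<in># C \<Longrightarrow> f S \<in> wt m n b) \<Longrightarrow> (\<Sum>S\<in>#C. f S) \<in> wt m n b"
  by (induction C) (auto intro: wt_add)

lemma E_wt:
  assumes "v \<in> wt m n b" "j \<in># b"
  shows "E i j v \<in> wt m n (add_mset i (b - {#j#}))"
proof (rule wt_lin[OF lin_E assms(1)])
  fix C assume C: "C \<in> B m n b"
  show "E i j (sg C 1) \<in> wt m n (add_mset i (b - {#j#}))"
    unfolding E_single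
  proof (rule sum_mset_wt)
    fix S assume S: "S \<in># C"
    then obtain D where D: "C = add_mset S D" by (metis mset_add)
    have fin: "finite S" "card S = m" using C S by (auto simp: B_def)
    show "sg (C - {#S#}) 1 * iota (EL i j (sg S 1)) \<in> wt m n (add_mset i (b - {#j#}))"
    proof (cases "j \<in> S \<and> (i = j \<or> i \<notin> S)")
      case True
      hence "card (insert i (S - {j})) = m"
        using fin card_Suc_Diff1[of S j] by (auto simp: card_insert_if insert_absorb)
      moreover have "mset_set (insert i (S - {j})) = add_mset i (mset_set S - {#j#})"
        using True fin by (auto simp: mset_set_Diff)
      moreover have "j \<in># mset_set S" using True fin by simp
      ultimately have "add_mset (insert i (S - {j})) D \<in> B m n (add_mset i (b - {#j#}))"
        using C fin D by (auto simp: B_def)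
      thus ?thesis using True by (auto simp: EL_single iota_single mult_single D intro!: wt_single)
    next
      case False
      thus ?thesis by (auto simp: EL_single lin_0[OF lin_iota])
    qed
  qed
qed

lemma E_wt_0:
  assumes "v \<in> wt m n b" "j \<notin># b"
  shows "E i j v = 0"
proof (rule lin_eq_on_wt[OF lin_E lin_zero assms(1)])
  fix C assume C: "C \<in> B m n b"
  have "j \<notin> S" if "S \<in># C" for S
  proof -
    have "mset_set S \<subseteq># b" "finite S" using C that by (auto simp: B_def dest!: multi_member_split)
    thus ?thesis using assms(2) by (auto dest: mset_subset_eqD)
  qed
  thus "E i j (sg C 1) = 0"
    unfolding E_single by (auto simp: EL_single lin_0[OF lin_iota] intro!: sum_mset.neutral)
qed

lemma E_diag:
  assumes "v \<in> wt m n b"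
  shows "E i i v = scl (real (count b i)) v"
proof (rule lin_eq_on_wt[OF lin_E lin_scale[OF lin_id] assms])
  fix C assume C: "C \<in> B m n b"
  have "E i i (sg C 1) = (\<Sum>S\<in>#C. if i \<in> S then sg C 1 else 0)"
    unfolding E_single
  proof (intro arg_cong[of _ _ sum_mset] image_mset_cong)
    fix S assume "S \<in># C"
    thus "sg (C - {#S#}) 1 * iota (EL i i (sg S 1)) = (if i \<in> S then sg C 1 else 0)"
      by (auto simp: EL_single iota_single mult_single insert_absorb eps_remove lin_0[OF lin_iota])
  qed
  also have "\<dots> = scl (real (count (\<Sum>S\<in>#C. mset_set S) i)) (sg C 1)"
  proof -
    have "(\<Sum>S\<in>#D. if i \<in> S then w else 0) = scl (real (count (\<Sum>S\<in>#D. mset_set S) i)) w"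
      if "\<forall>S\<in>#D. finite S" for D and w :: vec
      using that by (induction D) (auto simp: scl_add_left)
    thus ?thesis using C by (auto simp: B_def)
  qed
  finally show "E i i (sg C 1) = scl (real (count b i)) (sg C 1)" using C by (simp add: B_def)
qed

lemma sum_pairs_snd: "(\<Sum>(a, b)\<in>pairs N. f b) = (\<Sum>i<N. of_nat i * (f i :: 'a::comm_ring_1))"
proof -
  have "pairs N = (\<lambda>(b, a). (a, b)) ` (SIGMA b:{..<N}. {..<b})" by (auto simp: pairs_def image_iff)
  moreover have "inj_on (\<lambda>(b, a). (a, b)) (SIGMA b:{..<N}. {..<b::nat})" by (auto simp: inj_on_def)
  ultimately have "(\<Sum>(a, b)\<in>pairs N. f b) = (\<Sum>(b, a)\<in>(SIGMA b:{..<N}. {..<b}). f b)"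
    by (simp add: sum.reindex) (simp add: case_prod_beta o_def)
  thus ?thesis by (simp add: sum.Sigma[symmetric])
qed

lemma sum_square_pairs:
  "(\<Sum>i<N. \<Sum>j<N. f i j) = (\<Sum>i<N. f i i) + (\<Sum>(a, b)\<in>pairs N. f a b + f b (a :: nat) :: 'a::comm_monoid_add)"
proof -
  have eq: "{..<N} \<times> {..<N} = ((\<lambda>i. (i, i)) ` {..<N}) \<union> (pairs N \<union> prod.swap ` pairs N)"
    by (auto simp: pairs_def image_iff)
  have "(\<Sum>i<N. \<Sum>j<N. f i j) = (\<Sum>(i, j)\<in>{..<N} \<times> {..<N}. f i j)" by (rule sum.cartesian_product)
  also have "\<dots> = (\<Sum>(i, j)\<in>(\<lambda>i. (i, i)) ` {..<N}. f i j) + (\<Sum>(i, j)\<in>pairs N \<union> prod.swap ` pairs N. f i j)"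
    unfolding eq by (rule sum.union_disjoint) (simp, simp, auto simp: pairs_def)
  also have "(\<Sum>(i, j)\<in>pairs N \<union> prod.swap ` pairs N. f i j) = (\<Sum>(i, j)\<in>pairs N. f i j) + (\<Sum>(i, j)\<in>prod.swap ` pairs N. f i j)"
    by (rule sum.union_disjoint) (simp, simp, auto simp: pairs_def)
  also have "(\<Sum>(i, j)\<in>prod.swap ` pairs N. f i j) = (\<Sum>(a, b)\<in>pairs N. f b a)"
    by (subst sum.reindex) (auto simp: case_prod_beta)
  also have "(\<Sum>(i, j)\<in>(\<lambda>i. (i, i)) ` {..<N}. f i j) = (\<Sum>i<N. f i i)"
    by (subst sum.reindex) (auto simp: inj_on_def)
  finally show ?thesis by (simp add: sum.distrib case_prod_beta)
qed

text \<open>Raising operators are moved to the right by E_ij E_ji = E_ji E_ij + E_ii - E_jj. The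
  weight differences, summed over i < j, produce the coefficients N - 1 - 2i of
  \<open>cas_val\<close>.\<close>

lemma casimir_wt:
  assumes v: "v \<in> wt m n b"
  shows "casimir N v = scl (cas_val N b) v + scl 2 (\<Sum>(i, j)\<in>pairs N. E j i (E i j v))"
proof -
  let ?c = "\<lambda>i. real (count b i)"
  have diag: "E i i (E i i v) = scl ((?c i)\<^sup>2) v" for i
    using v by (simp add: E_diag[OF v] lin_scl[OF lin_E] power2_eq_square)
  have off: "E i j (E j i v) + E j i (E i j v) = scl (?c i - ?c j) v + scl 2 (E j i (E i j v))" if "i < j" for i j
    using that E_swap[of i j j i v] E_diag[OF v] scl_add_left[of 1 1 "E j i (E i j v)"]
    by (simp add: pvs.scale_left_diff_distrib)
  have "casimir N v = (\<Sum>i<N. E i i (E i i v)) + (\<Sum>(i, j)\<in>pairs N. E i j (E j i v) + E j i (E i j v))"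
    unfolding casimir_def by (rule sum_square_pairs)
  also have "(\<Sum>(i, j)\<in>pairs N. E i j (E j i v) + E j i (E i j v))
      = (\<Sum>(i, j)\<in>pairs N. scl (?c i - ?c j) v + scl 2 (E j i (E i j v)))"
    by (intro sum.cong refl) (auto simp: off pairs_def)
  also have "\<dots> = scl (\<Sum>(i, j)\<in>pairs N. ?c i - ?c j) v + scl 2 (\<Sum>(i, j)\<in>pairs N. E j i (E i j v))"
    by (simp add: case_prod_beta sum.distrib pvs.scale_sum_left pvs.scale_sum_right)
  also have "(\<Sum>i<N. E i i (E i i v)) = scl (\<Sum>i<N. (?c i)\<^sup>2) v"
    by (simp add: diag pvs.scale_sum_left)
  also have "scl (\<Sum>i<N. (?c i)\<^sup>2) v + (scl (\<Sum>(i, j)\<in>pairs N. ?c i - ?c j) v + scl 2 (\<Sum>(i, j)\<in>pairs N. E j i (E i j v)))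
     = scl ((\<Sum>i<N. (?c i)\<^sup>2) + (\<Sum>(i, j)\<in>pairs N. ?c i - ?c j)) v + scl 2 (\<Sum>(i, j)\<in>pairs N. E j i (E i j v))"
    by (simp add: scl_add_left)
  also have "(\<Sum>i<N. (?c i)\<^sup>2) + (\<Sum>(i, j)\<in>pairs N. ?c i - ?c j) = cas_val N b"
  proof -
    have "(\<Sum>(i, j)\<in>pairs N. ?c i - ?c j) = (\<Sum>(i, j)\<in>pairs N. ?c i) - (\<Sum>(i, j)\<in>pairs N. ?c j)"
      by (simp add: case_prod_beta sum_subtractf)
    also have "\<dots> = (\<Sum>i<N. (real N - 1 - 2 * real i) * ?c i)"
      unfolding sum_pairs_fst sum_pairs_snd sum_subtractf[symmetric]
      by (intro sum.cong refl) (simp add: algebra_simps)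
    finally show ?thesis by (simp add: cas_val_def sum.distrib)
  qed
  finally show ?thesis .
qed

section \<open>Traces and highest weight vectors\<close>

definition trace_on :: "'a set \<Rightarrow> (('a \<Rightarrow>\<^sub>0 real) \<Rightarrow> ('a \<Rightarrow>\<^sub>0 real)) \<Rightarrow> real" where
  "trace_on Bs A = (\<Sum>C\<in>Bs. lk (A (sg C 1)) C)"

lemma tr_cong: "(\<And>C. C \<in> Bs \<Longrightarrow> A (sg C 1) = A' (sg C 1)) \<Longrightarrow> trace_on Bs A = trace_on Bs A'"
  by (simp add: trace_on_def)

lemma tr_cyclic:
  assumes "finite Bs" "finite Bs'" "lin A" "lin A'"
    and A: "\<And>C. C \<in> Bs \<Longrightarrow> Poly_Mapping.keys (A (sg C 1)) \<subseteq> Bs'"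
    and A': "\<And>C. C \<in> Bs' \<Longrightarrow> Poly_Mapping.keys (A' (sg C 1)) \<subseteq> Bs"
  shows "trace_on Bs (\<lambda>v. A' (A v)) = trace_on Bs' (\<lambda>v. A (A' v))"
proof -
  have 1: "lk (A' (A (sg C 1))) C = (\<Sum>C'\<in>Bs'. lk (A (sg C 1)) C' * lk (A' (sg C' 1)) C)" if "C \<in> Bs" for C
    using lin_expand[OF \<open>lin A'\<close> \<open>finite Bs'\<close> A[OF that]] by (simp add: lookup_sum)
  have 2: "lk (A (A' (sg C' 1))) C' = (\<Sum>C\<in>Bs. lk (A' (sg C' 1)) C * lk (A (sg C 1)) C')" if "C' \<in> Bs'" for C'
    using lin_expand[OF \<open>lin A\<close> \<open>finite Bs\<close> A'[OF that]] by (simp add: lookup_sum)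
  show ?thesis unfolding trace_on_def
    by (simp add: 1 2, subst sum.swap) (simp add: mult.commute)
qed

text \<open>With the images expanded in a basis \<open>Z\<close> of \<open>H\<close>, interchanging
  the sums turns the trace into the sum over z in \<open>Z\<close> of the z-coordinate of
  \<open>P z\<close>, and \<open>P z = z\<close>.\<close>

lemma tr_projection:
  assumes fin: "finite Bs" and P: "lin P"
    and into: "\<And>C. C \<in> Bs \<Longrightarrow> P (sg C 1) \<in> H"
    and idem: "\<And>v. v \<in> H \<Longrightarrow> P v = v"
    and H: "\<And>v. v \<in> H \<Longrightarrow> Poly_Mapping.keys v \<subseteq> Bs"
  shows "trace_on Bs P = real (pvs.dim H)"
proof -
  obtain Z where Z: "Z \<subseteq> H" "pvs.independent Z" "H \<subseteq> pvs.span Z" "card Z = pvs.dim H"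
    using pvs.basis_exists by blast
  have "v \<in> pvs.span ((\<lambda>C. sg C 1) ` Bs)" if "v \<in> H" for v
  proof -
    have "(\<Sum>C\<in>Bs. scl (lk v C) (sg C 1)) = v"
      by (simp add: poly_mapping_sum_single[OF fin H[OF that], symmetric])
    moreover have "(\<Sum>C\<in>Bs. scl (lk v C) (sg C 1)) \<in> pvs.span ((\<lambda>C. sg C 1) ` Bs)"
      by (intro pvs.span_sum pvs.span_scale pvs.span_base) auto
    ultimately show ?thesis by metis
  qed
  hence "finite Z"
    using pvs.independent_span_bound[of "(\<lambda>C. sg C 1) ` Bs" Z] Z(1,2) fin by blast
  have "trace_on Bs P = (\<Sum>C\<in>Bs. \<Sum>z\<in>Z. pvs.representation Z (P (sg C 1)) z * lk z C)"
    unfolding trace_on_def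
  proof (intro sum.cong refl)
    fix C assume "C \<in> Bs"
    hence "P (sg C 1) \<in> pvs.span Z" using into Z(3) by blast
    hence "P (sg C 1) = (\<Sum>z\<in>Z. scl (pvs.representation Z (P (sg C 1)) z) z)"
      using pvs.sum_representation_eq[of Z "P (sg C 1)" Z] Z(2) \<open>finite Z\<close> by simp
    from arg_cong[OF this, of "\<lambda>v. lk v C"]
    show "lk (P (sg C 1)) C = (\<Sum>z\<in>Z. pvs.representation Z (P (sg C 1)) z * lk z C)"
      by (simp add: lookup_sum)
  qed
  also have "\<dots> = (\<Sum>z\<in>Z. \<Sum>C\<in>Bs. lk z C * pvs.representation Z (P (sg C 1)) z)"
    by (subst sum.swap) (simp add: mult.commute)
  also have "\<dots> = (\<Sum>z\<in>Z. 1)"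
  proof (intro sum.cong refl)
    fix z assume z: "z \<in> Z"
    hence zH: "z \<in> H" using Z(1) by auto
    have sp: "P (sg C 1) \<in> pvs.span Z" if "C \<in> Bs" for C using that into Z(3) by blast
    have "z = P z" using idem[OF zH] by simp
    also have "P z = (\<Sum>C\<in>Bs. scl (lk z C) (P (sg C 1)))"
      by (rule lin_expand[OF P fin H[OF zH]])
    finally have "pvs.representation Z z z = pvs.representation Z (\<Sum>C\<in>Bs. scl (lk z C) (P (sg C 1))) z"
      by (rule arg_cong)
    also have "\<dots> = (\<Sum>C\<in>Bs. pvs.representation Z (scl (lk z C) (P (sg C 1))) z)"
      by (subst pvs.representation_sum[OF Z(2)]) (auto intro: pvs.span_scale sp)
    also have "\<dots> = (\<Sum>C\<in>Bs. lk z C * pvs.representation Z (P (sg C 1)) z)"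
      by (intro sum.cong refl) (simp add: pvs.representation_scale[OF Z(2) sp])
    finally show "(\<Sum>C\<in>Bs. lk z C * pvs.representation Z (P (sg C 1)) z) = 1"
      using pvs.representation_basis[OF Z(2) z] by simp
  qed
  finally show ?thesis using Z(4) by simp
qed

section \<open>Generating functions of traces and Freudenthal's recursion\<close>

definition trace_poly :: "nat \<Rightarrow> nat \<Rightarrow> nat \<Rightarrow> (vec \<Rightarrow> vec) \<Rightarrow> mpoly" where
  "trace_poly N m n A = (\<Sum>b\<in>multisets_of_size {..<N} (m * n). sg b (trace_on (B m n b) A))"

lemma lookup_trace_poly: "lk (trace_poly N m n A) b = (if set_mset b \<subseteq> {..<N} then trace_on (B m n b) A else 0)"
proof -
  have fin: "finite (multisets_of_size {..<N} (m * n))" by (rule finite_multisets_of_size) simp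
  have "lk (trace_poly N m n A) b = (\<Sum>c\<in>multisets_of_size {..<N} (m * n). if c = b then trace_on (B m n b) A else 0)"
    unfolding trace_poly_def lookup_sum by (intro sum.cong refl) (auto simp: lookup_single when_def)
  also have "\<dots> = (if b \<in> multisets_of_size {..<N} (m * n) then trace_on (B m n b) A else 0)"
    using fin by simp
  also have "\<dots> = (if set_mset b \<subseteq> {..<N} then trace_on (B m n b) A else 0)"
  proof (cases "size b = m * n")
    case False
    hence "B m n b = {}" using size_B by auto
    thus ?thesis by (simp add: trace_on_def)
  qed (simp add: multisets_of_size_def)
  finally show ?thesis .
qed

lemma trace_poly_size: "lk (trace_poly N m n A) b \<noteq> 0 \<Longrightarrow> size b = m * n \<and> set_mset b \<subseteq> {..<N}"
proof -
  assume "lk (trace_poly N m n A) b \<noteq> 0"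
  hence 1: "set_mset b \<subseteq> {..<N}" "trace_on (B m n b) A \<noteq> 0" by (auto simp: lookup_trace_poly split: if_splits)
  hence "B m n b \<noteq> {}" by (auto simp: trace_on_def)
  thus ?thesis using 1 size_B by blast
qed

definition equivariant :: "nat \<Rightarrow> nat \<Rightarrow> nat \<Rightarrow> (vec \<Rightarrow> vec) \<Rightarrow> bool" where
  "equivariant N m n P \<longleftrightarrow> lin P \<and> (\<forall>i<N. \<forall>j<N. \<forall>v. P (E i j v) = E i j (P v)) \<and> (\<forall>b v. v \<in> wt m n b \<longrightarrow> P v \<in> wt m n b)"

lemma equivariantD:
  assumes "equivariant N m n P"
  shows "lin P" "i < N \<Longrightarrow> j < N \<Longrightarrow> P (E i j v) = E i j (P v)" "v \<in> wt m n b \<Longrightarrow> P v \<in> wt m n b"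
  using assms by (auto simp: equivariant_def)

lemma E_E_wt: "v \<in> wt m n b \<Longrightarrow> E j i (E i j v) \<in> wt m n b"
proof (cases "j \<in># b")
  case True
  assume "v \<in> wt m n b"
  from E_wt[OF E_wt[OF this True, of i], of i j] True show ?thesis by simp
qed (simp add: E_wt_0 lin_0[OF lin_E])

lemma tr_add: "trace_on Bs (\<lambda>v. A v + A' v) = trace_on Bs A + trace_on Bs A'"
  and tr_diff: "trace_on Bs (\<lambda>v. A v - A' v) = trace_on Bs A - trace_on Bs A'"
  and tr_scl: "trace_on Bs (\<lambda>v. scl r (A v)) = r * trace_on Bs A"
  and tr_sum: "trace_on Bs (\<lambda>v. \<Sum>i\<in>I. F i v) = (\<Sum>i\<in>I. trace_on Bs (F i))"
  by (simp_all add: trace_on_def lookup_add lookup_minus lookup_sum sum.distrib sum_subtractf sum_distrib_left)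
     (rule sum.swap)

text \<open>Plays the role of \<open>U a b\<close> in \<open>casimir_eigenvalue\<close>.\<close>

definition trace_poly_EE :: "nat \<Rightarrow> nat \<Rightarrow> nat \<Rightarrow> (vec \<Rightarrow> vec) \<Rightarrow> nat \<Rightarrow> nat \<Rightarrow> mpoly" where
  "trace_poly_EE N m n P a b = trace_poly N m n (\<lambda>v. P (E b a (E a b v)))"

text \<open>Freudenthal's step: cyclicity of the trace carries the operator from weight
  \<open>c\<close> to weight \<open>d\<close>, where the commutator of \<open>E a b\<close> and
  \<open>E b a\<close> contributes the difference of the two weight entries.\<close>

lemma tr_Up_step:
  assumes P: "equivariant N m n P" and ab: "a < N" "b < N" "a \<noteq> b"
    and c: "c = add_mset b g" and d: "d = add_mset a g"
  shows "trace_on (B m n c) (\<lambda>v. P (E b a (E a b v)))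
       = trace_on (B m n d) (\<lambda>v. P (E b a (E a b v))) + (real (count d a) - real (count d b)) * trace_on (B m n d) P"
proof -
  note linP = equivariantD(1)[OF P]
  have "trace_on (B m n c) (\<lambda>v. P (E b a (E a b v))) = trace_on (B m n d) (\<lambda>v. E a b (P (E b a v)))"
  proof (rule tr_cyclic[OF finite_B finite_B lin_E lin_comp[OF linP lin_E]])
    fix C assume "C \<in> B m n c"
    from E_wt[OF wt_single[OF this], of b a 1] c d
    show "Poly_Mapping.keys (E a b (sg C 1)) \<subseteq> B m n d" by (simp add: wt_def)
  next
    fix C assume "C \<in> B m n d"
    from equivariantD(3)[OF P E_wt[OF wt_single[OF this]], of a b 1] c d
    show "Poly_Mapping.keys (P (E b a (sg C 1))) \<subseteq> B m n c" by (simp add: wt_def)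
  qed
  also have "\<dots> = trace_on (B m n d) (\<lambda>v. P (E b a (E a b v)) + scl (real (count d a) - real (count d b)) (P v))"
  proof (rule tr_cong)
    fix C assume "C \<in> B m n d"
    hence v: "sg C 1 \<in> wt m n d" by (rule wt_single)
    have "E a b (P (E b a (sg C 1))) = P (E a b (E b a (sg C 1)))" using equivariantD(2)[OF P] ab by simp
    also have "E a b (E b a (sg C 1)) = E b a (E a b (sg C 1)) + scl (real (count d a) - real (count d b)) (sg C 1)"
      using E_swap[of a b b a "sg C 1"] E_diag[OF v] by (simp add: pvs.scale_left_diff_distrib single_diff)
    finally show "E a b (P (E b a (sg C 1))) = P (E b a (E a b (sg C 1))) + scl (real (count d a) - real (count d b)) (P (sg C 1))"
      by (simp only: lin_add[OF linP] lin_scl[OF linP])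
  qed
  finally show ?thesis by (simp add: tr_add tr_scl)
qed

text \<open>One end of a string of weights, where \<open>E a b\<close> annihilates the weight space.
  At the other end, in \<open>tr_Up_1\<close>, it is \<open>E b a\<close> that does, so only the
  commutator remains.\<close>

lemma tr_Up_0:
  assumes P: "equivariant N m n P" and "b \<notin># c"
  shows "trace_on (B m n c) (\<lambda>v. P (E b a (E a b v))) = 0"
proof -
  have "P (E b a (E a b (sg C 1))) = 0" if "C \<in> B m n c" for C
    using E_wt_0[OF wt_single[OF that] assms(2)] by (simp add: lin_0[OF lin_E] lin_0[OF equivariantD(1)[OF P]])
  thus ?thesis by (simp add: trace_on_def)
qed

lemma tr_Up_1:
  assumes P: "equivariant N m n P" and "a \<notin># c" "a \<noteq> b"
  shows "trace_on (B m n c) (\<lambda>v. P (E b a (E a b v))) = real (count c b) * trace_on (B m n c) P"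
proof -
  have "P (E b a (E a b (sg C 1))) = scl (real (count c b)) (P (sg C 1))" if "C \<in> B m n c" for C
  proof -
    note v = wt_single[OF that, of 1]
    have "E b a (E a b (sg C 1)) = scl (real (count c b)) (sg C 1)"
      using E_swap[of b a a b "sg C 1"] E_diag[OF v] E_wt_0[OF v assms(2)] assms(2,3)
      by (simp add: lin_0[OF lin_E] not_in_iff)
    thus ?thesis by (simp only: lin_scl[OF equivariantD(1)[OF P]])
  qed
  thus ?thesis by (simp add: trace_on_def sum_distrib_left)
qed

text \<open>The recursion as an identity of polynomials. If \<open>c\<close> contains both letters,
  \<open>c - {#a#}\<close> and \<open>c - {#b#}\<close> are neighbouring weights and
  \<open>tr_Up_step\<close> applies; if it contains one, the string ends there.\<close>

lemma trace_poly_EE_eq: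
  assumes P: "equivariant N m n P" and ab: "a < b" "b < N"
  shows "(X a - X b) * trace_poly_EE N m n P a b = X b * (euler a (trace_poly N m n P) - euler b (trace_poly N m n P))"
proof (rule poly_mapping_eqI)
  fix c
  let ?U = "\<lambda>c. trace_on (B m n c) (\<lambda>v. P (E b a (E a b v)))" and ?T = "\<lambda>c. trace_on (B m n c) P"
  have L: "lk ((X a - X b) * trace_poly_EE N m n P a b) c = lk (X a * trace_poly_EE N m n P a b) c - lk (X b * trace_poly_EE N m n P a b) c"
    by (simp add: left_diff_distrib lookup_minus)
  show "lk ((X a - X b) * trace_poly_EE N m n P a b) c = lk (X b * (euler a (trace_poly N m n P) - euler b (trace_poly N m n P))) c"
  proof (cases "set_mset c \<subseteq> {..<N}")
    case False
    then obtain z where z: "z \<in># c" "z \<notin> {..<N}" by auto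
    hence "z \<in># c - {#a#}" "z \<in># c - {#b#}" using ab by (auto simp: in_diff_count)
    hence "\<not> set_mset (c - {#a#}) \<subseteq> {..<N}" "\<not> set_mset (c - {#b#}) \<subseteq> {..<N}" using z by auto
    thus ?thesis unfolding L lookup_X_mult by (simp add: trace_poly_EE_def lookup_trace_poly lookup_euler lookup_minus)
  next
    case True
    hence sub: "set_mset (c - {#a#}) \<subseteq> {..<N}" "set_mset (c - {#b#}) \<subseteq> {..<N}"
      by (auto dest: in_diffD)
    have R: "lk (X b * (euler a (trace_poly N m n P) - euler b (trace_poly N m n P))) c
      = (if b \<in># c then (real (count (c - {#b#}) a) - real (count (c - {#b#}) b)) * ?T (c - {#b#}) else 0)"
      using sub by (simp add: lookup_X_mult lookup_trace_poly lookup_euler lookup_minus left_diff_distrib)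
    have LL: "lk ((X a - X b) * trace_poly_EE N m n P a b) c = (if a \<in># c then ?U (c - {#a#}) else 0) - (if b \<in># c then ?U (c - {#b#}) else 0)"
      using sub unfolding L by (simp add: lookup_X_mult trace_poly_EE_def lookup_trace_poly)
    show ?thesis
    proof (cases "a \<in># c")
      case a: True
      show ?thesis
      proof (cases "b \<in># c")
        case b: True
        have "c - {#a#} = add_mset b (c - {#a#} - {#b#})" "c - {#b#} = add_mset a (c - {#a#} - {#b#})"
          using a b ab by (auto simp: multiset_eq_iff)
        from tr_Up_step[OF P _ ab(2) _ this] ab
        show ?thesis unfolding LL R using a b by simp
      next
        case b: False
        hence "?U (c - {#a#}) = 0" by (intro tr_Up_0[OF P]) (auto dest: in_diffD)
        thus ?thesis unfolding LL R using a b by simp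
      qed
    next
      case a: False
      hence "a \<notin># c - {#b#}" by (auto dest: in_diffD)
      from tr_Up_1[OF P this, of b] this ab
      have "?U (c - {#b#}) = real (count (c - {#b#}) b) * ?T (c - {#b#})" "count (c - {#b#}) a = 0"
        by (simp_all only: not_in_iff)
      thus ?thesis unfolding LL R using a by (simp add: left_diff_distrib del: count_diff)
    qed
  qed
qed

lemma equivariant_casimir_comp:
  assumes P: "equivariant N m n P" shows "equivariant N m n (\<lambda>v. casimir N (P v))"
  unfolding equivariant_def
proof (intro conjI allI impI)
  fix b v assume "v \<in> wt m n b"
  hence v: "P v \<in> wt m n b" by (rule equivariantD(3)[OF P])
  show "casimir N (P v) \<in> wt m n b"
    unfolding casimir_wt[OF v] by (intro wt_add wt_scl wt_sum v) (auto intro: E_E_wt v)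
qed (auto simp: equivariantD(2)[OF P] casimir_E intro: lin_comp[OF lin_casimir equivariantD(1)[OF P]])

lemma equivariant_casimir_commute:
  assumes P: "equivariant N m n P" shows "P (casimir N v) = casimir N (P v)"
  unfolding casimir_def by (simp add: lin_sum[OF equivariantD(1)[OF P]] equivariantD(2)[OF P])

text \<open>Since \<open>P\<close> commutes with the Casimir operator it may act last, after
  \<open>casimir_wt\<close> has rewritten that operator; the traces that arise are those of
  \<open>trace_poly_EE\<close>.\<close>

lemma trace_poly_casimir:
  assumes P: "equivariant N m n P"
    and l: "set_mset l \<subseteq> {..<N}" "size l = m * n"
  shows "lk (V N * trace_poly N m n (\<lambda>v. casimir N (P v))) (l + mon N (staircase N)) = cas_val N l * lk (V N * trace_poly N m n P) (l + mon N (staircase N))"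
proof (rule casimir_eigenvalue[OF trace_poly_EE_eq[OF P] _ trace_poly_size l])
  fix c
  have "trace_on (B m n c) (\<lambda>v. casimir N (P v)) = trace_on (B m n c) (\<lambda>v. scl (cas_val N c) (P v) + scl 2 (\<Sum>s\<in>pairs N. P (E (snd s) (fst s) (E (fst s) (snd s) v))))"
  proof (rule tr_cong)
    fix C assume "C \<in> B m n c"
    hence v: "sg C 1 \<in> wt m n c" by (rule wt_single)
    have "casimir N (P (sg C 1)) = P (casimir N (sg C 1))" by (simp add: equivariant_casimir_commute[OF P])
    thus "casimir N (P (sg C 1)) = scl (cas_val N c) (P (sg C 1)) + scl 2 (\<Sum>s\<in>pairs N. P (E (snd s) (fst s) (E (fst s) (snd s) (sg C 1))))"
      unfolding casimir_wt[OF v]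
      by (simp only: lin_add[OF equivariantD(1)[OF P]] lin_scl[OF equivariantD(1)[OF P]] lin_sum[OF equivariantD(1)[OF P]] case_prod_beta)
  qed
  thus "lk (trace_poly N m n (\<lambda>v. casimir N (P v))) c = cas_val N c * lk (trace_poly N m n P) c + 2 * (\<Sum>(a, b)\<in>pairs N. lk (trace_poly_EE N m n P a b) c)"
    by (auto simp: lookup_trace_poly trace_poly_EE_def tr_add tr_scl tr_sum case_prod_beta)
qed auto

section \<open>Products of shifted Casimir operators\<close>

primrec casimir_prod :: "nat \<Rightarrow> nat multiset list \<Rightarrow> vec \<Rightarrow> vec" where
  "casimir_prod N [] v = v"
| "casimir_prod N (b # bs) v = casimir N (casimir_prod N bs v) - scl (cas_val N b) (casimir_prod N bs v)"

lemma equivariant_casimir_prod: "equivariant N m n (casimir_prod N bs)"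
proof (induction bs)
  case Nil
  show ?case by (simp add: equivariant_def)
next
  case (Cons b bs)
  note O = equivariant_casimir_comp[OF Cons]
  show ?case unfolding equivariant_def
  proof (intro conjI allI impI)
    show "lin (casimir_prod N (b # bs))" using lin_minus[OF equivariantD(1)[OF O] lin_scale[OF equivariantD(1)[OF Cons]]] by (simp add: lin_def)
  qed (auto simp: equivariantD(2)[OF Cons] casimir_E lin_diff[OF lin_E] lin_scl[OF lin_E] intro!: wt_diff wt_scl equivariantD(3)[OF Cons] equivariantD(3)[OF O])
qed

lemma lin_casimir_prod: "lin (casimir_prod N bs)" using equivariant_casimir_prod[of N 0 0 bs] by (rule equivariantD)

lemma casimir_prod_casimir: "casimir_prod N bs (casimir N v) = casimir N (casimir_prod N bs v)"
  using equivariant_casimir_commute[OF equivariant_casimir_prod[of N 0 0 bs]] .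

text \<open>All factors are polynomials in one operator and commute, so any of them may act
  first.\<close>

lemma casimir_prod_remove1: "b \<in> set bs \<Longrightarrow> casimir_prod N bs v = casimir_prod N (remove1 b bs) (casimir N v - scl (cas_val N b) v)"
  by (induction bs arbitrary: v)
     (auto simp: casimir_prod_casimir lin_diff[OF lin_casimir_prod] lin_scl[OF lin_casimir_prod] lin_diff[OF lin_casimir] lin_scl[OF lin_casimir] scl_diff mult.commute)

lemma trace_poly_casimir_prod:
  assumes l: "set_mset l \<subseteq> {..<N}" "size l = m * n"
  shows "lk (V N * trace_poly N m n (casimir_prod N bs)) (l + mon N (staircase N))
       = (\<Prod>b\<leftarrow>bs. cas_val N l - cas_val N b) * lk (V N * trace_poly N m n (\<lambda>v. v)) (l + mon N (staircase N))"
proof (induction bs)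
  case Nil
  have "casimir_prod N [] = (\<lambda>v. v)" by auto
  thus ?case by simp
next
  case (Cons b bs)
  have eq: "casimir_prod N (b # bs) = (\<lambda>v. casimir N (casimir_prod N bs v) - scl (cas_val N b) (casimir_prod N bs v))" by auto
  have "trace_poly N m n (casimir_prod N (b # bs)) = trace_poly N m n (\<lambda>v. casimir N (casimir_prod N bs v)) - sg 0 (cas_val N b) * trace_poly N m n (casimir_prod N bs)"
    unfolding eq
    by (rule poly_mapping_eqI) (simp only: lookup_minus lookup_const_mult, simp add: lookup_trace_poly tr_diff tr_scl)
  hence "lk (V N * trace_poly N m n (casimir_prod N (b # bs))) (l + mon N (staircase N))
    = lk (V N * trace_poly N m n (\<lambda>v. casimir N (casimir_prod N bs v))) (l + mon N (staircase N)) - cas_val N b * lk (V N * trace_poly N m n (casimir_prod N bs)) (l + mon N (staircase N))"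
    by (simp only: right_diff_distrib lookup_minus mult.left_commute[of "V N" "sg 0 (cas_val N b)"] lookup_const_mult)
  thus ?case unfolding trace_poly_casimir[OF equivariant_casimir_prod l] Cons by (simp add: algebra_simps del: casimir_prod.simps)
qed

lemma dom_raise:
  assumes "i < j" "j \<in># b"
  shows "dominated b (add_mset i (b - {#j#}))" "add_mset i (b - {#j#}) \<noteq> b"
proof -
  obtain c where c: "b = add_mset j c" using assms(2) by (metis mset_add)
  show "dominated b (add_mset i (b - {#j#}))" using assms(1) by (auto simp: c dominated_def)
  show "add_mset i (b - {#j#}) \<noteq> b" using assms(1) by (auto simp: c)
qed

text \<open>Let the factor for \<open>b\<close> itself act first: by \<open>casimir_wt\<close> it
  leaves a sum of terms \<open>E j i (E i j v)\<close>. The remaining product commutes with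
  \<open>E j i\<close>, and \<open>E i j v\<close> has a strictly higher weight, so induction
  applies with \<open>b\<close> removed from the list.\<close>

lemma casimir_prod_eq_0:
  assumes "distinct bs" "v \<in> wt m n b" "set_mset b \<subseteq> {..<N}"
    and "\<And>b'. dominated b b' \<Longrightarrow> set_mset b' \<subseteq> {..<N} \<Longrightarrow> b' \<in> set bs"
  shows "casimir_prod N bs v = 0"
  using assms
proof (induction "length bs" arbitrary: bs b v)
  case 0
  thus ?case using "0.prems"(4)[of b] by simp
next
  case (Suc n')
  note v = Suc.prems(2)
  have mem: "b \<in> set bs" using Suc.prems(3,4) by simp
  let ?bs = "remove1 b bs"
  have "casimir_prod N bs v = casimir_prod N ?bs (scl 2 (\<Sum>(i, j)\<in>pairs N. E j i (E i j v)))"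
    unfolding casimir_prod_remove1[OF mem] casimir_wt[OF v] by simp
  also have "\<dots> = scl 2 (\<Sum>(i, j)\<in>pairs N. E j i (casimir_prod N ?bs (E i j v)))"
    unfolding lin_scl[OF lin_casimir_prod] lin_sum[OF lin_casimir_prod] case_prod_beta
    by (intro arg_cong[of _ _ "scl 2"] sum.cong refl equivariantD(2)[OF equivariant_casimir_prod]) (auto simp: pairs_def)
  also have "\<dots> = scl 2 (\<Sum>(i, j)\<in>pairs N. 0)"
  proof (intro arg_cong[of _ _ "scl 2"] sum.cong refl, clarify)
    fix i j assume "(i, j) \<in> pairs N"
    hence ij: "i < j" "j < N" by (auto simp: pairs_def)
    have "casimir_prod N ?bs (E i j v) = 0"
    proof (cases "j \<in># b")
      case True
      show ?thesis
      proof (rule Suc.hyps(1)[OF _ _ E_wt[OF v True]])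
        show "n' = length ?bs" using Suc.hyps(2) mem by (simp add: length_remove1)
        show "distinct ?bs" using Suc.prems(1) by simp
        show "set_mset (add_mset i (b - {#j#})) \<subseteq> {..<N}" using Suc.prems(3) ij by (auto dest: in_diffD)
        fix b' assume b': "dominated (add_mset i (b - {#j#})) b'" "set_mset b' \<subseteq> {..<N}"
        have "b' \<in> set bs" using Suc.prems(4) dom_trans[OF dom_raise(1)[OF ij(1) True] b'(1)] b'(2) by blast
        moreover have "b' \<noteq> b" using dom_raise[OF ij(1) True] b'(1) dom_antisym by blast
        ultimately show "b' \<in> set ?bs" using Suc.prems(1) by simp
      qed
    qed (simp add: E_wt_0[OF v] lin_0[OF lin_casimir_prod])
    thus "E j i (casimir_prod N ?bs (E i j v)) = 0" by (simp add: lin_0[OF lin_E])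
  qed
  finally show ?case by simp
qed

lemma size_filter_less: "size (filter_mset (\<lambda>i. i < r) b) = (\<Sum>i<r. count b i)" for r :: nat
  by (induction r) (simp_all add: size_filter_Suc)

text \<open>Summation by parts. As the total of the \<open>x i\<close> is 0, the last weight may
  have either sign.\<close>

lemma abel_nonneg:
  fixes x w :: "nat \<Rightarrow> real"
  assumes "\<And>r. r \<le> N \<Longrightarrow> 0 \<le> (\<Sum>i<r. x i)" "(\<Sum>i<N. x i) = 0"
    and w: "\<And>i. Suc i < N \<Longrightarrow> w (Suc i) \<le> w i"
  shows "0 \<le> (\<Sum>i<N. x i * w i)"
proof (cases N)
  case (Suc M)
  have "(\<Sum>i<Suc r. x i) * w r \<le> (\<Sum>i<Suc r. x i * w i)" if "r < N" for r
    using that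
  proof (induction r)
    case (Suc r)
    have "(\<Sum>i<Suc r. x i) * w (Suc r) \<le> (\<Sum>i<Suc r. x i) * w r"
      using Suc.prems assms(1)[of "Suc r"] w[of r] by (intro mult_left_mono) auto
    also have "\<dots> \<le> (\<Sum>i<Suc r. x i * w i)" using Suc by simp
    finally show ?case by (simp add: algebra_simps)
  qed simp
  from this[of M] show ?thesis using assms(2) Suc by simp
qed simp

text \<open>With x = b - l the difference of the eigenvalues is |x|^2 + (x, 2 l + 2 rho). The
  pairing is nonnegative because l + rho is decreasing and x has nonnegative partial sums.\<close>

lemma cas_strict_mono:
  assumes d: "dominated l b" "l \<noteq> b" and s: "set_mset l \<subseteq> {..<N}" "set_mset b \<subseteq> {..<N}"
    and anti: "\<And>i. Suc i < N \<Longrightarrow> count l (Suc i) \<le> count l i"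
  shows "cas_val N l < cas_val N b"
proof -
  let ?x = "\<lambda>i. real (count b i) - real (count l i)"
  let ?w = "\<lambda>i. 2 * real (count l i) + real N - 1 - 2 * real i"
  have "cas_val N b - cas_val N l = (\<Sum>i<N. (?x i)\<^sup>2) + (\<Sum>i<N. ?x i * ?w i)"
    unfolding cas_val_def sum_subtractf[symmetric] sum.distrib[symmetric]
    by (intro sum.cong refl) (simp add: power2_eq_square algebra_simps)
  moreover have "0 \<le> (\<Sum>i<N. ?x i * ?w i)"
  proof (rule abel_nonneg)
    fix r
    have "(\<Sum>i<r. count l i) \<le> (\<Sum>i<r. count b i)"
      using d(1) by (simp add: dominated_def size_filter_less)
    hence "real (\<Sum>i<r. count l i) \<le> real (\<Sum>i<r. count b i)" by (rule of_nat_mono)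
    thus "0 \<le> (\<Sum>i<r. ?x i)" by (simp add: sum_subtractf)
  next
    have "(\<Sum>i<N. count b i) = (\<Sum>i<N. count l i)"
      using d(1) size_mon[of N "count b"] size_mon[of N "count l"] mon_count[OF s(1)] mon_count[OF s(2)]
      by (simp add: dominated_def)
    hence "real (\<Sum>i<N. count b i) = real (\<Sum>i<N. count l i)" by (rule arg_cong)
    thus "(\<Sum>i<N. ?x i) = 0" by (simp add: sum_subtractf)
  qed (use anti in force)
  moreover have "0 < (\<Sum>i<N. (?x i)\<^sup>2)"
  proof -
    obtain i where i: "count b i \<noteq> count l i" using d(2) by (metis multiset_eqI)
    hence "i < N" using s by (metis count_eq_zero_iff lessThan_iff subsetD)
    thus ?thesis using i by (intro sum_pos2[of _ i]) auto
  qed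
  ultimately show ?thesis by simp
qed

definition hw :: "nat \<Rightarrow> nat \<Rightarrow> nat \<Rightarrow> nat multiset \<Rightarrow> vec set" where
  "hw N m n l = {v \<in> wt m n l. \<forall>i j. i < j \<and> j < N \<longrightarrow> E i j v = 0}"

lemma casimir_prod_hw:
  assumes "v \<in> hw N m n l"
  shows "casimir_prod N bs v = scl (\<Prod>b\<leftarrow>bs. cas_val N l - cas_val N b) v"
proof (induction bs)
  case (Cons b bs)
  have "(\<Sum>(i, j)\<in>pairs N. E j i (E i j v)) = 0"
    using assms by (intro sum.neutral) (auto simp: hw_def pairs_def lin_0[OF lin_E])
  hence casimir: "casimir N v = scl (cas_val N l) v" using casimir_wt[of v m n l N] assms by (simp add: hw_def)
  show ?case unfolding casimir_prod.simps Cons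
    by (simp add: lin_scl[OF lin_casimir] casimir pvs.scale_left_diff_distrib algebra_simps)
qed simp

text \<open>The coefficient belonging to the product \<open>?P\<close> of shifted Casimir operators
  is computed twice. By \<open>trace_poly_casimir_prod\<close> it is \<open>?k\<close> times the
  coefficient sought; directly it is the trace of \<open>?P\<close> on the weight space
  \<open>l\<close>, which is \<open>?k\<close> times the dimension of the highest weight
  space.\<close>

proposition alternant_coeff_eq_dim_hw:
  assumes l: "set_mset l \<subseteq> {..<N}" and anti: "\<And>i. Suc i < N \<Longrightarrow> count l (Suc i) \<le> count l i"
  shows "lk (V N * trace_poly N m n (\<lambda>v. v)) (l + mon N (staircase N)) = real (pvs.dim (hw N m n l))"
proof (cases "size l = m * n")
  case sz: True
  let ?D = "{b. dominated l b \<and> b \<noteq> l \<and> set_mset b \<subseteq> {..<N}}"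
  have "?D \<subseteq> multisets_of_size {..<N} (m * n)" by (auto simp: multisets_of_size_def dominated_def sz)
  hence "finite ?D" by (rule finite_subset) (intro finite_multisets_of_size finite_lessThan)
  from finite_distinct_list[OF this] obtain bs where bs: "set bs = ?D" "distinct bs" by auto
  let ?k = "\<Prod>b\<leftarrow>bs. cas_val N l - cas_val N b"
  have "cas_val N l - cas_val N b \<noteq> 0" if "b \<in> set bs" for b
    using cas_strict_mono[of l b N] l anti that bs(1) by auto
  hence k: "?k \<noteq> 0" by (auto simp: prod_list_zero_iff)
  let ?P = "casimir_prod N bs"
  have kill: "?P v = 0" if "v \<in> wt m n b" "dominated l b" "b \<noteq> l" "set_mset b \<subseteq> {..<N}" for v b
  proof (rule casimir_prod_eq_0[OF bs(2) that(1,4)])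
    fix b' assume "dominated b b'" "set_mset b' \<subseteq> {..<N}"
    moreover have "b' \<noteq> l" using that(2,3) \<open>dominated b b'\<close> dom_antisym by blast
    ultimately show "b' \<in> set bs" using dom_trans[OF that(2)] bs(1) by auto
  qed
  \<comment> \<open>A raising operator commutes with \<open>?P\<close> and leads to a strictly
    higher weight space, where \<open>?P\<close> vanishes.\<close>
  have into: "?P v \<in> hw N m n l" if v: "v \<in> wt m n l" for v
    unfolding hw_def
  proof (clarify, intro conjI allI impI)
    show "?P v \<in> wt m n l" by (rule equivariantD(3)[OF equivariant_casimir_prod v])
    fix i j assume ij: "i < j \<and> j < N"
    have "E i j (?P v) = ?P (E i j v)" using equivariantD(2)[OF equivariant_casimir_prod] ij by simp
    also have "\<dots> = 0"
    proof (cases "j \<in># l")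
      case True
      show ?thesis
        by (rule kill[OF E_wt[OF v True]]) (use dom_raise[of i j l] ij True l in \<open>auto dest: in_diffD\<close>)
    qed (simp add: E_wt_0[OF v] lin_0[OF lin_casimir_prod])
    finally show "E i j (?P v) = 0" .
  qed
  have hwsub: "scl r v \<in> hw N m n l" if "v \<in> hw N m n l" for r v
    using that by (auto simp: hw_def wt_scl lin_scl[OF lin_E])
  have "trace_on (B m n l) (\<lambda>v. scl (1 / ?k) (?P v)) = real (pvs.dim (hw N m n l))"
  proof (rule tr_projection[OF finite_B lin_scale[OF lin_casimir_prod]])
    show "scl (1 / ?k) (?P (sg C 1)) \<in> hw N m n l" if "C \<in> B m n l" for C
      using that by (intro hwsub into wt_single)
    show "scl (1 / ?k) (?P v) = v" if "v \<in> hw N m n l" for v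
      unfolding casimir_prod_hw[OF that] using k by simp
  qed (auto simp: hw_def wt_def)
  hence trace_on: "trace_on (B m n l) ?P = ?k * real (pvs.dim (hw N m n l))"
    using k by (simp add: tr_scl field_simps)
  have "lk (V N * trace_poly N m n ?P) (l + mon N (staircase N)) = trace_on (B m n l) ?P"
  proof -
    let ?T = "trace_poly N m n ?P" and ?d = "mon N (staircase N)"
    let ?A = "Poly_Mapping.keys (V N)" and ?B = "insert l (Poly_Mapping.keys ?T)"
    have dA: "?d \<in> ?A" using monic_dom_V[of N] by (auto simp: monic_dom_def in_keys_iff)
    have "lk (V N * ?T) (l + ?d) = (\<Sum>a\<in>?A. \<Sum>b\<in>?B. if a + b = l + ?d then lk (V N) a * lk ?T b else 0)"
      by (rule lookup_mult_sum) auto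
    also have "\<dots> = (\<Sum>a\<in>?A. \<Sum>b\<in>?B. if a = ?d \<and> b = l then lk ?T l else 0)"
    proof (intro sum.cong refl)
      fix a b assume "a \<in> ?A" "b \<in> ?B"
      hence a: "dominated a ?d" using monic_dom_V[of N] unfolding monic_dom_def in_keys_iff by blast
      show "(if a + b = l + ?d then lk (V N) a * lk ?T b else 0) = (if a = ?d \<and> b = l then lk ?T l else 0)"
      proof (cases "a + b = l + ?d")
        case True
        \<comment> \<open>Every monomial of \<open>V N\<close> lies below delta, so its partner
          \<open>b\<close> lies above \<open>l\<close>; all such \<open>b\<close> other than
          \<open>l\<close> have trace 0.\<close>
        have "dominated (a + l) (?d + l)" using dom_add[OF a dom_refl] .
        also have "?d + l = a + b" using True by (simp add: add.commute)
        finally have lb: "dominated l b" by (simp add: dom_cancel)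
        show ?thesis
        proof (cases "b = l")
          case True
          hence "a = ?d" using \<open>a + b = l + ?d\<close> by simp
          thus ?thesis using True monic_dom_V[of N] by (simp add: monic_dom_def add.commute)
        next
          case False
          have "lk ?T b = 0"
          proof (cases "set_mset b \<subseteq> {..<N}")
            case True
            have "?P (sg C 1) = 0" if "C \<in> B m n b" for C
              by (rule kill[OF wt_single[OF that] lb False True])
            thus ?thesis using True by (simp add: lookup_trace_poly trace_on_def)
          qed (simp add: lookup_trace_poly)
          thus ?thesis using False by simp
        qed
      next
        case False
        thus ?thesis by (auto simp: add.commute)
      qed
    qed
    also have "\<dots> = (\<Sum>a\<in>?A. if a = ?d then (\<Sum>b\<in>?B. if b = l then lk ?T l else 0) else 0)"
      by (intro sum.cong refl) auto
    also have "\<dots> = lk ?T l"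
      using dA by (simp only: sum.delta finite_keys finite_insert insertI1 if_True)
    finally show ?thesis using l by (simp add: lookup_trace_poly)
  qed
  with trace_poly_casimir_prod[OF l sz, of bs] trace_on k show ?thesis by simp
next
  case False
  have "hw N m n l = {0}"
  proof -
    have "B m n l = {}" using False size_B by auto
    thus ?thesis by (auto simp: hw_def wt_def lin_0[OF lin_E])
  qed
  hence dim: "pvs.dim (hw N m n l) = 0"
    using pvs.dim_le_card[of "{0}" "{}"] by simp
  have "lk (V N * trace_poly N m n (\<lambda>v. v)) (l + mon N (staircase N)) = 0"
  proof -
    let ?T = "trace_poly N m n (\<lambda>v. v)" and ?d = "mon N (staircase N)"
    have "lk (V N * ?T) (l + ?d) = (\<Sum>a\<in>Poly_Mapping.keys (V N). \<Sum>b\<in>Poly_Mapping.keys ?T. if a + b = l + ?d then lk (V N) a * lk ?T b else 0)"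
      by (rule lookup_mult_sum) auto
    also have "\<dots> = 0"
    proof (intro sum.neutral ballI)
      fix a b assume "a \<in> Poly_Mapping.keys (V N)" "b \<in> Poly_Mapping.keys ?T"
      hence "dominated a ?d" and b: "size b = m * n"
        using monic_dom_V[of N] trace_poly_size[of N m n "\<lambda>v. v" b] unfolding monic_dom_def in_keys_iff by blast+
      hence "size a = size ?d" by (simp add: dominated_def)
      hence "size (a + b) \<noteq> size (l + ?d)" using False b by simp
      thus "(if a + b = l + ?d then lk (V N) a * lk ?T b else 0) = 0" by (metis (full_types))
    qed
    finally show ?thesis .
  qed
  thus ?thesis using dim by simp
qed

lemma E_mult_var: "E i j (sg {#S#} 1 * v) = iota (EL i j (sg S 1)) * v + sg {#S#} 1 * E i j v"
  using deriv_iota_mult[OF lin_EL, of i j "sg S 1" v] by (simp add: E_def iota_single)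

proposition dim_hw_mono:
  "pvs.dim (hw N m n l) \<le> pvs.dim (hw N m (Suc n) (l + mset_set {..<m}))"
proof -
  let ?S = "{..<m}" and ?H = "hw N m n l" and ?H' = "hw N m (Suc n) (l + mset_set {..<m})"
  let ?f = "\<lambda>v :: vec. sg {#?S#} 1 * v"
  have f: "?f v \<in> ?H'" if v: "v \<in> ?H" for v
  proof -
    have "?f v \<in> wt m (Suc n) (l + mset_set ?S)"
    proof (rule wt_lin[OF lin_mult_left])
      show "v \<in> wt m n l" using v by (simp add: hw_def)
      fix C assume "C \<in> B m n l"
      hence "add_mset ?S C \<in> B m (Suc n) (l + mset_set ?S)" by (auto simp: B_def)
      thus "sg {#?S#} 1 * sg C 1 \<in> wt m (Suc n) (l + mset_set ?S)" by (auto simp: mult_single intro: wt_single)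
    qed
    moreover have "E i j (?f v) = 0" if "i < j" "j < N" for i j
    proof -
      \<comment> \<open>Either j >= m is absent, or i < j < m and e_i would occur twice.\<close>
      have "EL i j (sg ?S 1) = 0" using that by (auto simp: EL_single)
      thus ?thesis using v that by (simp add: E_mult_var lin_0[OF lin_iota] hw_def)
    qed
    ultimately show ?thesis by (simp add: hw_def)
  qed
  have inj: "inj ?f"
  proof (rule injI)
    fix u v assume eq: "?f u = ?f v"
    show "u = v"
    proof (rule poly_mapping_eqI)
      fix C show "lk u C = lk v C"
        using arg_cong[OF eq, of "\<lambda>w. lk w ({#?S#} + C)"] by (simp only: lookup_single_mult mult_1)
    qed
  qed
  obtain Z where Z: "Z \<subseteq> ?H" "pvs.independent Z" "?H \<subseteq> pvs.span Z" "card Z = pvs.dim ?H"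
    using pvs.basis_exists by blast
  obtain Z' where Z': "Z' \<subseteq> ?H'" "pvs.independent Z'" "?H' \<subseteq> pvs.span Z'" "card Z' = pvs.dim ?H'"
    using pvs.basis_exists by blast
  have finZ': "finite Z'"
  proof -
    let ?G = "(\<lambda>C. sg C (1::real)) ` B m (Suc n) (l + mset_set {..<m})"
    have "Z' \<subseteq> pvs.span ?G"
    proof
      fix v assume "v \<in> Z'"
      hence "Poly_Mapping.keys v \<subseteq> B m (Suc n) (l + mset_set {..<m})" using Z'(1) by (auto simp: hw_def wt_def)
      from lin_expand[OF lin_id finite_B this]
      show "v \<in> pvs.span ?G"
        by (metis (no_types, lifting) image_eqI pvs.span_base pvs.span_scale pvs.span_sum)
    qed
    thus ?thesis using pvs.independent_span_bound[of ?G Z'] Z'(2) finite_B by blast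
  qed
  interpret f: Vector_Spaces.linear scl scl ?f
    by unfold_locales (auto simp: distrib_left scl_mult)
  have "pvs.independent (?f ` Z)"
    by (rule f.independent_inj_image[OF Z(2) inj])
  moreover have "?f ` Z \<subseteq> pvs.span Z'" using f Z(1) Z'(3) by blast
  ultimately have "card (?f ` Z) \<le> card Z'" using pvs.independent_span_bound[OF finZ'] by blast
  moreover have "card (?f ` Z) = card Z" by (rule card_image) (use inj in \<open>auto simp: inj_on_def\<close>)
  ultimately show ?thesis using Z(4) Z'(4) by simp
qed

section \<open>Partitions, strips and the Pieri rule\<close>

definition ptn :: "(nat \<Rightarrow> nat) \<Rightarrow> bool" where
  "ptn l \<longleftrightarrow> (\<forall>i. l (Suc i) \<le> l i) \<and> finite {i. l i \<noteq> 0}"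

definition psize :: "(nat \<Rightarrow> nat) \<Rightarrow> nat" where "psize l = (\<Sum>i | l i \<noteq> 0. l i)"

definition hstrip :: "(nat \<Rightarrow> nat) \<Rightarrow> (nat \<Rightarrow> nat) \<Rightarrow> bool" where
  "hstrip k l \<longleftrightarrow> (\<forall>i. k i \<le> l i \<and> l (Suc i) \<le> k i)"

text \<open>The last conjunct makes \<open>k\<close> decreasing; for \<open>hstrip\<close> this
  follows from the interlacing of \<open>k\<close> and \<open>l\<close>.\<close>

definition vstrip :: "(nat \<Rightarrow> nat) \<Rightarrow> (nat \<Rightarrow> nat) \<Rightarrow> bool" where
  "vstrip k l \<longleftrightarrow> (\<forall>i. k i \<le> l i \<and> l i \<le> Suc (k i) \<and> k (Suc i) \<le> k i)"

definition strip :: "bool \<Rightarrow> (nat \<Rightarrow> nat) \<Rightarrow> (nat \<Rightarrow> nat) \<Rightarrow> bool" where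
  "strip e k l \<longleftrightarrow> (if e then hstrip k l else vstrip k l)"

text \<open>
  The head of the list is the last letter, i.e. its strip is the outermost one.
\<close>

primrec chains :: "(nat \<Rightarrow> bool) \<Rightarrow> (nat \<Rightarrow> nat) \<Rightarrow> nat list \<Rightarrow> (nat \<Rightarrow> nat) \<Rightarrow> nat" where
  "chains ev c [] l = (if l = (\<lambda>_. 0) then 1 else 0)"
| "chains ev c (x # xs) l = (\<Sum>k | strip (ev x) k l \<and> psize l = psize k + c x. chains ev c xs k)"

lemma psize_eq: "(\<And>i. i \<ge> N \<Longrightarrow> l i = 0) \<Longrightarrow> psize l = (\<Sum>i<N. l i)"
proof -
  assume "\<And>i. i \<ge> N \<Longrightarrow> l i = 0"
  hence "{i. l i \<noteq> 0} \<subseteq> {..<N}" by (metis (mono_tags, lifting) lessThan_iff mem_Collect_eq not_le subsetI)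
  thus ?thesis unfolding psize_def by (intro sum.mono_neutral_left) auto
qed

lemma ptn_mono: "ptn l \<Longrightarrow> i \<le> j \<Longrightarrow> l j \<le> l i"
  unfolding ptn_def by (metis lift_Suc_antimono_le)

lemma ptn_bound: "ptn l \<Longrightarrow> \<exists>N. \<forall>i\<ge>N. l i = 0"
  unfolding ptn_def by (metis (mono_tags, lifting) finite_nat_set_iff_bounded mem_Collect_eq not_less)

lemma strip_le: "strip e k l \<Longrightarrow> k i \<le> l i"
  by (auto simp: strip_def hstrip_def vstrip_def split: if_splits)

lemma finite_below: "finite {i. l i \<noteq> 0} \<Longrightarrow> finite {k :: nat \<Rightarrow> nat. \<forall>i. k i \<le> l i}"
proof -
  assume fin: "finite {i. l i \<noteq> 0}"
  let ?A = "{i. l i \<noteq> 0}"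
  have "{k. \<forall>i. k i \<le> l i} \<subseteq> {k. \<forall>i. (i \<in> ?A \<longrightarrow> k i \<in> {..Max (l ` ?A)}) \<and> (i \<notin> ?A \<longrightarrow> k i = 0)}"
  proof clarify
    fix k i assume k: "\<forall>i. k i \<le> l i"
    show "(i \<in> ?A \<longrightarrow> k i \<in> {..Max (l ` ?A)}) \<and> (i \<notin> ?A \<longrightarrow> k i = 0)"
    proof (cases "i \<in> ?A")
      case True
      hence "l i \<le> Max (l ` ?A)" using fin by (intro Max_ge) auto
      thus ?thesis using True k order_trans[of "k i" "l i"] by auto
    next
      case False
      thus ?thesis using k[rule_format, of i] by auto
    qed
  qed
  thus ?thesis by (rule finite_subset) (intro finite_set_of_finite_funs fin finite_atMost)
qed

lemma strip_ptn: "strip e k l \<Longrightarrow> ptn l \<Longrightarrow> ptn k"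
proof -
  assume s: "strip e k l" and l: "ptn l"
  have "{i. k i \<noteq> 0} \<subseteq> {i. l i \<noteq> 0}" 
    by (intro Collect_mono impI) (metis le_zero_eq strip_le[OF s])
  hence "finite {i. k i \<noteq> 0}" using l by (auto simp: ptn_def intro: finite_subset)
  moreover have "k (Suc i) \<le> k i" for i
    using s by (cases e) (auto simp: strip_def hstrip_def vstrip_def intro: order_trans)
  ultimately show ?thesis by (simp add: ptn_def)
qed

lemma finite_strip: "ptn l \<Longrightarrow> finite {k. strip e k l \<and> P k}"
  by (rule finite_subset[OF _ finite_below[of l]]) (auto simp: ptn_def strip_le)

lemma psize_mono_eq:
  assumes "ptn l" "\<And>i. k i \<le> l i" "psize k = psize l" shows "k = l"
proof -
  obtain N where N: "\<forall>i\<ge>N. l i = 0" using ptn_bound[OF assms(1)] by blast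
  hence N': "\<forall>i\<ge>N. k i = 0" using assms(2) by (metis le_zero_eq)
  have "(\<Sum>i<N. k i) = (\<Sum>i<N. l i)" using assms(3) psize_eq[of N k] psize_eq[of N l] N N' by simp
  hence "\<forall>i<N. k i = l i" using sum_mono_inv[of k "{..<N}" l] assms(2) by auto
  thus ?thesis using N N' by (metis ext not_less)
qed

text \<open>A horizontal strip adds at most one new row.\<close>

lemma chains_supp: "chains ev c xs l \<noteq> 0 \<Longrightarrow> (\<And>x. x \<in> set xs \<Longrightarrow> ev x) \<Longrightarrow> length xs \<le> i \<Longrightarrow> l i = 0"
proof (induction xs arbitrary: l i)
  case (Cons x xs)
  have "\<exists>k. strip (ev x) k l \<and> chains ev c xs k \<noteq> 0"
  proof (rule ccontr)
    assume "\<not> ?thesis"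
    hence "chains ev c (x # xs) l = 0" by (auto intro!: sum.neutral)
    with Cons.prems(1) show False by simp
  qed
  then obtain k where k: "hstrip k l" "chains ev c xs k \<noteq> 0"
    using Cons.prems(2)[of x] by (auto simp: strip_def)
  obtain j where j: "i = Suc j" "length xs \<le> j" using Cons.prems(3) by (cases i) auto
  have "k j = 0" using Cons.IH[OF k(2)] Cons.prems(2) j by simp
  thus ?case using k(1) j by (metis hstrip_def le_zero_eq)
qed (auto split: if_splits)

text \<open>Division by X_r - X_N through the geometric series of the terms X_N^t / X_r^(t+1). It
  stops once the exponent of X_N in \<open>b\<close> is used up.\<close>

lemma lookup_divide:
  assumes "r \<noteq> N"
  shows "lk p b = (\<Sum>t\<le>count b N. lk ((X r - X N) * p) (b + replicate_mset (Suc t) r - replicate_mset t N))"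
  using assms
proof (induction "count b N" arbitrary: b)
  case 0
  hence "N \<notin># b" by (simp add: not_in_iff)
  thus ?case using 0 by (simp add: left_diff_distrib lookup_minus lookup_X_mult)
next
  case (Suc c)
  hence N: "N \<in># b" by (metis count_greater_zero_iff zero_less_Suc)
  let ?b = "add_mset r b - {#N#}"
  have c: "c = count ?b N" using Suc.hyps(2) Suc.prems by simp
  have "lk ((X r - X N) * p) (add_mset r b) = lk p b - lk p ?b"
    using N by (simp add: left_diff_distrib lookup_minus lookup_X_mult)
  hence "lk p b = lk ((X r - X N) * p) (add_mset r b) + lk p ?b" by simp
  also have "lk p ?b = (\<Sum>t\<le>c. lk ((X r - X N) * p) (?b + replicate_mset (Suc t) r - replicate_mset t N))"
    using Suc.hyps(1)[OF c] Suc.prems c by simp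
  also have "\<dots> = (\<Sum>t\<le>c. lk ((X r - X N) * p) (b + replicate_mset (Suc (Suc t)) r - replicate_mset (Suc t) N))"
  proof (intro sum.cong refl arg_cong[of _ _ "lk ((X r - X N) * p)"])
    fix t
    show "?b + replicate_mset (Suc t) r - replicate_mset t N = b + replicate_mset (Suc (Suc t)) r - replicate_mset (Suc t) N"
      using Suc.prems by (auto simp: multiset_eq_iff)
  qed
  also have "lk ((X r - X N) * p) (add_mset r b) + \<dots>
      = (\<Sum>t\<le>Suc c. lk ((X r - X N) * p) (b + replicate_mset (Suc t) r - replicate_mset t N))"
    by (subst sum.atMost_Suc_shift) simp
  finally show ?case using Suc.hyps(2) by simp
qed

lemma alternant_antisym:
  assumes "\<And>b. lk g (image_mset (transpose i (Suc i)) b) = lk g b" "Suc i < N"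
  shows "lk (V N * g) (image_mset (transpose i (Suc i)) b) = - lk (V N * g) b"
proof -
  have "rename_vars (transpose i (Suc i)) g = g" by (rule poly_mapping_eqI) (simp add: lookup_ren assms)
  hence "rename_vars (transpose i (Suc i)) (V N * g) = - (V N * g)" using assms by (simp add: ren_mult ren_V)
  from arg_cong[OF this, of "\<lambda>p. lk p b"] show ?thesis by (simp add: lookup_ren)
qed

context
  fixes N a :: nat and k :: "nat \<Rightarrow> nat" and g :: mpoly and rest :: "nat multiset"
  assumes kp: "ptn k" and kN: "\<And>i. N \<le> i \<Longrightarrow> k i = 0"
    and sym: "\<And>i b. Suc i < Suc N \<Longrightarrow> lk g (image_mset (transpose i (Suc i)) b) = lk g b"
    and rest: "\<And>i. i \<in># rest \<Longrightarrow> N < i"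
begin

text \<open>Stage r of the passage from \<open>V N\<close> to \<open>V (Suc N)\<close>: parts below
  r may have grown, those from r to N - 1 are still those of \<open>k\<close>, and
  \<open>l N\<close> is the exponent not yet distributed.\<close>

definition pieri_index :: "nat \<Rightarrow> (nat \<Rightarrow> nat) set" where
  "pieri_index r = {l. (\<forall>i<r. k i \<le> l i) \<and> (\<forall>i. r \<le> i \<and> i < N \<longrightarrow> l i = k i) \<and> (\<forall>i>N. l i = 0) \<and> (\<Sum>i\<le>N. l i) = psize k + a}"

text \<open>Parts below r already carry the staircase of \<open>Suc N\<close>: dividing by X_i - X_N
  raises the exponent of X_i by one more than the growth of the part.\<close>

definition pieri_exp :: "nat \<Rightarrow> (nat \<Rightarrow> nat) \<Rightarrow> nat \<Rightarrow> nat" where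
  "pieri_exp r l i = (if i < r then l i + (N - i) else if i < N then k i + (N - 1 - i) else l i)"

definition pieri_poly :: "nat \<Rightarrow> mpoly" where "pieri_poly r = V N * g * (\<Prod>i<r. X i - X N)"

lemma pieri_index_0: "pieri_index 0 = {k(N := a)}"
proof -
  have s: "psize k = (\<Sum>i<N. k i)" by (rule psize_eq) (rule kN)
  have "l = k(N := a)" if l: "\<forall>i. i < N \<longrightarrow> l i = k i" "\<forall>i>N. l i = 0" "(\<Sum>i\<le>N. l i) = psize k + a" for l
  proof
    fix i
    have "(\<Sum>i\<le>N. l i) = (\<Sum>i<N. k i) + l N" using l(1) by (simp add: lessThan_Suc_atMost[symmetric])
    hence "l N = a" using l(3) s by simp
    thus "l i = (k(N := a)) i" using l kN[of i] by (cases i N rule: linorder_cases) auto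
  qed
  moreover have "(\<Sum>i\<le>N. (k(N := a)) i) = psize k + a"
    using s by (simp add: lessThan_Suc_atMost[symmetric])
  ultimately show ?thesis by (auto simp: pieri_index_def kN)
qed

lemma finite_pieri_index: "finite (pieri_index r)"
proof -
  have "pieri_index r \<subseteq> {l. \<forall>i. l i \<le> (if i \<le> N then psize k + a else 0)}"
  proof clarify
    fix l i assume l: "l \<in> pieri_index r"
    show "l i \<le> (if i \<le> N then psize k + a else 0)"
    proof (cases "i \<le> N")
      case True
      hence "l i \<le> (\<Sum>i\<le>N. l i)" by (intro member_le_sum) auto
      thus ?thesis using l True by (simp add: pieri_index_def)
    qed (use l in \<open>auto simp: pieri_index_def\<close>)
  qed
  thus ?thesis by (rule finite_subset) (rule finite_below, rule finite_subset[of _ "{..N}"], auto)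
qed

text \<open>Each step divides by one factor X_r - X_N with \<open>lookup_divide\<close>; the
  summation index t counts the boxes moved from slot N to row r.\<close>

lemma pieri_step:
  assumes "r \<le> N"
  shows "lk (pieri_poly 0) (mon (Suc N) (pieri_exp 0 (k(N := a))) + rest) = (\<Sum>l\<in>pieri_index r. lk (pieri_poly r) (mon (Suc N) (pieri_exp r l) + rest))"
  using assms
proof (induction r)
  case 0
  show ?case by (simp add: pieri_index_0)
next
  case (Suc r)
  hence r: "r < N" by simp
  have cr: "count rest N = 0" "count rest r = 0" using rest[of N] rest[of r] r by (auto simp: count_eq_zero_iff)
  let ?l' = "\<lambda>l t. l(r := k r + t, N := l N - t)"
  have YS: "pieri_poly (Suc r) = (X r - X N) * pieri_poly r" by (simp add: pieri_poly_def ac_simps)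
  have "(\<Sum>l\<in>pieri_index r. lk (pieri_poly r) (mon (Suc N) (pieri_exp r l) + rest))
      = (\<Sum>l\<in>pieri_index r. \<Sum>t\<le>l N. lk (pieri_poly (Suc r)) (mon (Suc N) (pieri_exp (Suc r) (?l' l t)) + rest))"
  proof (intro sum.cong refl)
    fix l assume l: "l \<in> pieri_index r"
    let ?b = "mon (Suc N) (pieri_exp r l) + rest"
    have cb: "count ?b N = l N" using r cr by (simp add: count_mon pieri_exp_def)
    have "lk (pieri_poly r) ?b = (\<Sum>t\<le>l N. lk (pieri_poly (Suc r)) (?b + replicate_mset (Suc t) r - replicate_mset t N))"
      unfolding YS using lookup_divide[of r N "pieri_poly r" ?b] r cb by simp
    also have "\<dots> = (\<Sum>t\<le>l N. lk (pieri_poly (Suc r)) (mon (Suc N) (pieri_exp (Suc r) (?l' l t)) + rest))"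
    proof (intro sum.cong refl arg_cong[of _ _ "lk (pieri_poly (Suc r))"] multiset_eqI)
      fix t x assume t: "t \<in> {..l N}"
      show "count (?b + replicate_mset (Suc t) r - replicate_mset t N) x
          = count (mon (Suc N) (pieri_exp (Suc r) (?l' l t)) + rest) x"
        using r t cr by (cases "x = N") (auto simp: count_mon pieri_exp_def)
    qed
    finally show "lk (pieri_poly r) ?b = (\<Sum>t\<le>l N. lk (pieri_poly (Suc r)) (mon (Suc N) (pieri_exp (Suc r) (?l' l t)) + rest))" .
  qed
  also have "\<dots> = (\<Sum>(l, t)\<in>(SIGMA l:pieri_index r. {..l N}). lk (pieri_poly (Suc r)) (mon (Suc N) (pieri_exp (Suc r) (?l' l t)) + rest))"
    using finite_pieri_index by (intro sum.Sigma) auto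
  also have "\<dots> = (\<Sum>l\<in>pieri_index (Suc r). lk (pieri_poly (Suc r)) (mon (Suc N) (pieri_exp (Suc r) l) + rest))"
  proof (rule sum.reindex_bij_witness[where j = "\<lambda>(l, t). ?l' l t"
        and i = "\<lambda>l. (l(r := k r, N := l N + l r - k r), l r - k r)"])
    have sum2: "(\<Sum>i\<le>N. f i) = f r + f N + (\<Sum>i\<in>{..N} - {r, N}. f i)" for f :: "nat \<Rightarrow> nat"
    proof -
      have "(\<Sum>i\<le>N. f i) = (\<Sum>i\<in>{r, N}. f i) + (\<Sum>i\<in>{..N} - {r, N}. f i)"
        using r by (subst sum.subset_diff[of "{r, N}"]) auto
      thus ?thesis using r by simp
    qed
    have off: "(\<Sum>i\<in>{..N} - {r, N}. (l(r := x, N := y)) i) = (\<Sum>i\<in>{..N} - {r, N}. l i)" for l :: "nat \<Rightarrow> nat" and x y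
      by (intro sum.cong) auto
    {
      fix s assume "s \<in> (SIGMA l:pieri_index r. {..l N})"
      then obtain l t where s: "s = (l, t)" "l \<in> pieri_index r" "t \<le> l N" by auto
      have lr: "l r = k r" using s(2) r by (auto simp: pieri_index_def)
      show "(case s of (l, t) \<Rightarrow> ?l' l t) \<in> pieri_index (Suc r)"
      proof -
        have "(\<Sum>i\<le>N. ?l' l t i) = (\<Sum>i\<le>N. l i)"
          unfolding sum2 off using r s(3) lr by simp
        thus ?thesis using s r by (auto simp: pieri_index_def less_Suc_eq)
      qed
      show "(\<lambda>l. (l(r := k r, N := l N + l r - k r), l r - k r)) (case s of (l, t) \<Rightarrow> ?l' l t) = s"
        using s r lr by (auto simp: fun_eq_iff)
    }
    {
      fix l assume l: "l \<in> pieri_index (Suc r)"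
      have lr: "k r \<le> l r" using l by (auto simp: pieri_index_def)
      show "(case (l(r := k r, N := l N + l r - k r), l r - k r) of (l, t) \<Rightarrow> ?l' l t) = l"
        using r lr by (auto simp: fun_eq_iff)
      show "(l(r := k r, N := l N + l r - k r), l r - k r) \<in> (SIGMA l:pieri_index r. {..l N})"
      proof -
        have "(\<Sum>i\<le>N. (l(r := k r, N := l N + l r - k r)) i) = (\<Sum>i\<le>N. l i)"
          unfolding sum2 off using r lr by simp
        thus ?thesis using l r lr by (auto simp: pieri_index_def)
      qed
    }
  qed auto
  finally show ?case using Suc by simp
qed

text \<open>
  Inverting the factors \<open>X i - X N\<close> of the Vandermonde product gives a sum over all \<open>l\<close> with
  \<open>k i \<le> l i\<close> for \<open>i < N\<close>. Those that are not horizontal strips cancel: with \<open>p\<close> maximal such that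
  \<open>k p < l (Suc p)\<close>, exchange the exponents of \<open>X p\<close> and \<open>X (Suc p)\<close>.
\<close>

lemma pieri:
  "lk (V N * g) (mon N (\<lambda>i. k i + staircase N i) + replicate_mset a N + rest)
    = (\<Sum>l | hstrip k l \<and> psize l = psize k + a. lk (V (Suc N) * g) (mon (Suc N) (\<lambda>i. l i + staircase (Suc N) i) + rest))"
proof -
  define w where "w l = lk (V (Suc N) * g) (mon (Suc N) (\<lambda>i. l i + staircase (Suc N) i) + rest)" for l
  have "mon N (\<lambda>i. k i + staircase N i) + replicate_mset a N = mon (Suc N) (pieri_exp 0 (k(N := a)))"
    by (rule multiset_eqI) (auto simp: count_mon pieri_exp_def staircase_def kN)
  hence "lk (V N * g) (mon N (\<lambda>i. k i + staircase N i) + replicate_mset a N + rest)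
      = (\<Sum>l\<in>pieri_index N. lk (pieri_poly N) (mon (Suc N) (pieri_exp N l) + rest))"
    using pieri_step[of N] by (simp add: pieri_poly_def)
  also have "\<dots> = (\<Sum>l\<in>pieri_index N. w l)"
  proof (intro sum.cong refl)
    fix l
    have "pieri_poly N = V (Suc N) * g" by (simp add: pieri_poly_def V_Suc ac_simps)
    moreover have "mon (Suc N) (pieri_exp N l) = mon (Suc N) (\<lambda>i. l i + staircase (Suc N) i)"
      by (rule multiset_eqI) (auto simp: count_mon pieri_exp_def staircase_def less_Suc_eq)
    ultimately show "lk (pieri_poly N) (mon (Suc N) (pieri_exp N l) + rest) = w l" by (simp add: w_def)
  qed
  also have "\<dots> = (\<Sum>l\<in>{l\<in>pieri_index N. \<exists>p<N. k p < l (Suc p)}. w l) + (\<Sum>l\<in>{l\<in>pieri_index N. \<not> (\<exists>p<N. k p < l (Suc p))}. w l)"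
    using finite_pieri_index by (subst sum.union_disjoint[symmetric]) (auto intro: sum.cong)
  also have "(\<Sum>l\<in>{l\<in>pieri_index N. \<exists>p<N. k p < l (Suc p)}. w l) = 0"
  proof -
    let ?bad = "{l\<in>pieri_index N. \<exists>p<N. k p < l (Suc p)}"
    define mx where "mx l = Max {p. p < N \<and> k p < l (Suc p)}" for l :: "nat \<Rightarrow> nat"
    \<comment> \<open>The exponents l p + N - p and l (p+1) + N - (p+1) are exchanged; the staircase
      accounts for the shifts by one.\<close>
    define io where "io l = l(Suc (mx l) := Suc (l (mx l)), mx l := l (Suc (mx l)) - 1)" for l :: "nat \<Rightarrow> nat"
    have mx: "mx l < N" "k (mx l) < l (Suc (mx l))" "\<And>q. mx l < q \<Longrightarrow> q < N \<Longrightarrow> l (Suc q) \<le> k q" if "l \<in> ?bad" for l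
    proof -
      let ?S = "{p. p < N \<and> k p < l (Suc p)}"
      have "finite ?S" "?S \<noteq> {}" using that by auto
      hence "Max ?S \<in> ?S" by (rule Max_in)
      thus "mx l < N" "k (mx l) < l (Suc (mx l))" by (auto simp: mx_def)
      fix q assume "mx l < q" "q < N"
      thus "l (Suc q) \<le> k q" using Max_ge[OF \<open>finite ?S\<close>, of q] by (auto simp: mx_def not_le[symmetric])
    qed
    have io: "io l \<in> ?bad" "mx (io l) = mx l" "io (io l) = l" "w (io l) = - w l" if l: "l \<in> ?bad" for l
    proof -
      define p where "p = mx l"
      have p: "p < N" "k p < l (Suc p)" using mx[OF l] by (auto simp: p_def)
      have iol: "io l = l(Suc p := Suc (l p), p := l (Suc p) - 1)" by (simp add: io_def p_def)
      have lp: "k p \<le> l p" using l p by (auto simp: pieri_index_def)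
      have sum2: "(\<Sum>i\<le>N. f i) = f p + f (Suc p) + (\<Sum>i\<in>{..N} - {p, Suc p}. f i)" for f :: "nat \<Rightarrow> nat"
      proof -
        have "(\<Sum>i\<le>N. f i) = (\<Sum>i\<in>{p, Suc p}. f i) + (\<Sum>i\<in>{..N} - {p, Suc p}. f i)"
          using p by (subst sum.subset_diff[of "{p, Suc p}"]) auto
        thus ?thesis using p by simp
      qed
      have "(\<Sum>i\<in>{..N} - {p, Suc p}. io l i) = (\<Sum>i\<in>{..N} - {p, Suc p}. l i)"
        by (intro sum.cong) (auto simp: iol)
      hence sum: "(\<Sum>i\<le>N. io l i) = (\<Sum>i\<le>N. l i)"
        unfolding sum2 using p by (simp add: iol)
      have "k (Suc p) \<le> Suc (l p)" using lp ptn_mono[OF kp, of p "Suc p"] by simp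
      hence pieri_index: "io l \<in> pieri_index N"
        using l p sum by (auto simp: pieri_index_def iol)
      thus bad: "io l \<in> ?bad" using p lp by (auto simp: iol intro!: exI[of _ p])
      \<comment> \<open>Parts after \<open>Suc p\<close> are untouched, so no later violation
        appears, and the new part \<open>Suc (l p)\<close> at \<open>Suc p\<close> still exceeds
        \<open>k p\<close>.\<close>
      show mxe: "mx (io l) = mx l"
      proof (rule antisym)
        show "mx l \<le> mx (io l)"
        proof (rule ccontr)
          assume "\<not> mx l \<le> mx (io l)"
          hence "mx (io l) < p" by (simp add: p_def)
          hence "io l (Suc p) \<le> k p" using mx(3)[OF bad] p(1) by blast
          thus False using lp by (simp add: iol)
        qed
        show "mx (io l) \<le> mx l"
        proof (rule ccontr)
          assume n: "\<not> mx (io l) \<le> mx l"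
          hence "l (Suc (mx (io l))) \<le> k (mx (io l))" using mx(3)[OF l] mx(1)[OF bad] by simp
          moreover have "io l (Suc (mx (io l))) = l (Suc (mx (io l)))" using n by (simp add: iol p_def)
          ultimately show False using mx(2)[OF bad] by simp
        qed
      qed
      show "io (io l) = l"
        unfolding io_def[of "io l"] mxe p_def[symmetric] using p by (auto simp: iol fun_eq_iff)
      have "mon (Suc N) (\<lambda>i. io l i + staircase (Suc N) i) + rest
          = image_mset (transpose p (Suc p)) (mon (Suc N) (\<lambda>i. l i + staircase (Suc N) i) + rest)"
      proof (rule multiset_eqI)
        fix x
        have "count rest p = 0" "count rest (Suc p) = 0" using rest[of p] rest[of "Suc p"] p by (auto simp: count_eq_zero_iff)
        thus "count (mon (Suc N) (\<lambda>i. io l i + staircase (Suc N) i) + rest) x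
          = count (image_mset (transpose p (Suc p)) (mon (Suc N) (\<lambda>i. l i + staircase (Suc N) i) + rest)) x"
          unfolding count_image_transpose using p
          by (auto simp: count_mon iol staircase_def transpose_def)
      qed
      thus "w (io l) = - w l"
        unfolding w_def using alternant_antisym[OF sym, of p "Suc N"] p by (simp only: Suc_less_eq)
    qed
    have "(\<Sum>l\<in>?bad. w l) = (\<Sum>l\<in>?bad. w (io l))"
      by (rule sum.reindex_bij_witness[of _ io io]) (simp_all only: io)
    also have "\<dots> = - (\<Sum>l\<in>?bad. w l)"
      unfolding sum_negf[symmetric] by (intro sum.cong refl) (simp only: io)
    finally show ?thesis by simp
  qed
  also have "{l\<in>pieri_index N. \<not> (\<exists>p<N. k p < l (Suc p))} = {l. hstrip k l \<and> psize l = psize k + a}"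
  proof -
    have ps: "psize l = (\<Sum>i\<le>N. l i)" if "\<forall>i>N. l i = 0" for l
      using psize_eq[of "Suc N" l] that by (simp add: lessThan_Suc_atMost)
    have z: "\<forall>i>N. l i = 0" if "hstrip k l" for l
    proof (intro allI impI)
      fix i assume "N < i"
      then obtain j where "i = Suc j" "N \<le> j" by (cases i) auto
      thus "l i = 0" using that kN[of j] by (metis hstrip_def le_zero_eq)
    qed
    have hsI: "hstrip k l" if "\<forall>i<N. k i \<le> l i" "\<forall>i>N. l i = 0" "\<forall>p<N. l (Suc p) \<le> k p" for l
      unfolding hstrip_def
    proof
      fix i show "k i \<le> l i \<and> l (Suc i) \<le> k i"
        using that kN[of i] by (cases "i < N") auto
    qed
    show ?thesis
    proof (intro equalityI subsetI)
      fix l assume "l \<in> {l\<in>pieri_index N. \<not> (\<exists>p<N. k p < l (Suc p))}"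
      hence l: "\<forall>i<N. k i \<le> l i" "\<forall>i>N. l i = 0" "\<forall>p<N. l (Suc p) \<le> k p" "(\<Sum>i\<le>N. l i) = psize k + a"
        unfolding pieri_index_def by (auto simp: not_less[symmetric])
      thus "l \<in> {l. hstrip k l \<and> psize l = psize k + a}" using hsI ps by simp
    next
      fix l assume "l \<in> {l. hstrip k l \<and> psize l = psize k + a}"
      hence l: "hstrip k l" "psize l = psize k + a" by auto
      have "k i \<le> l i" "l (Suc i) \<le> k i" for i using l(1) by (auto simp: hstrip_def)
      thus "l \<in> {l\<in>pieri_index N. \<not> (\<exists>p<N. k p < l (Suc p))}"
        using z[OF l(1)] ps[OF z[OF l(1)]] l(2) by (simp add: pieri_index_def not_less)
    qed
  qed
  finally show ?thesis by (simp add: w_def)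
qed

end

definition Pt :: "nat \<Rightarrow> nat \<Rightarrow> (nat \<Rightarrow> nat) set" where
  "Pt N s = {l. ptn l \<and> (\<forall>i\<ge>N. l i = 0) \<and> psize l = s}"

lemma finite_Pt: "finite (Pt N s)"
proof -
  have "Pt N s \<subseteq> {l. \<forall>i. l i \<le> (if i < N then s else 0)}"
  proof clarify
    fix l i assume l: "l \<in> Pt N s"
    hence "s = (\<Sum>i<N. l i)" using psize_eq[of N l] by (simp add: Pt_def)
    thus "l i \<le> (if i < N then s else 0)" using l member_le_sum[of i "{..<N}" l] by (auto simp: Pt_def)
  qed
  thus ?thesis by (rule finite_subset) (rule finite_below, rule finite_subset[of _ "{..<N}"], auto)
qed

text \<open>The Vandermonde product is built up one variable at a time, and each use of
  \<open>pieri\<close> adds a horizontal strip. For \<open>g\<close> symmetric in the first N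
  variables, the coefficients of \<open>V N * g\<close> at l + delta are thus its Schur
  coefficients, \<open>chains\<close> giving the Kostka numbers. Letters from N on are carried along
  unchanged.\<close>

proposition alternant_expansion:
  assumes "\<And>i b. Suc i < N \<Longrightarrow> lk g (image_mset (transpose i (Suc i)) b) = lk g b"
  shows "lk g b = (\<Sum>l\<in>Pt N (\<Sum>i<N. count b i). real (chains (\<lambda>_. True) (count b) (rev [0..<N]) l)
            * lk (V N * g) (mon N (\<lambda>i. l i + staircase N i) + filter_mset (\<lambda>i. N \<le> i) b))"
  using assms
proof (induction N)
  case 0
  have "Pt 0 0 = {\<lambda>_. 0}" by (auto simp: Pt_def ptn_def psize_def fun_eq_iff)
  thus ?case by (simp add: mon_def)
next
  case (Suc N)
  let ?K = "\<Sum>i<N. count b i" and ?a = "count b N" and ?c = "chains (\<lambda>_. True) (count b) (rev [0..<N])"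
  let ?rest = "filter_mset (\<lambda>i. Suc N \<le> i) b"
  let ?w = "\<lambda>l. lk (V (Suc N) * g) (mon (Suc N) (\<lambda>i. l i + staircase (Suc N) i) + ?rest)"
  have fb: "filter_mset (\<lambda>i. N \<le> i) b = replicate_mset ?a N + ?rest"
    by (rule multiset_eqI) (auto simp: not_less_eq_eq dest: le_antisym)
  have "lk g b = (\<Sum>k\<in>Pt N ?K. real (?c k) * lk (V N * g) (mon N (\<lambda>i. k i + staircase N i) + filter_mset (\<lambda>i. N \<le> i) b))"
    by (rule Suc.IH) (simp add: Suc.prems)
  also have "\<dots> = (\<Sum>k\<in>Pt N ?K. \<Sum>l | hstrip k l \<and> psize l = psize k + ?a. real (?c k) * ?w l)"
  proof (intro sum.cong refl)
    fix k assume "k \<in> Pt N ?K"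
    hence k: "ptn k" "\<And>i. N \<le> i \<Longrightarrow> k i = 0" by (auto simp: Pt_def)
    have "lk (V N * g) (mon N (\<lambda>i. k i + staircase N i) + replicate_mset ?a N + ?rest) = (\<Sum>l | hstrip k l \<and> psize l = psize k + ?a. ?w l)"
      by (rule pieri[OF k Suc.prems]) auto
    thus "real (?c k) * lk (V N * g) (mon N (\<lambda>i. k i + staircase N i) + filter_mset (\<lambda>i. N \<le> i) b)
        = (\<Sum>l | hstrip k l \<and> psize l = psize k + ?a. real (?c k) * ?w l)"
      unfolding fb by (simp add: sum_distrib_left add.assoc)
  qed
  also have "\<dots> = (\<Sum>k\<in>Pt N ?K. \<Sum>l\<in>{l\<in>Pt (Suc N) (?K + ?a). hstrip k l \<and> psize l = psize k + ?a}. real (?c k) * ?w l)"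
  proof (intro sum.cong refl)
    fix k assume "k \<in> Pt N ?K"
    hence k: "ptn k" "\<And>i. N \<le> i \<Longrightarrow> k i = 0" "psize k = ?K" by (auto simp: Pt_def)
    have "l \<in> Pt (Suc N) (?K + ?a)" if l: "hstrip k l" "psize l = psize k + ?a" for l
    proof -
      have z: "l i = 0" if "Suc N \<le> i" for i
      proof -
        from that obtain j where "i = Suc j" "N \<le> j" by (cases i) auto
        thus ?thesis using l(1) k(2)[of j] by (metis hstrip_def le_zero_eq)
      qed
      have "{i. l i \<noteq> 0} \<subseteq> {..N}" using z by (metis (mono_tags, lifting) atMost_iff mem_Collect_eq not_less_eq_eq subsetI)
      hence "ptn l" using l(1) by (auto simp: ptn_def hstrip_def intro: order_trans finite_subset)
      thus ?thesis using z l k by (simp add: Pt_def)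
    qed
    thus "{l. hstrip k l \<and> psize l = psize k + ?a} = {l\<in>Pt (Suc N) (?K + ?a). hstrip k l \<and> psize l = psize k + ?a}" by auto
  qed
  also have "\<dots> = (\<Sum>l\<in>Pt (Suc N) (?K + ?a). \<Sum>k\<in>{k\<in>Pt N ?K. hstrip k l \<and> psize l = psize k + ?a}. real (?c k) * ?w l)"
    by (rule sum.swap_restrict) (auto intro: finite_Pt)
  also have "\<dots> = (\<Sum>l\<in>Pt (Suc N) (?K + ?a). real (chains (\<lambda>_. True) (count b) (rev [0..<Suc N]) l) * ?w l)"
  proof (intro sum.cong refl)
    fix l assume l: "l \<in> Pt (Suc N) (?K + ?a)"
    have "(\<Sum>k\<in>{k\<in>Pt N ?K. hstrip k l \<and> psize l = psize k + ?a}. ?c k) = (\<Sum>k | strip True k l \<and> psize l = psize k + ?a. ?c k)"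
    proof (rule sum.mono_neutral_left)
      show "finite {k. strip True k l \<and> psize l = psize k + ?a}" using l by (intro finite_strip) (simp add: Pt_def)
      show "{k\<in>Pt N ?K. hstrip k l \<and> psize l = psize k + ?a} \<subseteq> {k. strip True k l \<and> psize l = psize k + ?a}"
        by (auto simp: strip_def)
      show "\<forall>k\<in>{k. strip True k l \<and> psize l = psize k + ?a} - {k\<in>Pt N ?K. hstrip k l \<and> psize l = psize k + ?a}. ?c k = 0"
      proof (rule ballI, rule ccontr)
        fix k assume k: "k \<in> {k. strip True k l \<and> psize l = psize k + ?a} - {k\<in>Pt N ?K. hstrip k l \<and> psize l = psize k + ?a}"
          and nz: "?c k \<noteq> 0"
        have "ptn k" using k l strip_ptn[of True k l] by (simp add: Pt_def)
        moreover have "\<forall>i\<ge>N. k i = 0" using chains_supp[OF nz] by simp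
        moreover have "psize k = ?K" using k l by (auto simp: Pt_def)
        ultimately show False using k by (auto simp: Pt_def strip_def)
      qed
    qed
    thus "(\<Sum>k\<in>{k\<in>Pt N ?K. hstrip k l \<and> psize l = psize k + ?a}. real (?c k) * ?w l)
       = real (chains (\<lambda>_. True) (count b) (rev [0..<Suc N]) l) * ?w l"
      by (simp add: sum_distrib_right[symmetric] flip: of_nat_sum)
  qed
  finally show ?case by simp
qed

section \<open>Schur expansion of the weight multiplicities\<close>

lemma card_B_image:
  assumes "inj f"
  shows "card (B m n (image_mset f b)) = card (B m n b)"
proof (rule bij_betw_same_card[symmetric])
  have im: "mset_set (f ` S) = image_mset f (mset_set S)" for S
    using assms by (metis image_mset_mset_set inj_on_subset subset_UNIV)
  have smi: "(\<Sum>S\<in>#C. mset_set (f ` S)) = image_mset f (\<Sum>S\<in>#C. mset_set S)" for C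
    by (induction C) (auto simp: im)
  show "bij_betw (image_mset (image f)) (B m n b) (B m n (image_mset f b))"
  proof (rule bij_betw_imageI)
    have "inj (image f)" using assms by (simp add: inj_image_eq_iff inj_def)
    thus "inj_on (image_mset (image f)) (B m n b)"
      by (metis inj_on_subset multiset.inj_map subset_UNIV)
    show "image_mset (image f) ` B m n b = B m n (image_mset f b)"
    proof (intro equalityI subsetI)
      fix C assume "C \<in> image_mset (image f) ` B m n b"
      then obtain D where D: "D \<in> B m n b" "C = image_mset (image f) D" by auto
      thus "C \<in> B m n (image_mset f b)"
        using smi[of D] card_image[OF inj_on_subset[OF assms subset_UNIV]]
        by (auto simp: B_def multiset.map_comp o_def)
    next
      fix C assume C: "C \<in> B m n (image_mset f b)"
      let ?D = "image_mset (vimage f) C"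
      have sub: "S \<subseteq> range f" if "S \<in># C" for S
      proof -
        from multi_member_split[OF that] obtain A where "C = add_mset S A" by blast
        hence "image_mset f b = mset_set S + (\<Sum>S\<in>#A. mset_set S)" and fin: "finite S" using C by (auto simp: B_def)
        hence "mset_set S \<subseteq># image_mset f b" by (metis mset_subset_eq_add_left)
        hence "S \<subseteq> set_mset (image_mset f b)" using set_mset_mono[of "mset_set S" "image_mset f b"] fin by simp
        thus ?thesis by auto
      qed
      have CD: "C = image_mset (image f) ?D"
      proof -
        have "image_mset (\<lambda>S. f ` (f -` S)) C = image_mset (\<lambda>S. S) C"
          by (intro image_mset_cong) (use sub in auto)
        thus ?thesis by (simp add: multiset.map_comp o_def)
      qed
      have "?D \<in> B m n b"
      proof -
        have "finite (f -` S) \<and> card (f -` S) = m" if "S \<in># C" for S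
        proof
          have S: "finite S" "card S = m" using C that by (auto simp: B_def)
          show "finite (f -` S)" using S assms by (intro finite_vimageI)
          show "card (f -` S) = m" using S sub[OF that] card_vimage_inj[OF assms, of S] by simp
        qed
        moreover have "image_mset f (\<Sum>S\<in>#?D. mset_set S) = image_mset f b"
        proof -
          have "image_mset f (\<Sum>S\<in>#?D. mset_set S) = (\<Sum>S\<in>#C. mset_set S)"
            unfolding smi[symmetric] by (subst (2) CD) (simp add: multiset.map_comp o_def)
          thus ?thesis using C by (simp add: B_def)
        qed
        hence "(\<Sum>S\<in>#?D. mset_set S) = b" using multiset.inj_map[OF assms] by (auto simp: inj_def)
        ultimately show ?thesis using C by (auto simp: B_def)
      qed
      thus "C \<in> image_mset (image f) ` B m n b" using CD by blast
    qed
  qed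
qed

text \<open>Free of N, so that multiplicities obtained with alphabets of different sizes can be
  compared.\<close>

definition hdim :: "nat \<Rightarrow> nat \<Rightarrow> nat multiset \<Rightarrow> nat" where
  "hdim m n l = pvs.dim {v \<in> wt m n l. \<forall>i j. i < j \<longrightarrow> E i j v = 0}"

lemma hdim_eq:
  assumes "set_mset l \<subseteq> {..<N}" shows "hdim m n l = pvs.dim (hw N m n l)"
proof -
  have "E i j v = 0" if "v \<in> wt m n l" "N \<le> j" for i j v
    using that assms by (intro E_wt_0[OF that(1)]) auto
  hence "{v \<in> wt m n l. \<forall>i j. i < j \<longrightarrow> E i j v = 0} = hw N m n l"
    unfolding hw_def by (intro Collect_cong conj_cong refl) (metis not_le)
  thus ?thesis by (simp add: hdim_def)
qed

text \<open>For the identity operator the traces are the dimensions of the weight spaces. These are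
  symmetric in the letters, and \<open>alternant_coeff_eq_dim_hw\<close> identifies the coefficients
  of their expansion.\<close>

theorem card_B_expansion:
  assumes "set_mset b \<subseteq> {..<N}"
  shows "card (B m n b) = (\<Sum>l\<in>Pt N (size b). chains (\<lambda>_. True) (count b) (rev [0..<N]) l * hdim m n (mon N l))"
proof -
  let ?g = "trace_poly N m n (\<lambda>v. v)"
  have g: "lk ?g c = (if set_mset c \<subseteq> {..<N} then real (card (B m n c)) else 0)" for c
    by (simp add: lookup_trace_poly trace_on_def)
  have sym: "lk ?g (image_mset (transpose i (Suc i)) c) = lk ?g c" if "Suc i < N" for i c
  proof -
    have "set_mset (image_mset (transpose i (Suc i)) c) \<subseteq> {..<N} \<longleftrightarrow> set_mset c \<subseteq> {..<N}"
      using that by (auto simp: transpose_def subset_iff)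
    thus ?thesis unfolding g by (simp add: card_B_image)
  qed
  have sz: "(\<Sum>i<N. count b i) = size b" using size_mon[of N "count b"] mon_count[OF assms] by simp
  have fb: "filter_mset (\<lambda>i. N \<le> i) b = {#}" using assms by (intro filter_mset_eq_mempty_iff[THEN iffD2]) auto
  have "real (card (B m n b)) = lk ?g b" using assms by (simp add: g)
  also have "\<dots> = (\<Sum>l\<in>Pt N (size b). real (chains (\<lambda>_. True) (count b) (rev [0..<N]) l)
            * lk (V N * ?g) (mon N (\<lambda>i. l i + staircase N i)))"
    using alternant_expansion[OF sym, of N b] by (simp add: sz fb)
  also have "\<dots> = (\<Sum>l\<in>Pt N (size b). real (chains (\<lambda>_. True) (count b) (rev [0..<N]) l) * real (hdim m n (mon N l)))"
  proof (intro sum.cong refl arg_cong2[of _ _ _ _ "(*)"])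
    fix l assume "l \<in> Pt N (size b)"
    hence l: "ptn l" by (simp add: Pt_def)
    have "lk (V N * ?g) (mon N l + mon N (staircase N)) = real (pvs.dim (hw N m n (mon N l)))"
      using set_mon l by (intro alternant_coeff_eq_dim_hw) (auto simp: count_mon ptn_def)
    thus "lk (V N * ?g) (mon N (\<lambda>i. l i + staircase N i)) = real (hdim m n (mon N l))"
      by (simp add: hdim_eq[OF set_mon] mon_add)
  qed
  finally show ?thesis by (simp only: of_nat_mult[symmetric] of_nat_sum[symmetric] of_nat_eq_iff)
qed

section \<open>Super configurations\<close>

text \<open>
  Letters satisfying \<open>ev\<close> are even, the others odd; odd letters do not repeat inside a block, and a
  block may be repeated iff it has an even number of even letters. With all letters even this counts
  the monomials of \<open>h\<^sub>n\<close> (\<open>m\<close> even) or \<open>e\<^sub>n\<close> (\<open>m\<close> odd) composed with \<open>h\<^sub>m\<close>; with all letters odd, those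
  of \<open>h\<^sub>n\<close> composed with \<open>e\<^sub>m\<close>, for either parity of \<open>m\<close>.
\<close>

definition is_conf :: "nat \<Rightarrow> nat \<Rightarrow> (nat \<Rightarrow> bool) \<Rightarrow> nat multiset multiset \<Rightarrow> bool" where
  "is_conf m n ev C \<longleftrightarrow> size C = n \<and> (\<forall>a\<in>#C. size a = m \<and> (\<forall>i. \<not> ev i \<longrightarrow> count a i \<le> 1))
     \<and> (\<forall>a. odd (size (filter_mset ev a)) \<longrightarrow> count C a \<le> 1)"

definition confs :: "nat \<Rightarrow> nat \<Rightarrow> (nat \<Rightarrow> bool) \<Rightarrow> nat multiset \<Rightarrow> nat multiset multiset set" where
  "confs m n ev b = {C. is_conf m n ev C \<and> \<Sum>\<^sub># C = b}"

lemma finite_confs_set: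
  assumes "finite A"
  shows "finite {C. is_conf m n ev C \<and> set_mset (\<Sum>\<^sub># C) \<subseteq> A}"
proof -
  have "{C. is_conf m n ev C \<and> set_mset (\<Sum>\<^sub># C) \<subseteq> A} \<subseteq> multisets_of_size (multisets_of_size A m) n"
    by (auto simp: is_conf_def multisets_of_size_def)
  thus ?thesis using assms by (rule finite_subset[OF _ finite_multisets_of_size[OF finite_multisets_of_size]])
qed

text \<open>Without even letters, blocks are sets and every block may be repeated.\<close>

lemma card_confs_odd: "card (confs m n (\<lambda>_. False) b) = card (B m n b)"
proof (rule bij_betw_same_card[symmetric])
  show "bij_betw (image_mset mset_set) (B m n b) (confs m n (\<lambda>_. False) b)"
  proof (rule bij_betw_byWitness[where f' = "image_mset set_mset"])
    show "\<forall>C\<in>B m n b. image_mset set_mset (image_mset mset_set C) = C"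
    proof
      fix C assume C: "C \<in> B m n b"
      have "image_mset (\<lambda>S. set_mset (mset_set S)) C = image_mset (\<lambda>S. S) C"
        by (rule image_mset_cong) (use C in \<open>auto simp: B_def\<close>)
      thus "image_mset set_mset (image_mset mset_set C) = C" by (simp add: multiset.map_comp o_def)
    qed
    have one: "mset_set (set_mset a) = a" if "\<forall>i. count a i \<le> 1" for a :: "nat multiset"
    proof (rule multiset_eqI)
      fix i
      show "count (mset_set (set_mset a)) i = count a i"
        using that[rule_format, of i] count_greater_zero_iff[of a i]
        by (auto simp: count_mset_set' simp del: count_greater_zero_iff)
    qed
    have inv: "image_mset mset_set (image_mset set_mset C) = C" if C: "C \<in> confs m n (\<lambda>_. False) b" for C
    proof -
      have "image_mset (\<lambda>a. mset_set (set_mset a)) C = image_mset (\<lambda>a. a) C"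
        by (rule image_mset_cong, rule one) (use C in \<open>auto simp: confs_def is_conf_def\<close>)
      thus ?thesis by (simp add: multiset.map_comp o_def)
    qed
    thus "\<forall>C\<in>confs m n (\<lambda>_. False) b. image_mset mset_set (image_mset set_mset C) = C" by blast
    show "image_mset mset_set ` B m n b \<subseteq> confs m n (\<lambda>_. False) b"
      by (auto simp: B_def confs_def is_conf_def count_mset_set')
    show "image_mset set_mset ` confs m n (\<lambda>_. False) b \<subseteq> B m n b"
    proof clarify
      fix C assume C: "C \<in> confs m n (\<lambda>_. False) b"
      have "card (set_mset a) = m" if "a \<in># C" for a
        using C that one[of a] size_mset_set[of "set_mset a"] by (auto simp: confs_def is_conf_def)
      thus "image_mset set_mset C \<in> B m n b"
        using C inv[OF C] by (auto simp: B_def confs_def is_conf_def)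
    qed
  qed
qed

text \<open>Letters of multiplicity zero may change parity; \<open>super_transfer\<close> relies on
  this.\<close>

lemma confs_cong:
  assumes "\<And>x. x \<in># b \<Longrightarrow> ev x = ev' x"
  shows "confs m n ev b = confs m n ev' b"
proof -
  have "C \<in> confs m n e' b" if e: "\<And>x. x \<in># b \<Longrightarrow> e x = e' x" and C: "C \<in> confs m n e b" for C e e'
  proof -
    have sub: "set_mset a \<subseteq> set_mset b" if "a \<in># C" for a
      using C that by (auto simp: confs_def)
    have 1: "count a i \<le> 1" if "a \<in># C" "\<not> e' i" for a i
    proof (cases "i \<in># a")
      case True
      hence "\<not> e i" using sub[OF that(1)] e that(2) by auto
      thus ?thesis using C that(1) by (auto simp: confs_def is_conf_def)
    qed (simp add: not_in_iff)
    have 2: "count C a \<le> 1" if "odd (size (filter_mset e' a))" for a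
    proof (cases "a \<in># C")
      case True
      hence "filter_mset e' a = filter_mset e a" using sub[OF True] e by (intro filter_mset_cong) auto
      thus ?thesis using C that by (auto simp: confs_def is_conf_def)
    qed (simp add: not_in_iff)
    show ?thesis using C 1 2 by (auto simp: confs_def is_conf_def)
  qed
  from this[of ev ev'] this[of ev' ev] assms show ?thesis by (intro equalityI subsetI) auto
qed

context
  fixes m n x y :: nat and ev :: "nat \<Rightarrow> bool"
  assumes x: "ev x" and y: "\<not> ev y"
begin

definition merge :: "nat multiset \<Rightarrow> nat multiset" where
  "merge = image_mset (\<lambda>i. if i = y then x else i)"

lemma xy: "x \<noteq> y" using x y by auto

lemma count_merge: "count (merge a) i = (if i = x then count a x + count a y else if i = y then 0 else count a i)"
  using xy by (induction a) (auto simp: merge_def)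

definition vy :: "nat multiset \<Rightarrow> nat multiset" where "vy t = add_mset y (t - {#x#})"

definition uo :: "nat multiset \<Rightarrow> nat multiset" where
  "uo t = (if odd (size (filter_mset ev t)) then t else vy t)"
definition ue :: "nat multiset \<Rightarrow> nat multiset" where
  "ue t = (if odd (size (filter_mset ev t)) then vy t else t)"

text \<open>
  A block containing \<open>x\<close> and the block with one \<open>x\<close> replaced by \<open>y\<close> have opposite parity: \<open>uo\<close> is the one
  that may not be repeated and \<open>ue\<close> the other one. Exchanging them in a class that depends only on
  the merged configuration is an involution changing the number of letters \<open>y\<close> by one.
\<close>

definition blk_classes :: "nat multiset multiset \<Rightarrow> nat multiset set" where
  "blk_classes C = {merge a |a. a \<in># C \<and> (x \<in># a \<or> y \<in># a)}"

text \<open>The choice of t depends on \<open>blk_classes C\<close> alone, which toggling preserves,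
  so a second toggle picks the same class. A single block is moved: \<open>uo t\<close> occurs at
  most once and is turned into \<open>ue t\<close> if present; otherwise a copy of
  \<open>ue t\<close> is turned into it.\<close>

definition toggle :: "nat multiset multiset \<Rightarrow> nat multiset multiset" where
  "toggle C = (let t = (SOME t. t \<in> blk_classes C) in
     if uo t \<in># C then add_mset (ue t) (C - {#uo t#}) else add_mset (uo t) (C - {#ue t#}))"

lemma uo_ue_parity:
  assumes "x \<in># t" "y \<notin># t"
  shows "odd (size (filter_mset ev (uo t)))" "even (size (filter_mset ev (ue t)))" "uo t \<noteq> ue t"
    "merge (uo t) = t" "merge (ue t) = t" "x \<in># uo t \<or> y \<in># uo t" "x \<in># ue t \<or> y \<in># ue t"
    "size (uo t) = size t" "size (ue t) = size t"
    "count (uo t) y + count (ue t) y = 1"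
    "\<And>i. i \<noteq> x \<Longrightarrow> i \<noteq> y \<Longrightarrow> count (uo t) i = count t i \<and> count (ue t) i = count t i"
proof -
  obtain s where s: "t = add_mset x s" using assms(1) by (metis mset_add)
  have ys: "y \<notin># s" using assms s by auto
  have mgs: "merge s = s" 
  proof -
    have "image_mset (\<lambda>i. if i = y then x else i) s = image_mset (\<lambda>i. i) s"
      by (rule image_mset_cong) (use ys in auto)
    thus ?thesis by (simp add: merge_def)
  qed
  have mgt: "merge t = t" "merge (vy t) = t" using mgs xy by (auto simp: s vy_def merge_def)
  have ne: "vy t \<noteq> t" using xy by (simp add: s vy_def)
  show "odd (size (filter_mset ev (uo t)))" "even (size (filter_mset ev (ue t)))"
    using x y by (auto simp: uo_def ue_def vy_def s)
  show "uo t \<noteq> ue t" using ne by (auto simp: uo_def ue_def)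
  show "merge (uo t) = t" "merge (ue t) = t" using mgt by (auto simp: uo_def ue_def)
  show "x \<in># uo t \<or> y \<in># uo t" "x \<in># ue t \<or> y \<in># ue t" by (auto simp: uo_def ue_def vy_def s)
  show "size (uo t) = size t" "size (ue t) = size t" by (auto simp: uo_def ue_def vy_def s)
  show "count (uo t) y + count (ue t) y = 1"
    using ys xy by (auto simp: uo_def ue_def vy_def s not_in_iff)
  show "\<And>i. i \<noteq> x \<Longrightarrow> i \<noteq> y \<Longrightarrow> count (uo t) i = count t i \<and> count (ue t) i = count t i"
    by (auto simp: uo_def ue_def vy_def s)
qed

text \<open>The odd letter y occurs at most once in a block, so a merged block comes from just two
  blocks.\<close>

lemma class_cases:
  assumes "count a y \<le> 1" "x \<in># a \<or> y \<in># a"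
  shows "a = uo (merge a) \<or> a = ue (merge a)" "x \<in># merge a" "y \<notin># merge a"
proof -
  show xm: "x \<in># merge a" "y \<notin># merge a"
    using assms(2) xy by (auto simp: merge_def)
  have "a = merge a \<or> a = vy (merge a)"
  proof (cases "count a y = 0")
    case True
    hence "a = merge a" using xy by (auto simp: multiset_eq_iff count_merge)
    thus ?thesis ..
  next
    case False
    hence "count a y = 1" using assms(1) by linarith
    hence "a = vy (merge a)" using xy by (auto simp: multiset_eq_iff count_merge vy_def)
    thus ?thesis ..
  qed
  thus "a = uo (merge a) \<or> a = ue (merge a)" by (auto simp: uo_def ue_def)
qed

lemma toggle_props:
  assumes C: "is_conf m n ev C" and ne: "blk_classes C \<noteq> {}"
  shows "is_conf m n ev (toggle C)" "blk_classes (toggle C) = blk_classes C" "toggle (toggle C) = C"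
    "merge (\<Sum>\<^sub># (toggle C)) = merge (\<Sum>\<^sub># C)"
    "(-1 :: int) ^ count (\<Sum>\<^sub># (toggle C)) y = - ((-1) ^ count (\<Sum>\<^sub># C) y)"
proof -
  define t where "t = (SOME t. t \<in> blk_classes C)"
  have "t \<in> blk_classes C" unfolding t_def using ne by (simp add: some_in_eq)
  then obtain a where a: "t = merge a" "a \<in># C" "x \<in># a \<or> y \<in># a" by (auto simp: blk_classes_def)
  have ay: "count a y \<le> 1" using C a(2) y by (auto simp: is_conf_def)
  note cc = class_cases[OF ay a(3), folded a(1)]
  note pp = uo_ue_parity[OF cc(2,3)]
  have sz: "size t = m" using C a by (auto simp: is_conf_def merge_def)
  have cnt: "count t i \<le> 1" if "\<not> ev i" for i
  proof -
    have "i \<noteq> x" using that x by auto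
    thus ?thesis using C a that by (auto simp: count_merge is_conf_def)
  qed
  have bl: "size u = m \<and> (\<forall>i. \<not> ev i \<longrightarrow> count u i \<le> 1)" if u: "u = uo t \<or> u = ue t" for u
  proof (intro conjI allI impI)
    show "size u = m" using u pp sz by auto
    fix i assume i: "\<not> ev i"
    hence "i \<noteq> x" using x by auto
    show "count u i \<le> 1"
    proof (cases "i = y")
      case True thus ?thesis using u pp(10) by auto
    next
      case False
      thus ?thesis using u pp(11)[OF \<open>i \<noteq> x\<close>] cnt[OF i] by auto
    qed
  qed
  have clsadd: "blk_classes (add_mset u D) = insert t (blk_classes D)" if "u = uo t \<or> u = ue t" for u D
  proof -
    have u: "merge u = t" "x \<in># u \<or> y \<in># u" using that pp(4-7) by auto
    have "blk_classes (add_mset u D) = insert (merge u) (blk_classes D)" using u(2) unfolding blk_classes_def by auto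
    thus ?thesis using u(1) by simp
  qed
  have togC: "toggle C = (if uo t \<in># C then add_mset (ue t) (C - {#uo t#}) else add_mset (uo t) (C - {#ue t#}))"
    by (simp add: toggle_def t_def Let_def)
  define u v D where "u = (if uo t \<in># C then uo t else ue t)" and "v = (if uo t \<in># C then ue t else uo t)"
    and "D = C - {#u#}"
  have uC: "u \<in># C" using cc(1) a(2) by (auto simp: u_def)
  have CD: "C = add_mset u D" using uC by (simp add: D_def)
  have tC: "toggle C = add_mset v D" by (simp add: togC u_def v_def D_def)
  have uv: "{u, v} = {uo t, ue t}" "u \<noteq> v" using pp(3) by (auto simp: u_def v_def)
  have res: "count C b \<le> 1" if "odd (size (filter_mset ev b))" for b using C that by (auto simp: is_conf_def)
  \<comment> \<open>A block with an odd number of even letters occurs at most once in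
    \<open>C\<close>, so taking it away leaves no second copy.\<close>
  have uoD: "uo t \<notin># D"
  proof (cases "uo t \<in># C")
    case True
    hence "u = uo t" by (simp add: u_def)
    hence "count C (uo t) = Suc (count D (uo t))" unfolding CD by simp
    thus ?thesis using res[OF pp(1)] by (simp add: not_in_iff)
  next
    case False
    thus ?thesis unfolding D_def by (auto dest: in_diffD)
  qed
  show cl: "blk_classes (toggle C) = blk_classes C"
  proof -
    have "u = uo t \<or> u = ue t" "v = uo t \<or> v = ue t" by (auto simp: u_def v_def)
    thus ?thesis unfolding tC using clsadd[of v D] clsadd[of u D] CD by (simp only:)
  qed  show "is_conf m n ev (toggle C)"
    unfolding is_conf_def tC
  proof (intro conjI ballI allI impI)
    show "size (add_mset v D) = n" using C by (simp add: is_conf_def CD)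
    fix b assume b: "b \<in># add_mset v D"
    show "size b = m" using b bl[of v] uv C by (auto simp: is_conf_def CD)
    fix i assume "\<not> ev i" thus "count b i \<le> 1" using b bl[of v] uv C by (auto simp: is_conf_def CD)
  next
    fix b assume odd: "odd (size (filter_mset ev b))"
    show "count (add_mset v D) b \<le> 1"
    proof (cases "b = v")
      case True
      hence "b = uo t" using odd pp(2) uv by auto
      thus ?thesis using uoD True by (simp add: not_in_iff)
    next
      case False
      thus ?thesis using res[OF odd] by (auto simp: CD split: if_splits)
    qed
  qed
  show "toggle (toggle C) = C"
  proof -
    have t': "(SOME t. t \<in> blk_classes (toggle C)) = t" by (simp add: cl t_def)
    have "toggle (toggle C) = (if uo t \<in># toggle C then add_mset (ue t) (toggle C - {#uo t#}) else add_mset (uo t) (toggle C - {#ue t#}))"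
      unfolding toggle_def[of "toggle C"] t' Let_def ..
    also have "\<dots> = add_mset u D"
    proof (cases "uo t \<in># C")
      case True
      hence "u = uo t" "v = ue t" by (auto simp: u_def v_def)
      thus ?thesis using uoD pp(3) unfolding tC by simp
    next
      case False
      hence "u = ue t" "v = uo t" by (auto simp: u_def v_def)
      thus ?thesis unfolding tC by simp
    qed
    finally show ?thesis using CD by (simp only:)
  qed
  have S: "\<Sum>\<^sub># (toggle C) = v + \<Sum>\<^sub># D" "\<Sum>\<^sub># C = u + \<Sum>\<^sub># D"
    unfolding tC by (simp, subst CD, simp)
  have "merge u = t" "merge v = t" using pp(4,5) by (simp_all add: u_def v_def)
  thus "merge (\<Sum>\<^sub># (toggle C)) = merge (\<Sum>\<^sub># C)" unfolding S by (simp add: merge_def)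
  have "count u y + count v y = 1" using pp(10) by (auto simp: u_def v_def)
  hence "(count u y = 0 \<and> count v y = 1) \<or> (count u y = 1 \<and> count v y = 0)" by linarith
  thus "(-1 :: int) ^ count (\<Sum>\<^sub># (toggle C)) y = - ((-1) ^ count (\<Sum>\<^sub># C) y)"
    unfolding S by auto
qed

text \<open>Setting x = z and y = -z removes all dependence on z; this is the coefficient of z^r. As
  r > 0, some block contains x or y, and \<open>toggle\<close> pairs configurations of opposite
  sign.\<close>

lemma confs_cancel:
  assumes r: "r > 0" and b: "x \<notin># b" "y \<notin># b"
  shows "(\<Sum>j\<le>r. (-1) ^ j * int (card (confs m n ev (b + replicate_mset (r - j) x + replicate_mset j y)))) = 0"
proof -
  define S where "S = {C. is_conf m n ev C \<and> merge (\<Sum>\<^sub># C) = b + replicate_mset r x}"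
  have fib: "confs m n ev (b + replicate_mset (r - j) x + replicate_mset j y) = {C\<in>S. count (\<Sum>\<^sub># C) y = j}" if "j \<le> r" for j
  proof -
    have "z = b + replicate_mset (r - j) x + replicate_mset j y \<longleftrightarrow> merge z = b + replicate_mset r x \<and> count z y = j" for z
    proof
      assume "z = b + replicate_mset (r - j) x + replicate_mset j y"
      thus "merge z = b + replicate_mset r x \<and> count z y = j"
        using xy b that by (auto simp: multiset_eq_iff count_merge not_in_iff)
    next
      assume z: "merge z = b + replicate_mset r x \<and> count z y = j"
      show "z = b + replicate_mset (r - j) x + replicate_mset j y"
      proof (rule multiset_eqI)
        fix i
        have "count (merge z) i = count (b + replicate_mset r x) i" using z by simp
        thus "count z i = count (b + replicate_mset (r - j) x + replicate_mset j y) i"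
          using conjunct2[OF z] xy b by (auto simp: count_merge not_in_iff split: if_splits)
      qed
    qed
    thus ?thesis by (auto simp: confs_def S_def)
  qed
  have le: "count (\<Sum>\<^sub># C) y \<le> r" if "C \<in> S" for C
  proof -
    have "count (merge (\<Sum>\<^sub># C)) x = r" using that b by (simp add: S_def not_in_iff)
    thus ?thesis by (simp add: count_merge)
  qed
  have finS: "finite S"
  proof -
    have "S \<subseteq> {C. is_conf m n ev C \<and> set_mset (\<Sum>\<^sub># C) \<subseteq> set_mset b \<union> {x, y}}"
    proof clarify
      fix C assume C: "C \<in> S"
      have "i \<in> set_mset b \<union> {x, y}" if i: "i \<in># \<Sum>\<^sub># C" for i
      proof -
        have "(if i = y then x else i) \<in># merge (\<Sum>\<^sub># C)" unfolding merge_def using i by auto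
        thus ?thesis using C by (auto simp: S_def split: if_splits)
      qed
      thus "is_conf m n ev C \<and> set_mset (\<Sum>\<^sub># C) \<subseteq> set_mset b \<union> {x, y}" using C by (auto simp: S_def)
    qed
    thus ?thesis by (rule finite_subset) (rule finite_confs_set, simp)
  qed
  have ne: "blk_classes C \<noteq> {}" if "C \<in> S" for C
  proof -
    have "x \<in># merge (\<Sum>\<^sub># C)" using that r by (simp add: S_def)
    then obtain i where "i \<in># \<Sum>\<^sub># C" "i = x \<or> i = y" by (auto simp: merge_def split: if_splits)
    thus ?thesis by (auto simp: blk_classes_def)
  qed
  have SD: "is_conf m n ev C" "merge (\<Sum>\<^sub># C) = b + replicate_mset r x" if "C \<in> S" for C using that by (auto simp: S_def)
  have tS: "toggle C \<in> S" "toggle (toggle C) = C" "(-1 :: int) ^ count (\<Sum>\<^sub># (toggle C)) y = - ((-1) ^ count (\<Sum>\<^sub># C) y)" if "C \<in> S" for C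
    using toggle_props[OF SD(1)[OF that] ne[OF that]] SD(2)[OF that] by (simp_all add: S_def)
  have zero: "(\<Sum>C\<in>S. (-1 :: int) ^ count (\<Sum>\<^sub># C) y) = 0"
  proof -
    have "(\<Sum>C\<in>S. (-1 :: int) ^ count (\<Sum>\<^sub># C) y) = (\<Sum>C\<in>S. (-1 :: int) ^ count (\<Sum>\<^sub># (toggle C)) y)"
      by (rule sum.reindex_bij_witness[of _ toggle toggle]) (simp_all only: tS)
    also have "\<dots> = - (\<Sum>C\<in>S. (-1 :: int) ^ count (\<Sum>\<^sub># C) y)"
      unfolding sum_negf[symmetric] by (intro sum.cong refl) (simp only: tS)
    finally show ?thesis by linarith
  qed
  have "(\<Sum>j\<le>r. (-1) ^ j * int (card (confs m n ev (b + replicate_mset (r - j) x + replicate_mset j y))))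
     = (\<Sum>j\<le>r. \<Sum>C\<in>{C\<in>S. count (\<Sum>\<^sub># C) y = j}. (-1) ^ count (\<Sum>\<^sub># C) y)"
    by (intro sum.cong refl) (simp add: fib)
  also have "\<dots> = (\<Sum>C\<in>S. (-1 :: int) ^ count (\<Sum>\<^sub># C) y)"
    by (rule sum.group[OF finS]) (use le in auto)
  finally show ?thesis using zero by simp
qed

end

section \<open>Signed cancellation for chains of strips\<close>

lemma strip_zero: "ptn l \<Longrightarrow> {k. strip e k l \<and> psize l = psize k + 0} = {l}"
  using psize_mono_eq[of l] strip_le[of e _ l]
  by (auto simp: strip_def hstrip_def vstrip_def ptn_def)

lemma chains_cong:
  assumes "ptn l" "\<And>x. x \<in> set xs \<Longrightarrow> c x = c' x \<and> (ev x = ev' x \<or> c x = 0)"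
  shows "chains ev c xs l = chains ev' c' xs l"
  using assms
proof (induction xs arbitrary: l)
  case (Cons x xs)
  have "{k. strip (ev x) k l \<and> psize l = psize k + c x} = {k. strip (ev' x) k l \<and> psize l = psize k + c' x}"
  proof (cases "ev x = ev' x")
    case False
    hence "c x = 0" "c' x = 0" using Cons.prems(2)[of x] by auto
    thus ?thesis by (simp only: strip_zero[OF Cons.prems(1)])
  qed (use Cons.prems(2)[of x] in simp)
  moreover have "chains ev c xs k = chains ev' c' xs k" if "strip (ev' x) k l" for k
    by (rule Cons.IH[OF strip_ptn[OF that Cons.prems(1)]], rule Cons.prems(2)) simp
  ultimately show ?case by simp
qed simp

lemma chains_insert_zero:
  assumes "ptn l" "c y = 0"
  shows "chains ev c (A @ y # R) l = chains ev c (A @ R) l"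
  using assms(1)
proof (induction A arbitrary: l)
  case Nil
  thus ?case using strip_zero[of l "ev y"] assms(2) by simp
next
  case (Cons x A)
  show ?case using Cons strip_ptn by (simp cong: sum.cong) (intro sum.cong refl, auto)
qed

text \<open>In the first row where \<open>k\<close> and \<open>l\<close> differ, the last box of
  \<open>l\<close> may belong to either strip; exchanging its membership is an involution that
  changes the sign. In the rows above, \<open>k\<close> and \<open>l\<close> agree, so interlacing
  survives.\<close>

lemma strip_cancel:
  assumes l: "ptn l" and lt: "psize k < psize l"
  shows "(\<Sum>u | hstrip k u \<and> vstrip u l. (-1 :: int) ^ (psize l + psize u)) = 0"
proof (cases "\<exists>u. hstrip k u \<and> vstrip u l")
  case False
  hence "{u. hstrip k u \<and> vstrip u l} = {}" by auto
  thus ?thesis by (simp only: sum.empty)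
next
  case True
  then obtain u0 where u0: "hstrip k u0" "vstrip u0 l" by blast
  have kl: "k i \<le> l i" for i using u0 by (metis hstrip_def vstrip_def order_trans)
  have "k \<noteq> l" using lt by auto
  then obtain i1 where "k i1 < l i1" using kl by (metis ext le_neq_implies_less)
  define i where "i = (LEAST i. k i < l i)"
  have i: "k i < l i" unfolding i_def by (rule LeastI) fact
  have below: "k j = l j" if "j < i" for j
    using not_less_Least[of j "\<lambda>i. k i < l i"] that kl[of j] by (simp add: i_def)
  define io where "io u = u(i := if u i = l i then l i - 1 else l i)" for u :: "nat \<Rightarrow> nat"
  let ?S = "{u. hstrip k u \<and> vstrip u l}"
  have ui: "u i = l i \<or> u i = l i - 1" if "u \<in> ?S" for u
  proof -
    have "u i \<le> l i" "l i \<le> Suc (u i)" using that unfolding vstrip_def by blast+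
    thus ?thesis by arith
  qed
  have S: "io u \<in> ?S" "io (io u) = u" "(-1 :: int) ^ (psize l + psize (io u)) = - ((-1) ^ (psize l + psize u))"
    if u: "u \<in> ?S" for u
  proof -
    have ku: "k j \<le> u j" "u (Suc j) \<le> k j" "u j \<le> l j" "l j \<le> Suc (u j)" for j
      using u by (auto simp: hstrip_def vstrip_def)
    have h: "hstrip k (io u)" unfolding hstrip_def
    proof
      fix j
      have "k j \<le> io u j" using ku(1)[of j] i by (auto simp: io_def)
      moreover have "io u (Suc j) \<le> k j"
      proof (cases "Suc j = i")
        case True
        have "io u (Suc j) \<le> l (Suc j)" using True by (auto simp: io_def)
        also have "\<dots> \<le> l j" using l by (simp add: ptn_def)
        also have "\<dots> = k j" using below[of j] True by simp
        finally show ?thesis .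
      qed (use ku(2)[of j] in \<open>auto simp: io_def\<close>)
      ultimately show "k j \<le> io u j \<and> io u (Suc j) \<le> k j" ..
    qed
    have "vstrip (io u) l" unfolding vstrip_def
    proof
      fix j
      have "io u (Suc j) \<le> io u j" using h by (metis hstrip_def order_trans)
      thus "io u j \<le> l j \<and> l j \<le> Suc (io u j) \<and> io u (Suc j) \<le> io u j"
        using ku[of j] i by (auto simp: io_def)
    qed
    with h show "io u \<in> ?S" by simp
    show "io (io u) = u" using ui[OF u] i by (auto simp: io_def fun_eq_iff)
    obtain N where N: "\<forall>j\<ge>N. l j = 0" using ptn_bound[OF l] by blast
    have iN: "i < N" using i N by (metis not_le not_less_zero)
    have ps: "psize w = w i + (\<Sum>j\<in>{..<N} - {i}. w j)" if "\<forall>j. w j \<le> l j" for w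
    proof -
      have "psize w = (\<Sum>j<N. w j)" using that N by (intro psize_eq) (metis le_zero_eq)
      thus ?thesis using iN by (simp add: sum.remove[of _ i])
    qed
    have "(\<Sum>j\<in>{..<N} - {i}. io u j) = (\<Sum>j\<in>{..<N} - {i}. u j)" by (intro sum.cong) (auto simp: io_def)
    moreover have "\<forall>j. io u j \<le> l j" using ku(3) by (auto simp: io_def)
    ultimately have "psize (io u) + u i = psize u + io u i" using ps[of u] ps[of "io u"] ku(3) by simp
    hence "psize (io u) = Suc (psize u) \<or> psize u = Suc (psize (io u))"
      using ui[OF u] i by (auto simp: io_def split: if_splits)
    thus "(-1 :: int) ^ (psize l + psize (io u)) = - ((-1) ^ (psize l + psize u))" by auto
  qed
  have "(\<Sum>u\<in>?S. (-1 :: int) ^ (psize l + psize u)) = (\<Sum>u\<in>?S. (-1 :: int) ^ (psize l + psize (io u)))"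
    by (rule sum.reindex_bij_witness[of _ io io]) (simp_all only: S)
  also have "\<dots> = - (\<Sum>u\<in>?S. (-1 :: int) ^ (psize l + psize u))"
    unfolding sum_negf[symmetric] by (intro sum.cong refl) (simp only: S)
  finally show ?thesis by simp
qed

text \<open>The counterpart of \<open>confs_cancel\<close>. As y follows x directly, fixing the
  shapes inside and outside the two strips leaves the sum of \<open>strip_cancel\<close>; the
  letters in \<open>A\<close> only add strips further out.\<close>

lemma chains_cancel:
  assumes x: "ev x" and y: "\<not> ev y" and r: "r > 0" and l: "ptn l"
    and n: "x \<notin> set A" "y \<notin> set A" "x \<notin> set R" "y \<notin> set R"
  shows "(\<Sum>j\<le>r. (-1) ^ j * int (chains ev (c(x := r - j, y := j)) (A @ y # x # R) l)) = 0"
  using l n(1,2)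
proof (induction A arbitrary: l)
  case Nil
  have xy: "x \<noteq> y" using x y by auto
  let ?c = "\<lambda>j. c(x := r - j, y := j)"
  let ?K = "{k. (\<forall>i. k i \<le> l i) \<and> psize l = psize k + r}"
  let ?U = "{u. vstrip u l}"
  have finU: "finite ?U" using finite_strip[OF Nil(1), of False "\<lambda>_. True"] by (simp add: strip_def)
  have finK: "finite ?K" by (rule finite_subset[OF _ finite_below[of l]]) (use Nil(1) in \<open>auto simp: ptn_def\<close>)
  have "int (chains ev (?c j) (y # x # R) l)
      = (\<Sum>u\<in>{u\<in>?U. psize l = psize u + j}. \<Sum>k\<in>{k\<in>?K. hstrip k u}. int (chains ev c R k))" if "j \<le> r" for j
  proof -
    have "chains ev (?c j) (y # x # R) l = (\<Sum>u | vstrip u l \<and> psize l = psize u + j. \<Sum>k | hstrip k u \<and> psize u = psize k + (r - j). chains ev (?c j) R k)"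
      using x y xy by (simp add: strip_def)
    also have "\<dots> = (\<Sum>u\<in>{u\<in>?U. psize l = psize u + j}. \<Sum>k\<in>{k\<in>?K. hstrip k u}. chains ev c R k)"
    proof (rule sum.cong)
      fix u assume u: "u \<in> {u\<in>?U. psize l = psize u + j}"
      have up: "ptn u" using u strip_ptn[of False u l] Nil(1) by (simp add: strip_def)
      show "(\<Sum>k | hstrip k u \<and> psize u = psize k + (r - j). chains ev (?c j) R k) = (\<Sum>k\<in>{k\<in>?K. hstrip k u}. chains ev c R k)"
      proof (rule sum.cong)
        have "k i \<le> l i" if "hstrip k u" for k i using that u by (metis (mono_tags, lifting) hstrip_def vstrip_def mem_Collect_eq order_trans)
        thus "{k. hstrip k u \<and> psize u = psize k + (r - j)} = {k\<in>?K. hstrip k u}" using u \<open>j \<le> r\<close> by auto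
        fix k assume "k \<in> {k\<in>?K. hstrip k u}"
        hence "ptn k" using up strip_ptn[of True k u] by (simp add: strip_def)
        thus "chains ev (?c j) R k = chains ev c R k" using n by (intro chains_cong) auto
      qed
    qed auto
    finally show ?thesis by (simp only: of_nat_sum)
  qed
  hence "(\<Sum>j\<le>r. (-1) ^ j * int (chains ev (?c j) (y # x # R) l))
     = (\<Sum>j\<le>r. \<Sum>u\<in>{u\<in>?U. psize l = psize u + j}. \<Sum>k\<in>{k\<in>?K. hstrip k u}. (-1) ^ j * int (chains ev c R k))"
    by (simp add: sum_distrib_left)
  also have "\<dots> = (\<Sum>j\<le>r. \<Sum>k\<in>?K. \<Sum>u\<in>{u\<in>{u\<in>?U. psize l = psize u + j}. hstrip k u}. (-1) ^ j * int (chains ev c R k))"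
    using finU finK by (intro sum.cong refl sum.swap_restrict) auto
  also have "\<dots> = (\<Sum>k\<in>?K. \<Sum>j\<le>r. \<Sum>u\<in>{u\<in>{u\<in>?U. psize l = psize u + j}. hstrip k u}. (-1) ^ j * int (chains ev c R k))"
    by (rule sum.swap)
  also have "\<dots> = (\<Sum>k\<in>?K. (\<Sum>u | hstrip k u \<and> vstrip u l. (-1) ^ (psize l + psize u)) * int (chains ev c R k))"
  proof (intro sum.cong refl)
    fix k assume k: "k \<in> ?K"
    let ?S = "{u. hstrip k u \<and> vstrip u l}"
    have finS: "finite ?S" by (rule finite_subset[OF _ finU]) auto
    have le: "psize u \<le> psize l \<and> psize k \<le> psize u" if "u \<in> ?S" for u
    proof -
      have "ptn u" using that strip_ptn[of False u l] Nil(1) by (simp add: strip_def)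
      have mono: "psize w \<le> psize z" if "ptn z" "\<And>i. w i \<le> z i" for w z
      proof -
        from ptn_bound[OF that(1)] obtain N where N: "\<forall>j\<ge>N. z j = 0" by blast
        hence "\<forall>j\<ge>N. w j = 0" using that(2) by (metis le_zero_eq)
        thus ?thesis using N psize_eq[of N w] psize_eq[of N z] that(2) by (simp add: sum_mono)
      qed
      show ?thesis using mono[OF Nil(1), of u] mono[OF \<open>ptn u\<close>, of k] that by (auto simp: hstrip_def vstrip_def)
    qed
    have "(\<Sum>j\<le>r. \<Sum>u\<in>{u\<in>{u\<in>?U. psize l = psize u + j}. hstrip k u}. (-1) ^ j * int (chains ev c R k))
        = (\<Sum>j\<le>r. \<Sum>u\<in>{u\<in>?S. psize l - psize u = j}. (-1) ^ (psize l + psize u) * int (chains ev c R k))"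
    proof (intro sum.cong refl)
      fix j u assume u: "u \<in> {u\<in>?S. psize l - psize u = j}"
      \<comment> \<open>The strip of y has size j, so the sign depends only on the intermediate
        shape.\<close>
      hence "psize l + psize u = j + 2 * psize u" using le[of u] by auto
      thus "(-1) ^ j * int (chains ev c R k) = (-1) ^ (psize l + psize u) * int (chains ev c R k)"
        by (simp add: power_add)
    next
      fix j
      show "{u\<in>{u\<in>?U. psize l = psize u + j}. hstrip k u} = {u\<in>?S. psize l - psize u = j}"
        using le by force
    qed
    also have "\<dots> = (\<Sum>u\<in>?S. (-1) ^ (psize l + psize u) * int (chains ev c R k))"
      by (rule sum.group[OF finS]) (use le k in force)+
    finally show "(\<Sum>j\<le>r. \<Sum>u\<in>{u\<in>{u\<in>?U. psize l = psize u + j}. hstrip k u}. (-1) ^ j * int (chains ev c R k))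
      = (\<Sum>u\<in>?S. (-1) ^ (psize l + psize u)) * int (chains ev c R k)"
      by (simp add: sum_distrib_right)
  qed
  also have "\<dots> = 0"
  proof (intro sum.neutral ballI)
    fix k assume "k \<in> ?K"
    hence "psize k < psize l" using r by auto
    thus "(\<Sum>u | hstrip k u \<and> vstrip u l. (-1) ^ (psize l + psize u)) * int (chains ev c R k) = 0"
      by (simp only: strip_cancel[OF Nil(1)] mult_zero_left)
  qed
  finally show ?case by (simp only: append_Nil)
next
  case (Cons a A)
  let ?c = "\<lambda>j. c(x := r - j, y := j)"
  have "(\<Sum>j\<le>r. (-1) ^ j * int (chains ev (?c j) ((a # A) @ y # x # R) l))
     = (\<Sum>j\<le>r. \<Sum>k | strip (ev a) k l \<and> psize l = psize k + c a. (-1) ^ j * int (chains ev (?c j) (A @ y # x # R) k))"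
    using Cons.prems by (simp add: sum_distrib_left)
  also have "\<dots> = (\<Sum>k | strip (ev a) k l \<and> psize l = psize k + c a. \<Sum>j\<le>r. (-1) ^ j * int (chains ev (?c j) (A @ y # x # R) k))"
    by (rule sum.swap)
  also have "\<dots> = 0"
  proof (rule sum.neutral, rule ballI)
    fix k assume "k \<in> {k. strip (ev a) k l \<and> psize l = psize k + c a}"
    hence "ptn k" using strip_ptn Cons.prems(1) by blast
    thus "(\<Sum>j\<le>r. (-1) ^ j * int (chains ev (?c j) (A @ y # x # R) k)) = 0"
      using Cons.prems(2,3) by (intro Cons.IH) simp_all
  qed
  finally show ?case .
qed

section \<open>Transfer from odd to even letters\<close>

definition content :: "nat list \<Rightarrow> (nat \<Rightarrow> nat) \<Rightarrow> nat multiset" where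
  "content xs c = (\<Sum>x\<in>set xs. replicate_mset (c x) x)"

lemma count_content: "count (content xs c) i = (if i \<in> set xs then c i else 0)"
proof -
  have "count (content xs c) i = (\<Sum>x\<in>set xs. if x = i then c x else 0)"
    unfolding content_def count_sum by (intro sum.cong) auto
  thus ?thesis by simp
qed

definition Ptns :: "nat \<Rightarrow> (nat \<Rightarrow> nat) set" where "Ptns s = {l. ptn l \<and> psize l = s}"

lemma ptn_psize_bound: "ptn l \<Longrightarrow> psize l \<le> i \<Longrightarrow> l i = 0"
proof (rule ccontr)
  assume l: "ptn l" "psize l \<le> i" "l i \<noteq> 0"
  obtain N where N: "\<forall>i\<ge>N. l i = 0" using ptn_bound[OF l(1)] by blast
  have iN: "i < N" using N l(3) by (metis not_le)
  have "Suc i = (\<Sum>j<Suc i. 1)" by simp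
  also have "\<dots> \<le> (\<Sum>j<Suc i. l j)"
    using ptn_mono[OF l(1)] l(3) by (intro sum_mono) (metis le_zero_eq lessThan_iff less_Suc_eq_le not_less_eq_eq One_nat_def)
  also have "\<dots> \<le> (\<Sum>j<N. l j)" using iN by (intro sum_mono2) auto
  also have "\<dots> = psize l" using psize_eq[of N l] N by simp
  finally show False using l(2) by simp
qed

lemma PP_eq_Pt: "s \<le> N \<Longrightarrow> Ptns s = Pt N s"
  using ptn_psize_bound by (auto simp: Ptns_def Pt_def)

lemma finite_PP [simp]: "finite (Ptns s)"
  using PP_eq_Pt[of s s] finite_Pt by simp

text \<open>Induction on the total multiplicity of the even letters. A fresh odd letter y is placed
  next to an even letter x, and both sides satisfy the same alternating relation in the number j of
  copies of x turned into y. The terms with j > 0 agree by induction, hence so does the term j =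
  0.\<close>

theorem super_transfer:
  assumes H: "\<And>xs c. distinct xs \<Longrightarrow>
      int (card (confs m n (\<lambda>_. False) (content xs c))) = (\<Sum>l\<in>Ptns s. p l * int (chains (\<lambda>_. False) c xs l))"
    and "distinct xs"
  shows "int (card (confs m n ev (content xs c))) = (\<Sum>l\<in>Ptns s. p l * int (chains ev c xs l))"
  using assms(2)
proof (induction "\<Sum>x\<in>{x\<in>set xs. ev x}. c x" arbitrary: xs ev c rule: less_induct)
  case less
  show ?case
  proof (cases "\<exists>x\<in>set xs. ev x \<and> c x > 0")
    \<comment> \<open>No even letter actually occurs, so all letters may be declared odd.\<close>
    case False
    have "confs m n ev (content xs c) = confs m n (\<lambda>_. False) (content xs c)"
    proof (rule confs_cong)
      fix i assume "i \<in># content xs c"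
      hence "count (content xs c) i > 0" by simp
      thus "ev i = False" using False by (auto simp: count_content split: if_splits)
    qed
    moreover have "chains ev c xs l = chains (\<lambda>_. False) c xs l" if "l \<in> Ptns s" for l
      using that False by (intro chains_cong) (auto simp: Ptns_def)
    ultimately show ?thesis using H[OF less.prems] by simp
  next
    case True
    then obtain x where x: "x \<in> set xs" "ev x" "c x > 0" by blast
    then obtain A R where xs: "xs = A @ x # R" by (meson split_list)
    obtain y where y: "y \<notin> set xs" using ex_new_if_finite[OF infinite_UNIV_nat, of "set xs"] by auto
    define ev' where "ev' = ev(y := False)"
    define xs' where "xs' = A @ y # x # R"
    let ?r = "c x"
    define cc where "cc j = c(x := ?r - j, y := j)" for j
    have xy: "x \<noteq> y" using x y by auto
    have d': "distinct xs'" using less.prems y by (auto simp: xs xs'_def)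
    have set': "set xs' = insert y (set xs)" by (auto simp: xs xs'_def)
    have nA: "x \<notin> set A" "y \<notin> set A" "x \<notin> set R" "y \<notin> set R" using less.prems y by (auto simp: xs)
    let ?b = "content (A @ R) c"
    have contj: "content xs' (cc j) = ?b + replicate_mset (?r - j) x + replicate_mset j y" for j
      using nA xy by (intro multiset_eqI) (auto simp: count_content cc_def xs'_def)
    have nb: "x \<notin># ?b" "y \<notin># ?b" using nA by (auto simp: count_content not_in_iff)
    have conf0: "(\<Sum>j\<le>?r. (-1) ^ j * int (card (confs m n ev' (content xs' (cc j))))) = 0"
      unfolding contj by (rule confs_cancel) (use x nb xy in \<open>auto simp: ev'_def\<close>)
    have ch0: "(\<Sum>j\<le>?r. (-1) ^ j * int (chains ev' (cc j) xs' l)) = 0" if "l \<in> Ptns s" for l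
      unfolding cc_def xs'_def
      by (rule chains_cancel) (use x nA xy that in \<open>auto simp: ev'_def Ptns_def\<close>)
    \<comment> \<open>The defect of the claim after j copies of x have become y.\<close>
    let ?D = "\<lambda>j. int (card (confs m n ev' (content xs' (cc j)))) - (\<Sum>l\<in>Ptns s. p l * int (chains ev' (cc j) xs' l))"
    have "(\<Sum>j\<le>?r. (-1) ^ j * (\<Sum>l\<in>Ptns s. p l * int (chains ev' (cc j) xs' l)))
        = (\<Sum>l\<in>Ptns s. p l * (\<Sum>j\<le>?r. (-1) ^ j * int (chains ev' (cc j) xs' l)))"
      unfolding sum_distrib_left by (subst sum.swap) (intro sum.cong refl, simp)
    hence D0: "(\<Sum>j\<le>?r. (-1) ^ j * ?D j) = 0"
      using conf0 ch0 by (simp add: right_diff_distrib sum_subtractf)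
    have Dj: "?D j = 0" if j: "j \<in> {..?r}" "j \<noteq> 0" for j
    proof -
      have "(\<Sum>z\<in>{z\<in>set xs'. ev' z}. cc j z) < (\<Sum>z\<in>{z\<in>set xs. ev z}. c z)"
      proof -
        have e: "{z\<in>set xs'. ev' z} = {z\<in>set xs. ev z}" using y by (auto simp: set' ev'_def)
        show ?thesis unfolding e
          by (rule sum_strict_mono_ex1) (use x y j in \<open>auto simp: cc_def\<close>)
      qed
      from less.hyps[OF this d'] show ?thesis by simp
    qed
    have "(\<Sum>j\<le>?r. (-1) ^ j * ?D j) = ?D 0"
      using sum.remove[of "{..?r}" 0 "\<lambda>j. (-1) ^ j * ?D j"] Dj by simp
    hence "?D 0 = 0" using D0 by simp
    moreover have "content xs' (cc 0) = content xs c"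
      using y xy by (intro multiset_eqI) (auto simp: count_content cc_def set')
    moreover have "confs m n ev' (content xs c) = confs m n ev (content xs c)"
      by (rule confs_cong) (use y in \<open>auto simp: ev'_def content_def set_mset_sum\<close>)
    moreover have "chains ev' (cc 0) xs' l = chains ev c xs l" if "l \<in> Ptns s" for l
    proof -
      have l: "ptn l" using that by (simp add: Ptns_def)
      have "chains ev' (cc 0) xs' l = chains ev' (cc 0) xs l"
        unfolding xs'_def xs by (rule chains_insert_zero[OF l]) (simp add: cc_def)
      also have "\<dots> = chains ev c xs l"
        by (rule chains_cong[OF l]) (use y xy in \<open>auto simp: cc_def ev'_def\<close>)
      finally show ?thesis .
    qed
    ultimately show ?thesis by simp
  qed
qed

section \<open>Conjugate partitions\<close>

definition conj_ptn :: "(nat \<Rightarrow> nat) \<Rightarrow> nat \<Rightarrow> nat" where "conj_ptn l i = card {j. i < l j}"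

text \<open>Both sides describe the same box of the diagram; the facts on conjugation below are read
  off from this symmetry.\<close>

lemma less_conj_ptn_iff: assumes "ptn l" shows "j < conj_ptn l i \<longleftrightarrow> i < l j"
proof -
  obtain N where N: "\<forall>i\<ge>N. l i = 0" using ptn_bound[OF assms] by blast
  define t where "t = (LEAST t. l t \<le> i)"
  have ex: "l N \<le> i" using N by simp
  have "l t \<le> i" unfolding t_def by (rule LeastI) (rule ex)
  have "i < l j \<longleftrightarrow> j < t" for j
  proof
    assume "i < l j"
    thus "j < t" using \<open>l t \<le> i\<close> ptn_mono[OF assms, of t j] by (meson leD le_less_trans not_le order_trans)
  next
    assume "j < t"
    thus "i < l j" unfolding t_def using not_less_Least not_le by blast
  qed
  hence "{j. i < l j} = {..<t}" by auto
  thus ?thesis using \<open>\<And>j. i < l j \<longleftrightarrow> j < t\<close> by (simp add: conj_ptn_def)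
qed

lemma nat_eqI_less: "(\<And>j. j < a \<longleftrightarrow> j < b) \<Longrightarrow> a = (b :: nat)" by (metis linorder_neqE_nat less_irrefl)

lemma ptn_conj_ptn: assumes "ptn l" shows "ptn (conj_ptn l)"
proof -
  have "conj_ptn l (Suc i) \<le> conj_ptn l i" for i
    using less_conj_ptn_iff[OF assms, of _ "Suc i"] less_conj_ptn_iff[OF assms, of _ i] by (metis Suc_lessD leI less_irrefl)
  moreover have "{i. conj_ptn l i \<noteq> 0} \<subseteq> {..<l 0}" using less_conj_ptn_iff[OF assms, of 0] by auto
  ultimately show ?thesis by (auto simp: ptn_def intro: finite_subset)
qed

lemma conj_ptn_conj_ptn: assumes "ptn l" shows "conj_ptn (conj_ptn l) = l"
  by (rule ext, rule nat_eqI_less) (simp add: less_conj_ptn_iff[OF ptn_conj_ptn[OF assms]] less_conj_ptn_iff[OF assms])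

lemma psize_card: assumes "ptn l" shows "psize l = card {(i, j). j < l i}"
proof -
  have "{(i, j). j < l i} = (SIGMA i:{i. l i \<noteq> 0}. {..<l i})" by auto
  thus ?thesis using assms by (simp add: psize_def ptn_def)
qed

lemma psize_conj_ptn: assumes "ptn l" shows "psize (conj_ptn l) = psize l"
proof -
  have "{(i, j). j < conj_ptn l i} = prod.swap ` {(i, j). j < l i}" by (auto simp: less_conj_ptn_iff[OF assms] image_iff)
  thus ?thesis by (simp add: psize_card ptn_conj_ptn assms card_image)
qed

lemma conj_ptn_le_iff: assumes "ptn k" "ptn l" shows "(\<forall>i. conj_ptn k i \<le> conj_ptn l i) \<longleftrightarrow> (\<forall>i. k i \<le> l i)"
proof -
  have le: "\<forall>i. conj_ptn k i \<le> conj_ptn l i" if "ptn k" "ptn l" "\<forall>i. k i \<le> l i" for k l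
  proof
    fix i
    have "j < conj_ptn l i" if "j < conj_ptn k i" for j
      using that \<open>\<forall>i. k i \<le> l i\<close> by (auto simp: less_conj_ptn_iff[OF \<open>ptn k\<close>] less_conj_ptn_iff[OF \<open>ptn l\<close>] intro: less_le_trans)
    thus "conj_ptn k i \<le> conj_ptn l i" by (metis leI less_irrefl)
  qed
  from le[OF assms] le[OF ptn_conj_ptn[OF assms(1)] ptn_conj_ptn[OF assms(2)]] conj_ptn_conj_ptn[OF assms(1)] conj_ptn_conj_ptn[OF assms(2)]
  show ?thesis by auto
qed

lemma hstrip_conj_ptn: assumes "ptn k" "ptn l" shows "hstrip (conj_ptn k) (conj_ptn l) \<longleftrightarrow> vstrip k l"
proof -
  have "(\<forall>i. conj_ptn l (Suc i) \<le> conj_ptn k i) \<longleftrightarrow> (\<forall>i j. Suc i < l j \<longrightarrow> i < k j)"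
  proof -
    have "conj_ptn l (Suc i) \<le> conj_ptn k i \<longleftrightarrow> (\<forall>j. j < conj_ptn l (Suc i) \<longrightarrow> j < conj_ptn k i)" for i
      by (meson less_le_trans not_less order.strict_implies_order less_irrefl leI)
    thus ?thesis by (simp add: less_conj_ptn_iff[OF assms(1)] less_conj_ptn_iff[OF assms(2)])
  qed
  also have "\<dots> \<longleftrightarrow> (\<forall>j. l j \<le> Suc (k j))"
  proof (intro iffI allI impI)
    fix j assume a: "\<forall>i j. Suc i < l j \<longrightarrow> i < k j"
    show "l j \<le> Suc (k j)"
    proof (rule ccontr)
      assume "\<not> l j \<le> Suc (k j)"
      with a[rule_format, of "k j" j] show False by simp
    qed
  next
    fix i j assume a: "\<forall>j. l j \<le> Suc (k j)" and "Suc i < l j"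
    from this(2) a[rule_format, of j] show "i < k j" by linarith
  qed
  finally show ?thesis
    using conj_ptn_le_iff[OF assms] assms(1) unfolding hstrip_def vstrip_def ptn_def all_conj_distrib by blast
qed

lemma chains_conj_ptn: "ptn l \<Longrightarrow> chains (\<lambda>_. False) c xs (conj_ptn l) = chains (\<lambda>_. True) c xs l"
proof (induction xs arbitrary: l)
  case Nil
  have "conj_ptn (\<lambda>_. 0) = (\<lambda>_. 0)" by (simp add: conj_ptn_def fun_eq_iff)
  hence "conj_ptn l = (\<lambda>_. 0) \<longleftrightarrow> l = (\<lambda>_. 0)" using conj_ptn_conj_ptn[OF Nil] by auto
  thus ?case by simp
next
  case (Cons x xs)
  note l = Cons.prems
  have st: "ptn k" if "hstrip k l" for k using strip_ptn[of True k l] that l by (simp add: strip_def)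
  have st': "ptn k" if "vstrip k (conj_ptn l)" for k using strip_ptn[of False k "conj_ptn l"] that ptn_conj_ptn[OF l] by (simp add: strip_def)
  have "(\<Sum>k | vstrip k (conj_ptn l) \<and> psize (conj_ptn l) = psize k + c x. chains (\<lambda>_. False) c xs k)
     = (\<Sum>k | hstrip k l \<and> psize l = psize k + c x. chains (\<lambda>_. True) c xs k)"
  proof (rule sum.reindex_bij_witness[of _ conj_ptn conj_ptn])
    fix k assume "k \<in> {k. vstrip k (conj_ptn l) \<and> psize (conj_ptn l) = psize k + c x}"
    hence k: "vstrip k (conj_ptn l)" "psize (conj_ptn l) = psize k + c x" "ptn k" using st' by auto
    show "conj_ptn (conj_ptn k) = k" by (rule conj_ptn_conj_ptn[OF k(3)])
    show "conj_ptn k \<in> {k. hstrip k l \<and> psize l = psize k + c x}"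
      using k hstrip_conj_ptn[OF k(3) ptn_conj_ptn[OF l]] psize_conj_ptn[OF l] psize_conj_ptn[OF k(3)] conj_ptn_conj_ptn[OF l] by simp
    show "chains (\<lambda>_. True) c xs (conj_ptn k) = chains (\<lambda>_. False) c xs k"
      using Cons.IH[OF ptn_conj_ptn[OF k(3)]] conj_ptn_conj_ptn[OF k(3)] by simp
  next
    fix k assume "k \<in> {k. hstrip k l \<and> psize l = psize k + c x}"
    hence k: "hstrip k l" "psize l = psize k + c x" "ptn k" using st by auto
    show "conj_ptn (conj_ptn k) = k" by (rule conj_ptn_conj_ptn[OF k(3)])
    show "conj_ptn k \<in> {k. vstrip k (conj_ptn l) \<and> psize (conj_ptn l) = psize k + c x}"
      using k hstrip_conj_ptn[OF ptn_conj_ptn[OF k(3)] ptn_conj_ptn[OF l]] psize_conj_ptn[OF l] psize_conj_ptn[OF k(3)] conj_ptn_conj_ptn[OF l] conj_ptn_conj_ptn[OF k(3)] by simp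
  qed
  thus ?case by (simp add: strip_def)
qed

section \<open>The expansion for odd letters\<close>

lemma chains_map: "chains ev c (map f xs) l = chains (\<lambda>x. ev (f x)) (\<lambda>x. c (f x)) xs l"
  by (induction xs arbitrary: l) auto

lemma chains_size: "chains ev c xs l \<noteq> 0 \<Longrightarrow> psize l = sum_list (map c xs)"
proof (induction xs arbitrary: l)
  case Nil
  thus ?case by (auto simp: psize_def split: if_splits)
next
  case (Cons x xs)
  have "\<exists>k. psize l = psize k + c x \<and> chains ev c xs k \<noteq> 0"
  proof (rule ccontr)
    assume "\<not> ?thesis"
    hence "chains ev c (x # xs) l = 0" by (auto intro!: sum.neutral)
    with Cons.prems show False by simp
  qed
  thus ?case using Cons.IH by auto
qed

text \<open>The multiplicity of the conjugate of \<open>l\<close> in Sym^n of Lambda^m. For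
  \<open>l\<close> of size \<open>m * n\<close>, this many variables hold all parts of the
  conjugate.\<close>

definition pcoef :: "nat \<Rightarrow> nat \<Rightarrow> (nat \<Rightarrow> nat) \<Rightarrow> int" where
  "pcoef m n l = int (hdim m n (mon (m * n) (conj_ptn l)))"

text \<open>\<open>card_B_expansion\<close> concerns the letters 0, ..., N-1 in order. It is renamed
  to the list \<open>xs\<close>, and conjugation turns its horizontal strips into the vertical
  strips of odd letters.\<close>

lemma card_confs_odd_expansion:
  assumes "distinct xs"
  shows "int (card (confs m n (\<lambda>_. False) (content xs c))) = (\<Sum>l\<in>Ptns (m * n). pcoef m n l * int (chains (\<lambda>_. False) c xs l))"
proof -
  let ?N = "length xs" and ?s = "m * n"
  define M where "M = Suc (Max (insert 0 (set xs)))"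
  have M: "z < M" if "z \<in> set xs" for z
    using Max_ge[of "insert 0 (set xs)" z] that unfolding M_def by (meson finite_insert finite_set insertI2 le_imp_less_Suc)
  \<comment> \<open>Reversed, because the head of a list is the last letter. Beyond the list,
    indices are shifted past all letters, which keeps \<open>f\<close> injective on the
    naturals.\<close>
  define f where "f i = (if i < ?N then rev xs ! i else M + i)" for i
  have fm: "f i \<in> set xs" if "i < ?N" for i using that unfolding f_def by (metis length_rev nth_mem set_rev)
  have inj: "inj f"
  proof (rule injI)
    fix i j assume e: "f i = f j"
    show "i = j"
    proof (cases "i < ?N"; cases "j < ?N")
      assume "i < ?N" "j < ?N"
      thus ?thesis using e assms nth_eq_iff_index_eq[of "rev xs" i j] by (simp add: f_def)
    next
      assume "i < ?N" "\<not> j < ?N"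
      thus ?thesis using e M[OF fm[of i]] by (simp add: f_def)
    next
      assume "\<not> i < ?N" "j < ?N"
      thus ?thesis using e M[OF fm[of j]] by (simp add: f_def)
    qed (use e in \<open>simp add: f_def\<close>)
  qed
  have revxs: "xs = map f (rev [0..<?N])"
  proof -
    have "rev xs = map f [0..<?N]" by (rule nth_equalityI) (auto simp: f_def)
    thus ?thesis by (metis rev_map rev_rev_ident)
  qed
  let ?b = "mon ?N (\<lambda>i. c (f i))"
  have "image_mset f ?b = content xs c"
  proof -
    have "image_mset f ?b = (\<Sum>i<?N. replicate_mset (c (f i)) (f i))"
    proof -
      have "image_mset f (mon M g) = (\<Sum>i<M. replicate_mset (g i) (f i))" for M g
        unfolding mon_def by (induction M) auto
      thus ?thesis .
    qed
    also have "\<dots> = content xs c"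
    proof -
      have "set xs = f ` {..<?N}" by (subst revxs) auto
      thus ?thesis unfolding content_def using inj by (simp add: sum.reindex inj_on_def)
    qed
    finally show ?thesis .
  qed
  hence cards: "card (confs m n (\<lambda>_. False) (content xs c)) = card (B m n ?b)"
    using card_B_image[OF inj, of m n ?b] by (simp add: card_confs_odd)
  have chb: "chains (\<lambda>_. True) (count ?b) (rev [0..<?N]) l = chains (\<lambda>_. True) c xs l" if "ptn l" for l
  proof -
    have "chains (\<lambda>_. True) c xs l = chains (\<lambda>_. True) (\<lambda>i. c (f i)) (rev [0..<?N]) l"
      by (subst revxs, subst chains_map) simp
    also have "\<dots> = chains (\<lambda>_. True) (count ?b) (rev [0..<?N]) l"
      by (rule chains_cong[OF that]) (auto simp: count_mon)
    finally show ?thesis by simp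
  qed
  have chs: "psize l = size ?b" if "chains (\<lambda>_. True) c xs l \<noteq> 0" for l
  proof -
    from chains_size[OF that] have "psize l = sum_list (map c xs)" .
    also have "\<dots> = (\<Sum>i<?N. c (f i))"
      by (subst revxs) (simp add: rev_map[symmetric] comp_def interv_sum_list_conv_sum_set_nat atLeast0LessThan)
    finally show ?thesis by (simp add: size_mon)
  qed
  show ?thesis
  proof (cases "size ?b = ?s")
    case True
    have "card (B m n ?b) = (\<Sum>l\<in>Pt ?N ?s. chains (\<lambda>_. True) c xs l * hdim m n (mon ?N l))"
      unfolding card_B_expansion[OF set_mon] True by (intro sum.cong refl) (simp add: chb Pt_def)
    also have "\<dots> = (\<Sum>l\<in>Pt ?N ?s. chains (\<lambda>_. True) c xs l * hdim m n (mon ?s l))"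
    proof (intro sum.cong refl)
      fix l assume "l \<in> Pt ?N ?s"
      hence "mon ?N l = mon ?s l" using ptn_psize_bound[of l]
        by (intro multiset_eqI) (auto simp: count_mon Pt_def)
      thus "chains (\<lambda>_. True) c xs l * hdim m n (mon ?N l) = chains (\<lambda>_. True) c xs l * hdim m n (mon ?s l)" by simp
    qed
    also have "\<dots> = (\<Sum>l\<in>Ptns ?s. chains (\<lambda>_. True) c xs l * hdim m n (mon ?s l))"
    proof (rule sum.mono_neutral_left)
      show "\<forall>l\<in>Ptns ?s - Pt ?N ?s. chains (\<lambda>_. True) c xs l * hdim m n (mon ?s l) = 0"
      proof
        fix l assume l: "l \<in> Ptns ?s - Pt ?N ?s"
        have "chains (\<lambda>_. True) c xs l = 0"
        proof (rule ccontr)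
          assume "chains (\<lambda>_. True) c xs l \<noteq> 0"
          hence "\<forall>i\<ge>?N. l i = 0" using chains_supp by blast
          thus False using l by (auto simp: Ptns_def Pt_def)
        qed
        thus "chains (\<lambda>_. True) c xs l * hdim m n (mon ?s l) = 0" by simp
      qed
    qed (simp, auto simp: Ptns_def Pt_def)
    also have "\<dots> = (\<Sum>l\<in>Ptns ?s. chains (\<lambda>_. False) c xs l * hdim m n (mon ?s (conj_ptn l)))"
      by (rule sum.reindex_bij_witness[of _ conj_ptn conj_ptn]) (auto simp: Ptns_def ptn_conj_ptn conj_ptn_conj_ptn psize_conj_ptn chains_conj_ptn)
    finally show ?thesis unfolding cards pcoef_def by (simp add: mult.commute)
  next
    \<comment> \<open>For a content of the wrong size there are neither configurations nor
      chains.\<close>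
    case False
    hence "B m n ?b = {}" using size_B by auto
    moreover have "chains (\<lambda>_. False) c xs l = 0" if l: "l \<in> Ptns ?s" for l
    proof -
      have "ptn l" "psize (conj_ptn l) = ?s" using l psize_conj_ptn by (auto simp: Ptns_def)
      hence "chains (\<lambda>_. True) c xs (conj_ptn l) = 0" using chs[of "conj_ptn l"] False by auto
      thus ?thesis using chains_conj_ptn[OF ptn_conj_ptn[OF \<open>ptn l\<close>], of c xs] conj_ptn_conj_ptn[OF \<open>ptn l\<close>] by simp
    qed
    ultimately show ?thesis unfolding cards by simp
  qed
qed

theorem card_confs_expansion:
  "distinct xs \<Longrightarrow> int (card (confs m n ev (content xs c))) = (\<Sum>l\<in>Ptns (m * n). pcoef m n l * int (chains ev c xs l))"
  by (rule super_transfer[OF card_confs_odd_expansion])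

text \<open>The conjugate is shifted by the weight of the wedge of e_0, ..., e_(m-1), so
  \<open>dim_hw_mono\<close> applies once both weights are viewed in \<open>m * n + m\<close>
  variables.\<close>

theorem pcoef_mono:
  assumes l: "ptn l" "psize l = m * n"
    and l': "\<And>i. conj_ptn l' i = conj_ptn l i + (if i < m then 1 else 0)"
  shows "pcoef m n l \<le> pcoef m (Suc n) l'"
proof -
  let ?b = "mon (m * n) (conj_ptn l)" and ?b' = "mon (m * Suc n) (conj_ptn l')"
  let ?N = "m * n + m"
  have z: "conj_ptn l i = 0" if "m * n \<le> i" for i
    using ptn_psize_bound[OF ptn_conj_ptn[OF l(1)]] psize_conj_ptn[OF l(1)] l(2) that by simp
  have "?b' = ?b + mset_set {..<m}"
    by (rule multiset_eqI) (auto simp: count_mon l' z count_mset_set')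
  moreover have "set_mset ?b \<subseteq> {..<?N}" using set_mon[of "m * n" "conj_ptn l"] by auto
  moreover have "set_mset ?b' \<subseteq> {..<?N}" using set_mon[of "m * Suc n" "conj_ptn l'"] by (auto simp: algebra_simps)
  ultimately show ?thesis
    using dim_hw_mono[of ?N m n ?b] hdim_eq[of ?b ?N] hdim_eq[of ?b' ?N] by (simp only: pcoef_def of_nat_le_iff)
qed

section \<open>Tableaux and plethysm\<close>

definition mset_of :: "monomial \<Rightarrow> nat multiset" where "mset_of a = Abs_multiset (lk a)"

lemma count_ms [simp]: "count (mset_of a) = lk a"
  unfolding mset_of_def by (rule Abs_multiset_inverse) (simp add: finite_lookup)

lemma ms_eq_iff: "mset_of a = mset_of b \<longleftrightarrow> a = b"
  by (metis count_ms poly_mapping_eq_iff)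

lemma bij_ms: "bij mset_of"
proof (rule bijI)
  show "inj mset_of" by (rule injI) (simp add: ms_eq_iff)
  have "\<exists>b. a = mset_of b" for a
  proof
    have "{x. count a x \<noteq> 0} = set_mset a" by (auto simp: count_eq_zero_iff)
    thus "a = mset_of (Abs_poly_mapping (count a))"
      by (intro multiset_eqI) (simp add: lookup_Abs_poly_mapping)
  qed
  thus "surj mset_of" by blast
qed

lemma set_ms: "set_mset (mset_of a) = Poly_Mapping.keys a"
  by (auto simp: in_keys_iff count_greater_zero_iff[symmetric] simp del: count_greater_zero_iff)

lemma ms_bound: "\<exists>N. set_mset (mset_of a) \<subseteq> {..<N}"
  using finite_nat_set_iff_bounded[of "set_mset (mset_of a)"] by (auto simp: subset_iff)

section \<open>Semistandard tableaux as chains of horizontal strips\<close>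

definition SST :: "(nat \<Rightarrow> nat) \<Rightarrow> nat \<Rightarrow> (nat \<Rightarrow> nat) \<Rightarrow> (nat \<Rightarrow> nat \<Rightarrow> nat) set" where
  "SST l N c = {T. (\<forall>i j. \<not> j < l i \<longrightarrow> T i j = 0) \<and> (\<forall>i j. Suc j < l i \<longrightarrow> T i j \<le> T i (Suc j)) \<and>
     (\<forall>i j. j < l (Suc i) \<longrightarrow> T i j < T (Suc i) j) \<and> (\<forall>i j. j < l i \<longrightarrow> T i j < N) \<and>
     (\<forall>k<N. card {(i, j). j < l i \<and> T i j = k} = c k)}"

lemma SST_row_mono:
  assumes "T \<in> SST l N c" "j \<le> j'" "j' < l i"
  shows "T i j \<le> T i j'"
  using assms(2,3)
proof (induction j' rule: dec_induct)
  case (step k)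
  have "T i k \<le> T i (Suc k)" using assms(1) step.prems unfolding SST_def by blast
  thus ?case using step by simp
qed simp

lemma finite_cells: "ptn l \<Longrightarrow> finite {(i, j). j < l i}"
proof -
  assume "ptn l"
  moreover have "{(i, j). j < l i} = (SIGMA i:{i. l i \<noteq> 0}. {..<l i})" by auto
  ultimately show ?thesis by (simp add: ptn_def)
qed

text \<open>Entries below N fill an initial segment of each row, whose lengths form the shape
  \<open>kT T\<close>; strict columns make the boxes with entry N a horizontal strip. The inverse
  fills such a strip with N.\<close>

lemma SST_Suc_bij:
  fixes c :: "nat \<Rightarrow> nat" and N :: nat
  assumes l: "ptn l"
  defines "K \<equiv> {k. hstrip k l \<and> psize l = psize k + c N}"
  defines "kT \<equiv> \<lambda>T i. card {j. j < l i \<and> T i j < N}"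
  shows "bij_betw (\<lambda>T. (kT T, \<lambda>i j. if j < kT T i then T i j else 0)) (SST l (Suc N) c) (SIGMA k:K. SST k N c)"
proof -
  let ?G = "\<lambda>(k, T) i j. if j < k i then T i j else if j < l i then N else (0::nat)"
  have Kp: "ptn k" if "k \<in> K" for k
    using that strip_ptn[of True k l] l by (simp add: K_def strip_def)
  have kT: "j < kT T i \<longleftrightarrow> j < l i \<and> T i j < N" if T: "T \<in> SST l (Suc N) c" for T i j
  proof -
    let ?S = "{j. j < l i \<and> T i j < N}"
    have dc: "j' \<in> ?S" if "j \<in> ?S" "j' \<le> j" for j j'
      using that SST_row_mono[OF T that(2), of i] by auto
    have fin: "finite ?S" by simp
    have "?S = {..<card ?S}"
    proof (cases "?S = {}")
      case False
      have "?S = {..Max ?S}" using dc[OF Max_in[OF fin False]] Max_ge[OF fin] by blast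
      thus ?thesis by (metis card_atMost lessThan_Suc_atMost)
    next
      case True
      thus ?thesis by (simp only: card.empty lessThan_0)
    qed
    thus ?thesis unfolding kT_def by blast
  qed
  show ?thesis
  proof (rule bij_betw_byWitness[where f' = ?G])
    show "\<forall>T\<in>SST l (Suc N) c. ?G (kT T, \<lambda>i j. if j < kT T i then T i j else 0) = T"
    proof (intro ballI ext)
      fix T i j assume T: "T \<in> SST l (Suc N) c"
      have "T i j < Suc N" if "j < l i" using T that by (auto simp: SST_def)
      moreover have "T i j = 0" if "\<not> j < l i" using T that by (auto simp: SST_def)
      ultimately show "?G (kT T, \<lambda>i j. if j < kT T i then T i j else 0) i j = T i j"
        using kT[OF T, of j i] by auto
    qed
    have GT: "kT (?G (k, T)) = k" if k: "k \<in> K" and T: "T \<in> SST k N c" for k T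
    proof
      fix i
      have "k i \<le> l i" using k by (simp add: K_def hstrip_def)
      hence "{j. j < l i \<and> ?G (k, T) i j < N} = {..<k i}" using T by (auto simp: SST_def)
      thus "kT (?G (k, T)) i = k i" by (simp add: kT_def)
    qed
    show "\<forall>s\<in>(SIGMA k:K. SST k N c). (kT (?G s), \<lambda>i j. if j < kT (?G s) i then ?G s i j else 0) = s"
    proof
      fix s assume "s \<in> (SIGMA k:K. SST k N c)"
      then obtain k T where s: "s = (k, T)" and k: "k \<in> K" and T: "T \<in> SST k N c" by blast
      have "(\<lambda>i j. if j < k i then ?G (k, T) i j else 0) = T"
        using T by (auto simp: SST_def fun_eq_iff)
      thus "(kT (?G s), \<lambda>i j. if j < kT (?G s) i then ?G s i j else 0) = s"
        unfolding s GT[OF k T] by blast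
    qed
    show "(\<lambda>T. (kT T, \<lambda>i j. if j < kT T i then T i j else 0)) ` SST l (Suc N) c \<subseteq> (SIGMA k:K. SST k N c)"
    proof (rule image_subsetI)
      fix T assume T: "T \<in> SST l (Suc N) c"
      note k = kT[OF T]
      have "hstrip (kT T) l" unfolding hstrip_def
      proof (intro allI conjI)
        fix i
        show "kT T i \<le> l i" using k[of "l i" i] by (meson not_less less_irrefl)
        have "j < kT T i" if "j < l (Suc i)" for j
        proof -
          have "T i j < T (Suc i) j" "T (Suc i) j < Suc N" using T that by (auto simp: SST_def)
          moreover have "j < l i" using that ptn_mono[OF l, of i "Suc i"] by simp
          ultimately show ?thesis using k[of j i] by simp
        qed
        thus "l (Suc i) \<le> kT T i" by (meson not_less less_irrefl)
      qed
      hence kp: "ptn (kT T)" and hstrip: "hstrip (kT T) l" using strip_ptn[of True "kT T" l] l by (auto simp: strip_def)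
      have "{(i, j). j < l i} = {(i, j). j < kT T i} \<union> {(i, j). j < l i \<and> T i j = N}"
        using T k by (auto simp: SST_def less_Suc_eq)
      moreover have "{(i, j). j < kT T i} \<inter> {(i, j). j < l i \<and> T i j = N} = {}" using k by auto
      moreover have "finite {(i, j). j < l i \<and> T i j = N}"
        by (rule finite_subset[OF _ finite_cells[OF l]]) auto
      ultimately have "psize l = psize (kT T) + card {(i, j). j < l i \<and> T i j = N}"
        unfolding psize_card[OF l] psize_card[OF kp] using finite_cells[OF kp] by (simp add: card_Un_disjoint)
      hence "kT T \<in> K" using T hstrip by (auto simp: K_def SST_def)
      moreover have "(\<lambda>i j. if j < kT T i then T i j else 0) \<in> SST (kT T) N c"
        unfolding SST_def
      proof (rule CollectI, intro conjI allI impI)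
        fix i j assume "Suc j < kT T i"
        thus "(if j < kT T i then T i j else 0) \<le> (if Suc j < kT T i then T i (Suc j) else 0)"
          using T k by (auto simp: SST_def)
      next
        fix i j assume j: "j < kT T (Suc i)"
        moreover have "j < kT T i" using j ptn_mono[OF kp, of i "Suc i"] by simp
        ultimately show "(if j < kT T i then T i j else 0) < (if j < kT T (Suc i) then T (Suc i) j else 0)"
          using T k by (auto simp: SST_def)
      next
        fix kk assume kk: "kk < N"
        have "{(i, j). j < kT T i \<and> (if j < kT T i then T i j else 0) = kk} = {(i, j). j < l i \<and> T i j = kk}"
          using k kk by auto
        thus "card {(i, j). j < kT T i \<and> (if j < kT T i then T i j else 0) = kk} = c kk"
          using T kk by (simp add: SST_def)
      qed (use k in auto)
      ultimately show "(kT T, \<lambda>i j. if j < kT T i then T i j else 0) \<in> (SIGMA k:K. SST k N c)" by blast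
    qed
    show "?G ` (SIGMA k:K. SST k N c) \<subseteq> SST l (Suc N) c"
    proof (rule image_subsetI)
      fix s assume "s \<in> (SIGMA k:K. SST k N c)"
      then obtain k T where s: "s = (k, T)" and k: "k \<in> K" and T: "T \<in> SST k N c" by blast
      note kp = Kp[OF k]
      have kl: "k i \<le> l i" "l (Suc i) \<le> k i" for i using k by (auto simp: K_def hstrip_def)
      have TN: "T i j < N" if "j < k i" for i j using T that by (auto simp: SST_def)
      show "?G s \<in> SST l (Suc N) c"
        unfolding SST_def s
      proof (rule CollectI, intro conjI allI impI)
        fix i j assume "\<not> j < l i"
        thus "?G (k, T) i j = 0" using kl(1)[of i] by simp
      next
        fix i j assume "Suc j < l i"
        thus "?G (k, T) i j \<le> ?G (k, T) i (Suc j)"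
          using T less_imp_le[OF TN, of j i] by (auto simp: SST_def)
      next
        fix i j assume j: "j < l (Suc i)"
        hence "j < k i" using kl(2)[of i] by simp
        thus "?G (k, T) i j < ?G (k, T) (Suc i) j"
          using T TN[of j i] j by (auto simp: SST_def)
      next
        fix i j assume "j < l i"
        thus "?G (k, T) i j < Suc N" using TN[of j i] by auto
      next
        fix kk assume kk: "kk < Suc N"
        show "card {(i, j). j < l i \<and> ?G (k, T) i j = kk} = c kk"
        proof (cases "kk = N")
          case True
          have "{(i, j). j < l i \<and> ?G (k, T) i j = kk} = {(i, j). j < l i} - {(i, j). j < k i}"
            using TN kl(1) True by (auto simp: less_le_trans)
          moreover have "{(i, j). j < k i} \<subseteq> {(i, j). j < l i}" using kl(1) by (auto intro: less_le_trans)
          ultimately have "card {(i, j). j < l i \<and> ?G (k, T) i j = kk} = psize l - psize k"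
            using finite_cells[OF kp] by (simp add: psize_card[OF l] psize_card[OF kp] card_Diff_subset)
          thus ?thesis using k True by (simp add: K_def)
        next
          case False
          hence "{(i, j). j < l i \<and> ?G (k, T) i j = kk} = {(i, j). j < k i \<and> T i j = kk}"
            using kl(1) by (auto intro: less_le_trans)
          thus ?thesis using T kk False by (simp add: SST_def)
        qed
      qed
    qed
  qed
qed

lemma card_SST: "ptn l \<Longrightarrow> finite (SST l N c) \<and> card (SST l N c) = chains (\<lambda>_. True) c (rev [0..<N]) l"
proof (induction N arbitrary: l)
  case 0
  show ?case
  proof (cases "l = (\<lambda>_. 0)")
    case True
    hence "SST l 0 c = {\<lambda>_ _. 0}" by (auto simp: SST_def)
    thus ?thesis using True by simp
  next
    case False
    hence "SST l 0 c = {}" by (auto simp: SST_def fun_eq_iff)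
    thus ?thesis using False by simp
  qed
next
  case (Suc N)
  let ?K = "{k. hstrip k l \<and> psize l = psize k + c N}"
  have Kp: "ptn k" if "k \<in> ?K" for k
    using that strip_ptn[of True k l] Suc.prems by (simp add: strip_def)
  have finK: "finite ?K" using finite_strip[OF Suc.prems, of True] by (simp add: strip_def)
  have IH: "finite (SST k N c)" "card (SST k N c) = chains (\<lambda>_. True) c (rev [0..<N]) k" if "k \<in> ?K" for k
    using Suc.IH[OF Kp[OF that]] by auto
  note bij = SST_Suc_bij[OF Suc.prems, where c = c and N = N]
  have "finite (SIGMA k:?K. SST k N c)" using finK IH by (intro finite_SigmaI) auto
  hence fin: "finite (SST l (Suc N) c)" using bij_betw_finite[OF bij] by blast
  have "card (SST l (Suc N) c) = card (SIGMA k:?K. SST k N c)" by (rule bij_betw_same_card[OF bij])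
  also have "\<dots> = (\<Sum>k\<in>?K. chains (\<lambda>_. True) c (rev [0..<N]) k)"
    using finK IH by (subst card_SigmaI) auto
  finally show ?case using fin by (simp add: strip_def)
qed

definition pf :: "nat list \<Rightarrow> nat \<Rightarrow> nat" where
  "pf lam i = (if i < length lam then lam ! i else 0)"

lemma ptn_pf: "sorted_wrt (\<ge>) lam \<Longrightarrow> ptn (pf lam)"
proof -
  assume s: "sorted_wrt (\<ge>) lam"
  have "{i. pf lam i \<noteq> 0} \<subseteq> {..<length lam}" by (auto simp: pf_def)
  moreover have "pf lam (Suc i) \<le> pf lam i" for i
    using s by (auto simp: pf_def sorted_wrt_iff_nth_less)
  ultimately show ?thesis by (auto simp: ptn_def intro: finite_subset)
qed

lemma psize_pf: "psize (pf lam) = sum_list lam"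
proof -
  have "psize (pf lam) = (\<Sum>i<length lam. pf lam i)" by (rule psize_eq) (simp add: pf_def)
  thus ?thesis by (simp add: pf_def sum_list_sum_nth atLeast0LessThan)
qed

text \<open>\<open>schur\<close> puts no bound on the entries, but the prescribed content
  does.\<close>

lemma schur_eq_chains:
  assumes s: "sorted_wrt (\<ge>) lam" and b: "set_mset (mset_of b) \<subseteq> {..<N}"
  shows "schur lam b = int (chains (\<lambda>_. True) (count (mset_of b)) (rev [0..<N]) (pf lam))"
proof -
  have cells: "cells lam = {(i, j). j < pf lam i}" by (auto simp: cells_def pf_def split: if_splits)
  have fin: "finite (cells lam)" unfolding cells by (rule finite_cells[OF ptn_pf[OF s]])
  have lkT: "lk (tableau_monomial lam T) k = card {(i, j). j < pf lam i \<and> T i j = k}" for T k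
  proof -
    have "lk (tableau_monomial lam T) k = (\<Sum>(i, j)\<in>cells lam. if T i j = k then 1 else 0)"
      unfolding tableau_monomial_def lookup_sum by (intro sum.cong refl) (auto simp: lookup_single when_def)
    also have "\<dots> = card {s\<in>cells lam. T (fst s) (snd s) = k}"
      using fin by (simp add: sum.If_cases case_prod_beta Int_def)
    also have "{s\<in>cells lam. T (fst s) (snd s) = k} = {(i, j). j < pf lam i \<and> T i j = k}"
      by (auto simp: cells)
    finally show ?thesis .
  qed
  have "{T. semistandard lam T \<and> tableau_monomial lam T = b} = SST (pf lam) N (lk b)"
  proof (intro equalityI subsetI)
    fix T assume "T \<in> {T. semistandard lam T \<and> tableau_monomial lam T = b}"
    hence T: "semistandard lam T" "tableau_monomial lam T = b" by auto
    have "T i j < N" if j: "j < pf lam i" for i j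
    proof -
      have "finite {(i', j'). j' < pf lam i' \<and> T i' j' = T i j}"
        by (rule finite_subset[OF _ fin]) (auto simp: cells)
      hence "lk b (T i j) \<noteq> 0" unfolding T(2)[symmetric] lkT using j by (auto simp: card_eq_0_iff)
      hence "T i j \<in> Poly_Mapping.keys b" by (simp add: in_keys_iff)
      thus ?thesis using b by (auto simp: set_ms)
    qed
    moreover have "card {(i, j). j < pf lam i \<and> T i j = k} = lk b k" for k
      using lkT[of T k] T(2) by simp
    ultimately show "T \<in> SST (pf lam) N (lk b)"
      using T(1) by (auto simp: semistandard_def cells SST_def)
  next
    fix T assume T: "T \<in> SST (pf lam) N (lk b)"
    have "tableau_monomial lam T = b"
    proof (rule poly_mapping_eqI)
      fix k
      show "lk (tableau_monomial lam T) k = lk b k"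
      proof (cases "k < N")
        case True
        thus ?thesis using T unfolding lkT by (simp add: SST_def)
      next
        case False
        hence e: "{(i, j). j < pf lam i \<and> T i j = k} = {}" using T by (auto simp: SST_def)
        have "k \<notin> Poly_Mapping.keys b" using False b by (auto simp: set_ms)
        thus ?thesis unfolding lkT e by (simp add: in_keys_iff)
      qed
    qed
    thus "T \<in> {T. semistandard lam T \<and> tableau_monomial lam T = b}"
      using T by (auto simp: semistandard_def cells SST_def)
  qed
  thus ?thesis using card_SST[OF ptn_pf[OF s], of N "lk b"] by (simp add: schur_def)
qed

section \<open>Rows, columns, and plethysm as a count of configurations\<close>

definition row_shape :: "nat \<Rightarrow> nat \<Rightarrow> nat" where "row_shape n i = (if i = 0 then n else 0)"

lemma psize_row: "psize (row_shape n) = n"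
  using psize_eq[of 1 "row_shape n"] by (simp add: row_shape_def)

lemma ptn_row: "ptn (row_shape n)"
proof -
  have "{i. row_shape n i \<noteq> 0} \<subseteq> {0}" by (auto simp: row_shape_def)
  thus ?thesis by (auto simp: ptn_def row_shape_def intro: finite_subset)
qed

lemma strip_row: "strip e k (row_shape n) \<longleftrightarrow> (\<exists>k0\<le>n. k = row_shape k0 \<and> (e \<or> n \<le> Suc k0))"
proof
  assume s: "strip e k (row_shape n)"
  have "k i = 0" if "i \<noteq> 0" for i using strip_le[OF s, of i] that by (simp add: row_shape_def)
  hence "k = row_shape (k 0)" by (auto simp: row_shape_def fun_eq_iff)
  moreover have "k 0 \<le> n" using strip_le[OF s, of 0] by (simp add: row_shape_def)
  moreover have "e \<or> n \<le> Suc (k 0)" using s by (auto simp: strip_def vstrip_def row_shape_def split: if_splits)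
  ultimately show "\<exists>k0\<le>n. k = row_shape k0 \<and> (e \<or> n \<le> Suc k0)" by blast
next
  assume "\<exists>k0\<le>n. k = row_shape k0 \<and> (e \<or> n \<le> Suc k0)"
  thus "strip e k (row_shape n)" by (auto simp: strip_def hstrip_def vstrip_def row_shape_def)
qed

lemma row_eq_iff: "row_shape a = row_shape b \<longleftrightarrow> a = b"
  by (metis row_shape_def)

text \<open>Inside one row, horizontal strips produce \<open>h_n\<close>; vertical strips have at
  most one box there and produce \<open>e_n\<close>.\<close>

lemma chains_row:
  "chains (\<lambda>_. e) c xs (row_shape n) = (if sum_list (map c xs) = n \<and> (e \<or> (\<forall>x\<in>set xs. c x \<le> 1)) then 1 else 0)"
proof (induction xs arbitrary: n)
  case Nil
  have "row_shape n = (\<lambda>_. 0) \<longleftrightarrow> n = 0" by (auto simp: row_shape_def fun_eq_iff)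
  thus ?case by auto
next
  case (Cons x xs)
  have "{k. strip e k (row_shape n) \<and> psize (row_shape n) = psize k + c x} = (if c x \<le> n \<and> (e \<or> c x \<le> 1) then {row_shape (n - c x)} else {})"
    by (auto simp: strip_row psize_row row_eq_iff)
  thus ?case using Cons.IH by (auto split: if_splits)
qed

lemma size_ms_eq: "set_mset b \<subseteq> {..<N} \<Longrightarrow> sum_list (map (count b) (rev [0..<N])) = size b"
  using size_mon[of N "count b"] mon_count[of b N]
  by (simp add: rev_map[symmetric] interv_sum_list_conv_sum_set_nat atLeast0LessThan)

lemma schur_row_col:
  assumes lam: "lam = (if e then [n] else replicate n 1)"
  shows "schur lam b = (if size (mset_of b) = n \<and> (e \<or> (\<forall>i. lk b i \<le> 1)) then 1 else 0)"
proof -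
  obtain N where N: "set_mset (mset_of b) \<subseteq> {..<N}" using ms_bound by blast
  have s: "sorted_wrt (\<ge>) lam" by (auto simp: lam sorted_wrt_iff_nth_less)
  have z: "(\<forall>i\<in>set (rev [0..<N]). lk b i \<le> 1) \<longleftrightarrow> (\<forall>i. lk b i \<le> 1)"
  proof -
    have "lk b i = 0" if "\<not> i < N" for i using that N by (auto simp: set_ms in_keys_iff)
    hence "lk b i \<le> 1" if "\<not> i < N" for i using that by simp
    thus ?thesis by (metis atLeastLessThan_iff set_rev set_upt zero_le)
  qed
  have "chains (\<lambda>_. True) (lk b) (rev [0..<N]) (pf lam) = chains (\<lambda>_. e) (lk b) (rev [0..<N]) (row_shape n)"
  proof (cases e)
    case True
    moreover have "pf [n] = row_shape n" by (auto simp: pf_def row_shape_def fun_eq_iff)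
    ultimately show ?thesis by (simp add: lam)
  next
    \<comment> \<open>A column is the conjugate of a row, so its horizontal strips become vertical
      strips of the row.\<close>
    case False
    have "{j. i < row_shape n j} = (if i < n then {0} else {})" for i by (auto simp: row_shape_def)
    hence "pf lam = conj_ptn (row_shape n)" using False by (auto simp: lam pf_def conj_ptn_def fun_eq_iff)
    thus ?thesis using chains_conj_ptn[OF ptn_conj_ptn[OF ptn_row[of n]], of "lk b" "rev [0..<N]"] conj_ptn_conj_ptn[OF ptn_row[of n]] False by simp
  qed
  thus ?thesis unfolding schur_eq_chains[OF s N] chains_row using size_ms_eq[OF N] z by simp
qed

text \<open>Every monomial of degree m has coefficient 1, so any injective coding of monomials by
  naturals gives an enumeration. Its existence makes the \<open>SOME\<close> in
  \<open>plethysm\<close> meaningful.\<close>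

lemma ex_enumeration: "\<exists>I \<theta>. enumerates I \<theta> (schur [m])"
proof -
  let ?A = "{a. size (mset_of a) = m}"
  define enc where "enc a = to_nat (sorted_list_of_multiset (mset_of a))" for a
  have inj: "inj enc"
  proof (rule injI)
    fix a b assume "enc a = enc b"
    hence "mset (sorted_list_of_multiset (mset_of a)) = mset (sorted_list_of_multiset (mset_of b))" by (simp add: enc_def)
    thus "a = b" by (simp add: ms_eq_iff)
  qed
  let ?I = "enc ` ?A" and ?t = "inv_into ?A enc"
  have inj': "inj_on enc ?A" using inj by (auto simp: inj_on_def inj_def)
  have "{i \<in> ?I. ?t i = a} = (if a \<in> ?A then {enc a} else {})" for a
    using inv_into_f_f[OF inj'] by auto
  hence "enumerates ?I ?t (schur [m])"
    unfolding enumerates_def using schur_row_col[of "[m]" True m] by simp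
  thus ?thesis by blast
qed

lemma sum_mset_count:
  assumes "finite A" "set_mset D \<subseteq> A"
  shows "(\<Sum>i\<in>#D. f i) = (\<Sum>i\<in>A. count D i * (f i :: nat))"
  using assms(2)
proof (induction D)
  case (add x D)
  have "(\<Sum>i\<in>A. count (add_mset x D) i * f i) = (\<Sum>i\<in>A. count D i * f i + (if i = x then f i else 0))"
    by (intro sum.cong refl) auto
  also have "\<dots> = (\<Sum>i\<in>A. count D i * f i) + f x" using add.prems assms(1) by (simp add: sum.distrib)
  finally show ?case using add by simp
qed simp

lemma count_Union_image: "count (\<Sum>\<^sub># (image_mset f D)) k = (\<Sum>i\<in>#D. count (f i) k)"
  by (induction D) auto

lemma ms_monomial_subst: "mset_of (monomial_subst \<theta> c) = \<Sum>\<^sub># (image_mset (\<lambda>i. mset_of (\<theta> i)) (mset_of c))"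
proof (rule multiset_eqI)
  fix k
  have "count (\<Sum>\<^sub># (image_mset (\<lambda>i. mset_of (\<theta> i)) (mset_of c))) k = (\<Sum>i\<in>Poly_Mapping.keys c. lk c i * lk (\<theta> i) k)"
    unfolding count_Union_image using sum_mset_count[of "Poly_Mapping.keys c" "mset_of c"] by (simp add: set_ms)
  moreover have "lk (monomial_subst \<theta> c) k = (\<Sum>i\<in>Poly_Mapping.keys c. lk c i * lk (\<theta> i) k)"
    unfolding monomial_subst_def lookup_sum by (intro sum.cong refl) (simp add: map.rep_eq when_def)
  ultimately show "count (mset_of (monomial_subst \<theta> c)) k = count (\<Sum>\<^sub># (image_mset (\<lambda>i. mset_of (\<theta> i)) (mset_of c))) k"
    by simp
qed

text \<open>An enumeration identifies variables with blocks, hence monomials in these variables with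
  multisets of blocks. As all letters are even, a block of size m may be repeated iff m is even,
  which is the difference between \<open>h_n\<close> and \<open>e_n\<close>.\<close>

lemma plethysm_eq_card_confs:
  assumes lam: "lam = (if even m then [n] else replicate n 1)"
  shows "plethysm (schur lam) (schur [m]) b = int (card (confs m n (\<lambda>_. True) (mset_of b)))"
proof -
  obtain I \<theta> where some: "(SOME (I, \<theta>). enumerates I \<theta> (schur [m])) = (I, \<theta>)" by fastforce
  have "case (SOME (I, \<theta>). enumerates I \<theta> (schur [m])) of (I, \<theta>) \<Rightarrow> enumerates I \<theta> (schur [m])"
    by (rule someI_ex[of "\<lambda>(I, \<theta>). enumerates I \<theta> (schur [m])"]) (use ex_enumeration in auto)
  hence en: "enumerates I \<theta> (schur [m])" by (simp add: some)
  define f where "f i = mset_of (\<theta> i)" for i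
  have card1: "card {i\<in>I. f i = mset_of a} = (if size (mset_of a) = m then 1 else 0)" "finite {i\<in>I. f i = mset_of a}" for a
  proof -
    have e: "{i\<in>I. f i = mset_of a} = {i\<in>I. \<theta> i = a}" by (simp add: f_def ms_eq_iff)
    have "int (card {i\<in>I. \<theta> i = a}) = (if size (mset_of a) = m then 1 else 0)" "finite {i\<in>I. \<theta> i = a}"
      using en schur_row_col[of "[m]" True m a] unfolding enumerates_def by simp_all
    thus "card {i\<in>I. f i = mset_of a} = (if size (mset_of a) = m then 1 else 0)" "finite {i\<in>I. f i = mset_of a}"
      unfolding e by (simp_all split: if_splits)
  qed
  have card2: "card {i\<in>I. f i = a} = (if size a = m then 1 else 0)" "finite {i\<in>I. f i = a}" for a
  proof -
    obtain a' where "a = mset_of a'" using bij_ms by (metis bij_pointE)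
    thus "card {i\<in>I. f i = a} = (if size a = m then 1 else 0)" "finite {i\<in>I. f i = a}" using card1[of a'] by auto
  qed
  have inj: "inj_on f I"
  proof (rule inj_onI)
    fix i j assume ij: "i \<in> I" "j \<in> I" "f i = f j"
    have "card {k\<in>I. f k = f i} \<le> 1" using card2(1)[of "f i"] by simp
    thus "i = j" using ij card_le_Suc0_iff_eq[OF card2(2)[of "f i"]] by auto
  qed
  have img: "f ` I = {a. size a = m}"
  proof (intro equalityI subsetI)
    fix a assume "a \<in> f ` I"
    then obtain i where i: "i \<in> I" "a = f i" by auto
    hence "{k\<in>I. f k = a} \<noteq> {}" by auto
    hence "card {k\<in>I. f k = a} \<noteq> 0" using card2(2) by (simp add: card_eq_0_iff)
    thus "a \<in> {a. size a = m}" using card2(1)[of a] by (auto split: if_splits)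
  next
    fix a :: "nat multiset" assume "a \<in> {a. size a = m}"
    hence "{k\<in>I. f k = a} \<noteq> {}" using card2(1)[of a] by force
    thus "a \<in> f ` I" by auto
  qed
  let ?S = "{c. Poly_Mapping.keys c \<subseteq> I \<and> monomial_subst \<theta> c = b \<and> schur lam c \<noteq> 0}"
  have sch: "schur lam c = (if size (mset_of c) = n \<and> (even m \<or> (\<forall>i. lk c i \<le> 1)) then 1 else 0)" for c
    by (rule schur_row_col[OF lam])
  have "plethysm (schur lam) (schur [m]) b = (\<Sum>c\<in>?S. schur lam c)"
    by (simp add: plethysm_def some series_subst_def)
  also have "\<dots> = (\<Sum>c\<in>?S. 1)" by (intro sum.cong refl) (auto simp: sch split: if_splits)
  also have "\<dots> = int (card ?S)" by simp
  also have "card ?S = card (confs m n (\<lambda>_. True) (mset_of b))"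
  proof (rule bij_betw_same_card[of "\<lambda>c. image_mset f (mset_of c)"], rule bij_betw_imageI)
    have cnt: "count (image_mset f D) (f i) = count D i" if "set_mset D \<subseteq> I" "i \<in> I" for D i
      using that
    proof (induction D)
      case (add x D)
      thus ?case using inj by (auto simp: inj_on_def)
    qed simp
    show "inj_on (\<lambda>c. image_mset f (mset_of c)) ?S"
    proof (rule inj_onI)
      fix c c' assume c: "c \<in> ?S" "c' \<in> ?S" "image_mset f (mset_of c) = image_mset f (mset_of c')"
      hence sub: "set_mset (mset_of c) \<subseteq> I" "set_mset (mset_of c') \<subseteq> I" by (auto simp: set_ms)
      have "mset_of c = mset_of c'"
      proof (rule multiset_eqI)
        fix i
        show "count (mset_of c) i = count (mset_of c') i"
        proof (cases "i \<in> I")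
          case True
          thus ?thesis using cnt[OF sub(1) True] cnt[OF sub(2) True] c(3) by metis
        next
          case False
          thus ?thesis using sub by (metis not_in_iff subsetD)
        qed
      qed
      thus "c = c'" by (simp add: ms_eq_iff)
    qed
    have iff: "image_mset f (mset_of c) \<in> confs m n (\<lambda>_. True) (mset_of b) \<longleftrightarrow> c \<in> ?S" if sub: "Poly_Mapping.keys c \<subseteq> I" for c
    proof -
      let ?C = "image_mset f (mset_of c)"
      have sz: "size a = m" if "a \<in># ?C" for a
        using that sub img by (auto simp: set_ms)
      have "(\<forall>a. odd (size a) \<longrightarrow> count ?C a \<le> 1) \<longleftrightarrow> (even m \<or> (\<forall>i. lk c i \<le> 1))"
      proof
        assume a: "\<forall>a. odd (size a) \<longrightarrow> count ?C a \<le> 1"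
        show "even m \<or> (\<forall>i. lk c i \<le> 1)"
        proof (cases "even m")
          case False
          have "lk c i \<le> 1" for i
          proof (cases "i \<in> Poly_Mapping.keys c")
            case True
            hence "i \<in> I" "f i \<in># ?C" using sub by (auto simp: set_ms)
            hence "count ?C (f i) \<le> 1" using a sz[of "f i"] False by auto
            thus ?thesis using cnt[of "mset_of c" i] sub \<open>i \<in> I\<close> by (simp add: set_ms)
          qed (simp add: in_keys_iff)
          thus ?thesis by blast
        qed simp
      next
        assume e: "even m \<or> (\<forall>i. lk c i \<le> 1)"
        show "\<forall>a. odd (size a) \<longrightarrow> count ?C a \<le> 1"
        proof (intro allI impI)
          fix a :: "nat multiset" assume odd: "odd (size a)"
          show "count ?C a \<le> 1"
          proof (cases "a \<in># ?C")
            case True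
            then obtain i where i: "i \<in> Poly_Mapping.keys c" "a = f i" by (auto simp: set_ms)
            have "odd m" using sz[OF True] odd by simp
            hence "lk c i \<le> 1" using e by simp
            thus ?thesis using cnt[of "mset_of c" i] sub i by (auto simp: set_ms)
          next
            case False
            hence "count ?C a = 0" by (simp only: not_in_iff)
            thus ?thesis by simp
          qed
        qed
      qed
      moreover have "\<Sum>\<^sub># ?C = mset_of b \<longleftrightarrow> monomial_subst \<theta> c = b"
        using ms_monomial_subst[of \<theta> c] ms_eq_iff[of "monomial_subst \<theta> c" b] by (simp add: f_def[abs_def])
      ultimately show ?thesis using sz sub by (auto simp: confs_def is_conf_def sch)
    qed
    show "(\<lambda>c. image_mset f (mset_of c)) ` ?S = confs m n (\<lambda>_. True) (mset_of b)"
    proof (intro equalityI subsetI)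
      fix C assume "C \<in> (\<lambda>c. image_mset f (mset_of c)) ` ?S"
      thus "C \<in> confs m n (\<lambda>_. True) (mset_of b)" using iff by auto
    next
      fix C assume C: "C \<in> confs m n (\<lambda>_. True) (mset_of b)"
      hence "set_mset C \<subseteq> f ` I" using img by (auto simp: confs_def is_conf_def)
      define D where "D = image_mset (inv_into I f) C"
      have D: "image_mset f D = C"
      proof -
        have "image_mset (\<lambda>a. f (inv_into I f a)) C = image_mset (\<lambda>a. a) C"
          using \<open>set_mset C \<subseteq> f ` I\<close> by (intro image_mset_cong) (auto intro!: f_inv_into_f)
        thus ?thesis by (simp add: D_def multiset.map_comp o_def)
      qed
      obtain c where c: "D = mset_of c" using bij_ms by (metis bij_pointE)
      have "Poly_Mapping.keys c \<subseteq> I"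
        unfolding set_ms[symmetric] c[symmetric] D_def using \<open>set_mset C \<subseteq> f ` I\<close> by (auto intro!: inv_into_into)
      thus "C \<in> (\<lambda>c. image_mset f (mset_of c)) ` ?S" using iff[of c] C D c by (auto intro!: image_eqI[of _ _ c])
    qed
  qed
  finally show ?thesis .
qed

section \<open>Uniqueness of the Schur expansion\<close>

lemma bij_pf: "bij_betw pf {lam. is_partition_of lam s} (Ptns s)"
proof (rule bij_betw_imageI)
  show "inj_on pf {lam. is_partition_of lam s}"
  proof (rule inj_onI)
    fix a b assume a: "a \<in> {lam. is_partition_of lam s}" and b: "b \<in> {lam. is_partition_of lam s}" and eq: "pf a = pf b"
    have le: "length a \<le> length b" if "is_partition_of a s" "pf a = pf b" for a b
    proof (rule ccontr)
      assume "\<not> length a \<le> length b"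
      hence "pf a (length b) > 0" using that(1) by (auto simp: pf_def is_partition_of_def)
      thus False using that(2) by (simp add: pf_def)
    qed
    have len: "length a = length b" using le[of a b] le[of b a] a b eq by simp
    show "a = b"
    proof (rule nth_equalityI[OF len])
      fix i assume "i < length a"
      thus "a ! i = b ! i" using fun_cong[OF eq, of i] len by (simp add: pf_def)
    qed
  qed
  show "pf ` {lam. is_partition_of lam s} = Ptns s"
  proof (intro equalityI subsetI)
    fix l assume "l \<in> pf ` {lam. is_partition_of lam s}"
    thus "l \<in> Ptns s" by (auto simp: Ptns_def is_partition_of_def ptn_pf psize_pf)
  next
    fix l assume "l \<in> Ptns s"
    hence l: "ptn l" "psize l = s" by (auto simp: Ptns_def)
    \<comment> \<open>The number of nonzero parts of \<open>l\<close> is the first part of its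
      conjugate.\<close>
    let ?lam = "map l [0..<conj_ptn l 0]"
    have pos: "i < conj_ptn l 0 \<longleftrightarrow> 0 < l i" for i by (rule less_conj_ptn_iff[OF l(1)])
    have pfl: "pf ?lam = l" using pos by (auto simp: pf_def fun_eq_iff)
    have "sorted_wrt (\<ge>) ?lam" using ptn_mono[OF l(1)] by (auto simp: sorted_wrt_iff_nth_less)
    moreover have "sum_list ?lam = s" using psize_pf[of ?lam] pfl l(2) by simp
    ultimately have "is_partition_of ?lam s" using pos by (auto simp: is_partition_of_def)
    thus "l \<in> pf ` {lam. is_partition_of lam s}" using pfl by (intro image_eqI[of _ _ ?lam]) auto
  qed
qed

text \<open>Entries below r lie in the first r rows of a tableau. This is the triangularity of the
  Kostka numbers.\<close>

lemma chains_dominance: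
  "chains (\<lambda>_. True) c (rev [0..<N]) l \<noteq> 0 \<Longrightarrow> r \<le> N \<Longrightarrow> (\<Sum>i<r. c i) \<le> (\<Sum>i<r. l i)"
proof (induction N arbitrary: l r)
  case (Suc N)
  have nz: "chains (\<lambda>_. True) c (N # rev [0..<N]) l \<noteq> 0" using Suc.prems(1) by simp
  have "\<exists>k. strip True k l \<and> chains (\<lambda>_. True) c (rev [0..<N]) k \<noteq> 0"
  proof (rule ccontr)
    assume "\<not> ?thesis"
    hence "chains (\<lambda>_. True) c (N # rev [0..<N]) l = 0" by (auto intro!: sum.neutral)
    with nz show False by simp
  qed
  then obtain k where k: "strip True k l" "chains (\<lambda>_. True) c (rev [0..<N]) k \<noteq> 0" by blast
  show ?case
  proof (cases "r \<le> N")
    case True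
    have "(\<Sum>i<r. c i) \<le> (\<Sum>i<r. k i)" by (rule Suc.IH[OF k(2) True])
    also have "\<dots> \<le> (\<Sum>i<r. l i)" by (intro sum_mono strip_le[OF k(1)])
    finally show ?thesis .
  next
    case False
    hence r: "r = Suc N" using Suc.prems(2) by simp
    have "\<And>i. Suc N \<le> i \<Longrightarrow> l i = 0" using chains_supp[OF Suc.prems(1)] by simp
    hence "psize l = (\<Sum>i<Suc N. l i)" by (rule psize_eq)
    moreover have "psize l = sum_list (map c (rev [0..<Suc N]))" by (rule chains_size[OF Suc.prems(1)])
    moreover have "sum_list (map c (rev [0..<Suc N])) = (\<Sum>i<Suc N. c i)"
      by (simp add: rev_map[symmetric] interv_sum_list_conv_sum_set_nat atLeast0LessThan)
    ultimately show ?thesis using r by simp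
  qed
qed simp

text \<open>The shape reached before the last letter N has at most N rows, so the strip of N must be
  the whole row N; the chain is unique by induction.\<close>

lemma chains_diagonal:
  "ptn l \<Longrightarrow> (\<And>i. N \<le> i \<Longrightarrow> l i = 0) \<Longrightarrow> chains (\<lambda>_. True) l (rev [0..<N]) l = 1"
proof (induction N arbitrary: l)
  case 0
  hence "l = (\<lambda>_. 0)" by auto
  thus ?case by simp
next
  case (Suc N)
  define k where "k = l(N := 0)"
  have kz: "k i = 0" if "N \<le> i" for i using that Suc.prems(2)[of i] by (cases "i = N") (auto simp: k_def)
  have kp: "ptn k"
  proof -
    have "{i. k i \<noteq> 0} \<subseteq> {..<N}" using kz by (metis (mono_tags, lifting) lessThan_iff mem_Collect_eq not_le subsetI)
    moreover have "k (Suc i) \<le> k i" for i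
      using Suc.prems(1) kz[of "Suc N"] by (auto simp: k_def ptn_def)
    ultimately show ?thesis by (auto simp: ptn_def intro: finite_subset)
  qed
  have pk: "psize l = psize k + l N"
  proof -
    have "psize l = (\<Sum>i<Suc N. l i)" by (rule psize_eq) (rule Suc.prems(2))
    moreover have "psize k = (\<Sum>i<N. k i)" by (rule psize_eq) (rule kz)
    ultimately show ?thesis by (simp add: k_def)
  qed
  have hstrip: "hstrip k l" unfolding hstrip_def
  proof
    fix i show "k i \<le> l i \<and> l (Suc i) \<le> k i"
      using Suc.prems(1) Suc.prems(2)[of "Suc i"] by (auto simp: k_def ptn_def)
  qed
  have "chains (\<lambda>_. True) l (rev [0..<Suc N]) l = (\<Sum>k' | strip True k' l \<and> psize l = psize k' + l N. chains (\<lambda>_. True) l (rev [0..<N]) k')"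
    by simp
  also have "\<dots> = (\<Sum>k'\<in>{k}. chains (\<lambda>_. True) l (rev [0..<N]) k')"
  proof (rule sum.mono_neutral_right)
    show "finite {k'. strip True k' l \<and> psize l = psize k' + l N}" by (rule finite_strip[OF Suc.prems(1)])
    show "{k} \<subseteq> {k'. strip True k' l \<and> psize l = psize k' + l N}" using hstrip pk by (simp add: strip_def)
    show "\<forall>k'\<in>{k'. strip True k' l \<and> psize l = psize k' + l N} - {k}. chains (\<lambda>_. True) l (rev [0..<N]) k' = 0"
    proof (rule ballI, rule ccontr)
      fix k' assume k': "k' \<in> {k'. strip True k' l \<and> psize l = psize k' + l N} - {k}"
        and nz: "chains (\<lambda>_. True) l (rev [0..<N]) k' \<noteq> 0"
      hence s: "strip True k' l" "psize l = psize k' + l N" "k' \<noteq> k" by auto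
      have "k' N = 0" using chains_supp[OF nz] by simp
      hence "k' i \<le> k i" for i using strip_le[OF s(1), of i] by (auto simp: k_def)
      hence "k' = k" using s(2) pk by (intro psize_mono_eq[OF kp]) auto
      thus False using s(3) by simp
    qed
  qed
  also have "\<dots> = chains (\<lambda>_. True) k (rev [0..<N]) k"
    by (simp, rule chains_cong[OF kp]) (auto simp: k_def)
  also have "\<dots> = 1" by (rule Suc.IH[OF kp kz])
  finally show ?case .
qed

text \<open>The Kostka matrix is unitriangular: at the content \<open>u\<close>, taken maximal in
  the support of \<open>q\<close>, only \<open>l = u\<close> contributes.\<close>

lemma chains_independent:
  fixes q :: "(nat \<Rightarrow> nat) \<Rightarrow> int"
  assumes "\<And>b. set_mset b \<subseteq> {..<s} \<Longrightarrow> (\<Sum>l\<in>Ptns s. q l * int (chains (\<lambda>_. True) (count b) (rev [0..<s]) l)) = 0"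
    and "l \<in> Ptns s"
  shows "q l = 0"
proof (rule ccontr)
  assume "q l \<noteq> 0"
  \<comment> \<open>A numerical function, strictly increasing for dominance among partitions of s,
    that picks a maximal element.\<close>
  define Phi where "Phi l = (\<Sum>r\<le>s. \<Sum>i<r. l i)" for l :: "nat \<Rightarrow> nat"
  let ?A = "{l\<in>Ptns s. q l \<noteq> 0}"
  have A: "finite ?A" "?A \<noteq> {}" using assms(2) \<open>q l \<noteq> 0\<close> by auto
  obtain u where u: "u \<in> ?A" "\<And>w. w \<in> ?A \<Longrightarrow> Phi w \<le> Phi u"
  proof -
    have "Max (Phi ` ?A) \<in> Phi ` ?A" using A by (intro Max_in) auto
    then obtain u where "u \<in> ?A" "Phi u = Max (Phi ` ?A)" by auto
    thus ?thesis using A by (intro that[of u]) auto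
  qed
  have up: "ptn u" "psize u = s" using u(1) by (auto simp: Ptns_def)
  have uz: "u i = 0" if "s \<le> i" for i using ptn_psize_bound[OF up(1)] up(2) that by simp
  have chu: "chains (\<lambda>_. True) (count (mon s u)) (rev [0..<s]) l = chains (\<lambda>_. True) u (rev [0..<s]) l" if "ptn l" for l
    by (rule chains_cong[OF that]) (simp add: count_mon)
  have "0 = (\<Sum>l\<in>Ptns s. q l * int (chains (\<lambda>_. True) (count (mon s u)) (rev [0..<s]) l))"
    using assms(1)[OF set_mon] by simp
  also have "\<dots> = (\<Sum>l\<in>Ptns s. if l = u then q u else 0)"
  proof (intro sum.cong refl)
    fix l assume l: "l \<in> Ptns s"
    hence lp: "ptn l" "psize l = s" by (auto simp: Ptns_def)
    have lz: "l i = 0" if "s \<le> i" for i using ptn_psize_bound[OF lp(1)] lp(2) that by simp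
    show "q l * int (chains (\<lambda>_. True) (count (mon s u)) (rev [0..<s]) l) = (if l = u then q u else 0)"
    proof (cases "l = u")
      case True
      thus ?thesis using chu[OF lp(1)] chains_diagonal[OF up(1) uz] by simp
    next
      case False
      have "q l * int (chains (\<lambda>_. True) u (rev [0..<s]) l) = 0"
      proof (rule ccontr)
        assume nz: "q l * int (chains (\<lambda>_. True) u (rev [0..<s]) l) \<noteq> 0"
        hence lA: "l \<in> ?A" and c: "chains (\<lambda>_. True) u (rev [0..<s]) l \<noteq> 0" using l by auto
        have le: "(\<Sum>i<r. u i) \<le> (\<Sum>i<r. l i)" if "r \<in> {..s}" for r using chains_dominance[OF c] that by simp
        have "Phi u \<le> Phi l" unfolding Phi_def by (rule sum_mono[OF le])
        hence "(\<Sum>r\<le>s. \<Sum>i<r. u i) = (\<Sum>r\<le>s. \<Sum>i<r. l i)" using u(2)[OF lA] by (simp add: Phi_def)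
        hence eq: "(\<Sum>i<r. u i) = (\<Sum>i<r. l i)" if "r \<le> s" for r
          using sum_mono_inv[of "\<lambda>r. \<Sum>i<r. u i" "{..s}" "\<lambda>r. \<Sum>i<r. l i" r] le that by simp
        have "l i = u i" for i
        proof (cases "i < s")
          case True
          thus ?thesis using eq[of i] eq[of "Suc i"] by simp
        next
          case False
          thus ?thesis using lz[of i] uz[of i] by simp
        qed
        thus False using False by auto
      qed
      thus ?thesis using chu[OF lp(1)] False by simp
    qed
  qed
  also have "\<dots> = q u" using u(1) by simp
  finally show False using u(1) by simp
qed

text \<open>\<open>card_confs_expansion\<close> provides a solution and
  \<open>chains_independent\<close> shows that it is the only one, so \<open>THE\<close> denotes it.
  Both parities of m lead to the same \<open>pcoef\<close>.\<close>

theorem plethysm_coeff_eq_pcoef: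
  assumes nu: "nu = (if even m then [n] else replicate n 1)"
    and lam: "is_partition_of lam (m * n)"
  shows "plethysm_coeff nu [m] lam = pcoef m n (pf lam)"
proof -
  let ?s = "m * n"
  define p0 where "p0 = (\<lambda>lam. if is_partition_of lam ?s then pcoef m n (pf lam) else 0)"
  have sum_nu: "sum_list [m] * sum_list nu = ?s" by (simp add: nu sum_list_replicate)
  \<comment> \<open>Partitions as lists are traded for partitions as functions.\<close>
  have conv: "(\<Sum>lam | is_partition_of lam ?s. p lam * schur lam b)
      = (\<Sum>l\<in>Ptns ?s. p (inv_into {lam. is_partition_of lam ?s} pf l) * int (chains (\<lambda>_. True) (count (mset_of b)) (rev [0..<N]) l))"
    if "set_mset (mset_of b) \<subseteq> {..<N}" for p b N
  proof -
    have "(\<Sum>l\<in>Ptns ?s. p (inv_into {lam. is_partition_of lam ?s} pf l) * int (chains (\<lambda>_. True) (count (mset_of b)) (rev [0..<N]) l))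
      = (\<Sum>lam | is_partition_of lam ?s. p (inv_into {lam. is_partition_of lam ?s} pf (pf lam)) * int (chains (\<lambda>_. True) (count (mset_of b)) (rev [0..<N]) (pf lam)))"
      by (rule sum.reindex_bij_betw[OF bij_pf, symmetric])
    also have "\<dots> = (\<Sum>lam | is_partition_of lam ?s. p lam * schur lam b)"
    proof (intro sum.cong refl arg_cong2[of _ _ _ _ "(*)"])
      fix lam assume lam: "lam \<in> {lam. is_partition_of lam ?s}"
      show "p (inv_into {lam. is_partition_of lam ?s} pf (pf lam)) = p lam"
        using inv_into_f_f[OF bij_betw_imp_inj_on[OF bij_pf] lam] by simp
      show "int (chains (\<lambda>_. True) (count (mset_of b)) (rev [0..<N]) (pf lam)) = schur lam b"
        using schur_eq_chains[OF _ that, of lam] lam by (simp add: is_partition_of_def)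
    qed
    finally show ?thesis by simp
  qed
  have p0: "plethysm (schur nu) (schur [m]) b = (\<Sum>lam | is_partition_of lam ?s. p0 lam * schur lam b)" for b
  proof -
    obtain N where N: "set_mset (mset_of b) \<subseteq> {..<N}" using ms_bound by blast
    let ?xs = "rev [0..<N]"
    have "content ?xs (count (mset_of b)) = mset_of b"
      using N by (intro multiset_eqI) (auto simp: count_content set_ms in_keys_iff subset_iff)
    hence "plethysm (schur nu) (schur [m]) b = (\<Sum>l\<in>Ptns ?s. pcoef m n l * int (chains (\<lambda>_. True) (count (mset_of b)) ?xs l))"
      unfolding plethysm_eq_card_confs[OF nu] using card_confs_expansion[of ?xs m n "\<lambda>_. True" "count (mset_of b)"] by simp
    also have "\<dots> = (\<Sum>l\<in>Ptns ?s. p0 (inv_into {lam. is_partition_of lam ?s} pf l) * int (chains (\<lambda>_. True) (count (mset_of b)) ?xs l))"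
    proof (intro sum.cong refl arg_cong2[of _ _ _ _ "(*)"])
      fix l assume "l \<in> Ptns ?s"
      hence l: "l \<in> pf ` {lam. is_partition_of lam ?s}" using bij_pf by (simp add: bij_betw_def)
      show "pcoef m n l = p0 (inv_into {lam. is_partition_of lam ?s} pf l)"
        using inv_into_into[OF l] f_inv_into_f[OF l] by (simp add: p0_def)
    qed
    finally show ?thesis by (simp only: conv[OF N])
  qed
  have uniq: "p = p0" if p: "\<And>b. plethysm (schur nu) (schur [m]) b = (\<Sum>lam | is_partition_of lam ?s. p lam * schur lam b)"
      "\<And>lam. \<not> is_partition_of lam ?s \<Longrightarrow> p lam = 0" for p
  proof
    fix lam
    show "p lam = p0 lam"
    proof (cases "is_partition_of lam ?s")
      case True
      let ?inv = "inv_into {lam. is_partition_of lam ?s} pf"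
      have "p (?inv (pf lam)) - p0 (?inv (pf lam)) = 0"
      proof (rule chains_independent[where q = "\<lambda>l. p (?inv l) - p0 (?inv l)" and s = ?s])
        show "pf lam \<in> Ptns ?s" using bij_betw_apply[OF bij_pf] True by blast
        fix b assume b: "set_mset b \<subseteq> {..<?s}"
        obtain b' where b': "b = mset_of b'" using bij_ms by (metis bij_pointE)
        have "(\<Sum>lam | is_partition_of lam ?s. p lam * schur lam b') = (\<Sum>lam | is_partition_of lam ?s. p0 lam * schur lam b')"
          using p(1)[of b'] p0[of b'] by simp
        thus "(\<Sum>l\<in>Ptns ?s. (p (?inv l) - p0 (?inv l)) * int (chains (\<lambda>_. True) (count b) (rev [0..<?s]) l)) = 0"
          unfolding b' conv[OF b[unfolded b']] by (simp add: left_diff_distrib sum_subtractf)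
      qed
      moreover have "?inv (pf lam) = lam" using inv_into_f_f[OF bij_betw_imp_inj_on[OF bij_pf]] True by simp
      ultimately show ?thesis by simp
    next
      case False
      thus ?thesis using p(2) by (simp add: p0_def)
    qed
  qed
  have "plethysm_coeff nu [m] = p0"
    unfolding plethysm_coeff_def sum_nu
    by (rule the_equality) (use p0 uniq in \<open>auto simp: p0_def\<close>)
  thus ?thesis using lam by (simp add: p0_def)
qed

section \<open>The two inequalities\<close>

lemma conj_ptn_pf: "conj_ptn (pf lam) i = length (filter (\<lambda>k. i < k) lam)"
proof -
  have "{j. i < pf lam j} = {j. j < length lam \<and> i < lam ! j}" by (auto simp: pf_def)
  thus ?thesis by (simp add: conj_ptn_def length_filter_conv_card)
qed

theorem theorem1p1p1:
  fixes m n q :: nat and lam lam' :: "nat list"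
  assumes "m > 0" and "n > 0"
    and "is_partition_of lam (m * n)"
    and "q = (LEAST k. 0 \<le> part lam (k + 1) \<and> part lam (k + 1) \<le> m)"
    and "lam' = (if q \<noteq> 0 then take q lam @ [m] @ drop q lam else m # lam)"
  shows "(even m \<longrightarrow> plethysm_coeff [n] [m] lam \<le> plethysm_coeff [n + 1] [m] lam') \<and>
         (odd m \<longrightarrow> plethysm_coeff (replicate n 1) [m] lam
                    \<le> plethysm_coeff (replicate (n + 1) 1) [m] lam')"
proof -
  \<comment> \<open>For q = 0 the first formula also gives \<open>m # lam\<close>.\<close>
  have lam': "lam' = take q lam @ [m] @ drop q lam" using assms(5) by simp
  have s: "sorted_wrt (\<ge>) lam" using assms(3) by (simp add: is_partition_of_def)
  \<comment> \<open>The part after the last one is 0, so the \<open>LEAST\<close> has a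
    candidate.\<close>
  have "part lam (length lam + 1) \<le> m" by (simp add: Defs.part_def)
  hence "part lam (q + 1) \<le> m"
    unfolding assms(4) using LeastI[of "\<lambda>k. 0 \<le> part lam (k + 1) \<and> part lam (k + 1) \<le> m" "length lam"] by simp
  hence qle: "lam ! q \<le> m" if "q < length lam" using that by (simp add: Defs.part_def)
  have qgt: "m < lam ! j" if "j < q" for j
  proof -
    have "\<not> part lam (j + 1) \<le> m" using that not_less_Least[of j] unfolding assms(4) by blast
    thus ?thesis by (auto simp: Defs.part_def split: if_splits)
  qed
  have "sorted_wrt (\<ge>) lam'"
  proof -
    have "x \<ge> m" if x: "x \<in> set (take q lam)" for x
    proof -
      from x obtain j where "j < q" "j < length lam" "x = lam ! j" by (auto simp: in_set_conv_nth)
      thus ?thesis using qgt[of j] by simp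
    qed
    moreover have "x \<le> m" if x: "x \<in> set (drop q lam)" for x
    proof -
      from x obtain j where "j < length (drop q lam)" "drop q lam ! j = x" unfolding in_set_conv_nth by blast
      hence j: "q + j < length lam" "x = lam ! (q + j)" by auto
      hence "lam ! (q + j) \<le> lam ! q" using s by (cases "j = 0") (auto simp: sorted_wrt_iff_nth_less)
      thus ?thesis using j qle by simp
    qed
    moreover have "sorted_wrt (\<ge>) (take q lam)" "sorted_wrt (\<ge>) (drop q lam)"
      using s by (simp_all add: sorted_wrt_take sorted_wrt_drop)
    ultimately show ?thesis unfolding lam' by (force simp: sorted_wrt_append intro: order_trans)
  qed
  moreover have "sum_list lam' = m * (n + 1)"
  proof -
    have "sum_list (take q lam) + sum_list (drop q lam) = m * n"
      using assms(3) by (metis append_take_drop_id is_partition_of_def sum_list_append)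
    thus ?thesis by (simp add: lam')
  qed
  moreover have "\<forall>k\<in>set lam'. 0 < k"
    using assms(1,3) by (auto simp: lam' is_partition_of_def dest: in_set_takeD in_set_dropD)
  ultimately have part': "is_partition_of lam' (m * (n + 1))" by (simp add: is_partition_of_def)
  \<comment> \<open>A conjugate part counts the parts exceeding i wherever they stand, and the
    inserted part m exceeds i iff i < m.\<close>
  have "conj_ptn (pf lam') i = conj_ptn (pf lam) i + (if i < m then 1 else 0)" for i
  proof -
    have "length (filter (\<lambda>k. i < k) lam) = length (filter (\<lambda>k. i < k) (take q lam)) + length (filter (\<lambda>k. i < k) (drop q lam))"
      by (metis append_take_drop_id filter_append length_append)
    thus ?thesis by (simp add: conj_ptn_pf lam')
  qed
  hence le: "pcoef m n (pf lam) \<le> pcoef m (n + 1) (pf lam')"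
    using pcoef_mono[of "pf lam" m n "pf lam'"] assms(3)
    by (simp add: is_partition_of_def ptn_pf psize_pf)
  show ?thesis
  proof (cases "even m")
    case True
    thus ?thesis using le
        plethysm_coeff_eq_pcoef[OF _ assms(3), of "[n]"] plethysm_coeff_eq_pcoef[OF _ part', of "[n + 1]"]
      by simp
  next
    case False
    have "plethysm_coeff (replicate n 1) [m] lam = pcoef m n (pf lam)"
      by (rule plethysm_coeff_eq_pcoef[OF _ assms(3)]) (simp only: False if_False)
    moreover have "plethysm_coeff (replicate (n + 1) 1) [m] lam' = pcoef m (n + 1) (pf lam')"
      by (rule plethysm_coeff_eq_pcoef[OF _ part']) (simp only: False if_False)
    ultimately show ?thesis using le False by (simp only: simp_thms)
  qed
qed

end
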